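(* With the notation of the context, for an extended target with unknown contour (vectors $\mathbf m$ and $\mathbf n$ unknown) at a sufficiently long range $\mathring d$, the following approximate relationships hold true for the hybrid Cramér–Rao bounds $C(\mathring d)$, $C(\mathring\phi)$, $C(\varphi)$ of $\mathring d,\mathring\phi,\varphi$: $$C(\mathring d)\approx C_{\mathrm{p.t.}}(\mathring d)\Big(\|w\|_\star^{-2}\big\|\operatorname{P}_{\mathcal B}^\perp(w,0)\big\|_\star^2\Big)^{-1},$$ $$C(\mathring\phi)\approx C_{\mathrm{p.t.}}(\mathring\phi),$$ $$C(\varphi)\approx C_{\mathrm{p.t.}}(\mathring\phi)+\Big(2\frac{E}{N_0}\Big)^{-1}\Big(\|w\|_\star^{-2}\big\|\operatorname{P}_{\mathcal D}^\perp\big(\sqrt L\,w\,\bar{\mathbf p}_\perp^{\mathsf T}\mathbf R\boldsymbol\rho,\ (\alpha+1)\operatorname{P}_w^\perp(v)\big)\big\|_\star^2\Big)^{-1},$$ where $C_{\mathrm{p.t.}}(\mathring d)=(2E/N_0)^{-1}L^{-1}$ and $C_{\mathrm{p.t.}}(\mathring\phi)=(2E/N_0)^{-1}Z^{-1}$, with $Z=M\cos^2\mathring\phi$, are the Cramér–Rao bounds of range and direction for a point-like target with the same received energy $E$, and $$\mathcal A=\operatorname{span}\big\{(\sqrt L\,w\,s_q,(1+\alpha)t_q)\big\}_{q=1}^{2Q},\quad \mathcal B=\operatorname{span}\big\{\mathcal A,(\sqrt L\,w\,\bar{\mathbf p}_\perp^{\mathsf T}\mathbf R\boldsymbol\rho,(1+\alpha)\operatorname{P}_w^\perp(v))\big\},\quad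 \mathcal D=\operatorname{span}\big\{\mathcal A,(\sqrt L\,w,0)\big\}.$$
   Context: Contour. Let $\mathbf m=[a_1,\dots,a_Q]^{\mathsf T}$, $\mathbf n=[b_1,\dots,b_Q]^{\mathsf T}\in\mathbb R^Q$ with $a_1,b_1>0$, $\boldsymbol\sigma(u)=[\cos u,\dots,\cos Qu]^{\mathsf T}$, $\boldsymbol\varsigma(u)=[\sin u,\dots,\sin Qu]^{\mathsf T}$, $\boldsymbol\rho(u)=[\boldsymbol\sigma^{\mathsf T}\mathbf m,\ \boldsymbol\varsigma^{\mathsf T}\mathbf n]^{\mathsf T}$ for $0\le u<2\pi$. The target (seen by a radar at the origin) has center $\mathbf p=[\mathring d\cos\mathring\phi,\ \mathring d\sin\mathring\phi]^{\mathsf T}$ and orientation $\varphi$; $\mathbf R=\begin{bmatrix}\cos\varphi&-\sin\varphi\\ \sin\varphi&\cos\varphi\end{bmatrix}$ and the contour is $\mathbf r(u)=\mathbf p+\mathbf R\boldsymbol\rho(u)$. A dot denotes $\partial/\partial u$. Let $d(u)=\|\mathbf r(u)\|$, $\phi(u)$ the polar angle of $\mathbf r(u)$, $\beta(u)$ the polar angle of $\dot{\mathbf r}(u)$. For $\mathbf x\in\mathbb R^2$, $\mathbf x_\perp=\left(\begin{smallmatrix}0&-1\\1&0\end{smallmatrix}\right)\mathbf x$; $\|\cdot\|$ is the Euclidean norm, $\bar{\mathbf p}=\mathbf p/\|\mathbf p\|$, $\bar{\mathbf p}_\perp=\mathbf p_\perp/\|\mathbf p_\perp\|$. Parameters: $\boldsymbol\gamma=[\mathring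 d,\mathring\phi,\varphi,a_1,\dots,a_Q,b_1,\dots,b_Q]^{\mathsf T}$; $\boldsymbol\mu=\partial d/\partial\boldsymbol\gamma$, $\boldsymbol\eta=\partial\phi/\partial\boldsymbol\gamma$, $\boldsymbol\xi=\boldsymbol\eta-\partial\beta/\partial\boldsymbol\gamma$ (functions of $u$). With $\overline{\sin}\,x=\max(\sin x,0)$ and $\alpha$ the known surface roughness, $w=(\overline{\sin}(\phi-\beta))^{\alpha+1}$, $v=(\overline{\sin}(\phi-\beta))^{\alpha}\cos(\phi-\beta)$. Star product: $\langle f_1,f_2\rangle_\star=\int_0^{2\pi}f_1f_2\|\dot{\mathbf r}(u)\|\,du$, $\|f\|_\star=\langle f,f\rangle_\star^{1/2}$; for vector functions $\langle\mathbf f_1,\mathbf f_2\rangle_\star=\int_0^{2\pi}\mathbf f_1\mathbf f_2^{\mathsf T}\|\dot{\mathbf r}\|\,du$. $\operatorname{P}_w^\perp(\mathbf f)=\mathbf f-\langle\mathbf f,w\rangle_\star\langle w,w\rangle_\star^{-1}w$. On $L^2([0,2\pi])\times L^2([0,2\pi])$, $\langle(f_1,f_2),(g_1,g_2)\rangle_\star=\langle f_1,g_1\rangle_\star+\langle f_2,g_2\rangle_\star$ with induced norm $\|\cdot\|_\star$; for a subspace $\mathcal S$ spanned by finitely many pairs, $\operatorname{P}_{\mathcal S}$ is the orthogonal projection onto $\mathcal S$ for this inner product and $\operatorname{P}_{\mathcal S}^\perp(f_1,f_2)=(f_1,f_2)-\operatorname{P}_{\mathcal S}(f_1,f_2)$.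 The functions $s_q,t_q$ ($q=1,\dots,2Q$) are the components of $$\mathbf s=\begin{bmatrix}([1\ 0]\mathbf R^{\mathsf T}\bar{\mathbf p})\,\boldsymbol\sigma\\ ([0\ 1]\mathbf R^{\mathsf T}\bar{\mathbf p})\,\boldsymbol\varsigma\end{bmatrix},\qquad \mathbf t=\operatorname{P}_w^\perp\!\left(v\,\|\dot{\boldsymbol\rho}\|^{-2}\begin{bmatrix}(\dot{\boldsymbol\varsigma}^{\mathsf T}\mathbf n)\,\dot{\boldsymbol\sigma}\\ -(\dot{\boldsymbol\sigma}^{\mathsf T}\mathbf m)\,\dot{\boldsymbol\varsigma}\end{bmatrix}\right).$$ Constants: $N$ is the number of antennas of the radar's uniform linear array, $N_0$ the noise power spectral density, $B_{\mathrm{RMS}}$ the effective signal bandwidth, $c$ the speed of light, $L=(4\pi B_{\mathrm{RMS}}/c)^2$, $M=\pi^2(N^2-1)/12$; the channel gain is $g=\sqrt G/\mathring d^2$ with $G$ a constant, and $E\approx g^2N\|w\|_\star^2$ is the received energy. Effective Fisher information matrix of $\boldsymbol\gamma$: $$\mathbf J(\boldsymbol\gamma)=\frac1{\|w\|_\star^2}\frac{2E}{N_0}\Big[L\langle w\boldsymbol\mu,w\boldsymbol\mu\rangle_\star+M\langle w\cos\phi\,\boldsymbol\eta,w\cos\phi\,\boldsymbol\eta\rangle_\star+(\alpha+1)^2\langle\operatorname{P}_w^\perp(v\boldsymbol\xi),\operatorname{P}_w^\perp(v\boldsymbol\xi)\rangle_\star\Big].$$ When the contour is unknown, $C(\mathring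 d),C(\mathring\phi),C(\varphi)$ are the first three diagonal entries of $\mathbf J(\boldsymbol\gamma)^{-1}$. *)

theory Defs
  imports
    "HOL-Analysis.Analysis"
    "HOL-Library.Landau_Symbols"
    "Jordan_Normal_Form.Gauss_Jordan_Elimination"
begin

(* The plane is real \<times> real, whose library norm and inner product are the Euclidean ones;
   the library function sgn normalises a nonzero vector: sgn x = x /\<^sub>R norm x. *)

definition perp :: "real \<times> real \<Rightarrow> real \<times> real" where
  "perp x = (- snd x, fst x)"

definition rot :: "real \<Rightarrow> real \<times> real \<Rightarrow> real \<times> real" where
  "rot \<theta> x = (cos \<theta> * fst x - sin \<theta> * snd x, sin \<theta> * fst x + cos \<theta> * snd x)"

definition rot_transpose :: "real \<Rightarrow> real \<times> real \<Rightarrow> real \<times> real" where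
  "rot_transpose \<theta> x = (cos \<theta> * fst x + sin \<theta> * snd x, - sin \<theta> * fst x + cos \<theta> * snd x)"

definition to_complex :: "real \<times> real \<Rightarrow> complex" where
  "to_complex x = Complex (fst x) (snd x)"

definition polar_angle :: "real \<times> real \<Rightarrow> real" where
  "polar_angle x = Arg (to_complex x)"

(* A parameter vector \<gamma> has the 3 + 2 Q entries
     \<gamma> 0 = range of the centre, \<gamma> 1 = direction of the centre, \<gamma> 2 = orientation,
     \<gamma> 3, ..., \<gamma> (2 + Q) = a_1, ..., a_Q,  \<gamma> (3 + Q), ..., \<gamma> (2 + 2 Q) = b_1, ..., b_Q;
   the values of \<gamma> at larger indices are never used. *)

definition coeff_a :: "(nat \<Rightarrow> real) \<Rightarrow> nat \<Rightarrow> real" where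
  "coeff_a \<gamma> q = \<gamma> (2 + q)"

definition coeff_b :: "nat \<Rightarrow> (nat \<Rightarrow> real) \<Rightarrow> nat \<Rightarrow> real" where
  "coeff_b Q \<gamma> q = \<gamma> (2 + Q + q)"

definition partial :: "((nat \<Rightarrow> real) \<Rightarrow> real) \<Rightarrow> (nat \<Rightarrow> real) \<Rightarrow> nat \<Rightarrow> real" where
  "partial f \<gamma> i = deriv (\<lambda>t. f (\<gamma>(i := t))) (\<gamma> i)"

(* Partial derivative of the polar angle of z.  A polar angle is determined only modulo 2 \<pi>, and
   Arg jumps at the negative real axis.  The increment from \<gamma> to \<gamma>' of any branch that is continuous
   near z \<gamma> is Arg (z \<gamma>' / z \<gamma>), so this is the derivative of such a branch, also when z \<gamma> lies
   on the cut of Arg. *)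
definition partial_angle ::
    "((nat \<Rightarrow> real) \<Rightarrow> real \<times> real) \<Rightarrow> (nat \<Rightarrow> real) \<Rightarrow> nat \<Rightarrow> real" where
  "partial_angle z \<gamma> i = partial (\<lambda>\<gamma>'. Arg (to_complex (z \<gamma>') / to_complex (z \<gamma>))) \<gamma> i"

definition sigma :: "nat \<Rightarrow> real \<Rightarrow> real" where
  "sigma q u = cos (real q * u)"

definition varsigma :: "nat \<Rightarrow> real \<Rightarrow> real" where
  "varsigma q u = sin (real q * u)"

definition rho :: "nat \<Rightarrow> (nat \<Rightarrow> real) \<Rightarrow> real \<Rightarrow> real \<times> real" where
  "rho Q \<gamma> u = (\<Sum>q=1..Q. sigma q u * coeff_a \<gamma> q, \<Sum>q=1..Q. varsigma q u * coeff_b Q \<gamma> q)"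

definition rho_dot :: "nat \<Rightarrow> (nat \<Rightarrow> real) \<Rightarrow> real \<Rightarrow> real \<times> real" where
  "rho_dot Q \<gamma> u = vector_derivative (rho Q \<gamma>) (at u)"

definition centre :: "(nat \<Rightarrow> real) \<Rightarrow> real \<times> real" where
  "centre \<gamma> = (\<gamma> 0 * cos (\<gamma> 1), \<gamma> 0 * sin (\<gamma> 1))"

definition contour :: "nat \<Rightarrow> (nat \<Rightarrow> real) \<Rightarrow> real \<Rightarrow> real \<times> real" where
  "contour Q \<gamma> u = centre \<gamma> + rot (\<gamma> 2) (rho Q \<gamma> u)"

definition contour_dot :: "nat \<Rightarrow> (nat \<Rightarrow> real) \<Rightarrow> real \<Rightarrow> real \<times> real" where
  "contour_dot Q \<gamma> u = vector_derivative (contour Q \<gamma>) (at u)"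

definition distance :: "nat \<Rightarrow> (nat \<Rightarrow> real) \<Rightarrow> real \<Rightarrow> real" where
  "distance Q \<gamma> u = norm (contour Q \<gamma> u)"

definition phi :: "nat \<Rightarrow> (nat \<Rightarrow> real) \<Rightarrow> real \<Rightarrow> real" where
  "phi Q \<gamma> u = polar_angle (contour Q \<gamma> u)"

definition beta :: "nat \<Rightarrow> (nat \<Rightarrow> real) \<Rightarrow> real \<Rightarrow> real" where
  "beta Q \<gamma> u = polar_angle (contour_dot Q \<gamma> u)"

definition mu :: "nat \<Rightarrow> (nat \<Rightarrow> real) \<Rightarrow> nat \<Rightarrow> real \<Rightarrow> real" where
  "mu Q \<gamma> i u = partial (\<lambda>\<gamma>'. distance Q \<gamma>' u) \<gamma> i"

definition eta :: "nat \<Rightarrow> (nat \<Rightarrow> real) \<Rightarrow> nat \<Rightarrow> real \<Rightarrow> real" where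
  "eta Q \<gamma> i u = partial_angle (\<lambda>\<gamma>'. contour Q \<gamma>' u) \<gamma> i"

definition xi :: "nat \<Rightarrow> (nat \<Rightarrow> real) \<Rightarrow> nat \<Rightarrow> real \<Rightarrow> real" where
  "xi Q \<gamma> i u = eta Q \<gamma> i u - partial_angle (\<lambda>\<gamma>'. contour_dot Q \<gamma>' u) \<gamma> i"

definition sin_bar :: "real \<Rightarrow> real" where
  "sin_bar x = max (sin x) 0"

definition w_fun :: "nat \<Rightarrow> real \<Rightarrow> (nat \<Rightarrow> real) \<Rightarrow> real \<Rightarrow> real" where
  "w_fun Q \<alpha> \<gamma> u = sin_bar (phi Q \<gamma> u - beta Q \<gamma> u) powr (\<alpha> + 1)"

(* Since 0 powr 0 = 0, for \<alpha> = 0 the function v vanishes on the part of the contour that is not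
   visible from the origin, as it does for every \<alpha> > 0. *)
definition v_fun :: "nat \<Rightarrow> real \<Rightarrow> (nat \<Rightarrow> real) \<Rightarrow> real \<Rightarrow> real" where
  "v_fun Q \<alpha> \<gamma> u =
     sin_bar (phi Q \<gamma> u - beta Q \<gamma> u) powr \<alpha> * cos (phi Q \<gamma> u - beta Q \<gamma> u)"

definition star_inner ::
    "nat \<Rightarrow> (nat \<Rightarrow> real) \<Rightarrow> (real \<Rightarrow> real) \<Rightarrow> (real \<Rightarrow> real) \<Rightarrow> real" where
  "star_inner Q \<gamma> f g = (LBINT u:{0..2*pi}. f u * g u * norm (contour_dot Q \<gamma> u))"

definition star_norm :: "nat \<Rightarrow> (nat \<Rightarrow> real) \<Rightarrow> (real \<Rightarrow> real) \<Rightarrow> real" where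
  "star_norm Q \<gamma> f = sqrt (star_inner Q \<gamma> f f)"

definition proj_perp_w ::
    "nat \<Rightarrow> real \<Rightarrow> (nat \<Rightarrow> real) \<Rightarrow> (real \<Rightarrow> real) \<Rightarrow> real \<Rightarrow> real" where
  "proj_perp_w Q \<alpha> \<gamma> f = (\<lambda>u. f u -
     star_inner Q \<gamma> f (w_fun Q \<alpha> \<gamma>) / star_inner Q \<gamma> (w_fun Q \<alpha> \<gamma>) (w_fun Q \<alpha> \<gamma>) * w_fun Q \<alpha> \<gamma> u)"

type_synonym fun_pair = "(real \<Rightarrow> real) \<times> (real \<Rightarrow> real)"

definition pair_inner :: "nat \<Rightarrow> (nat \<Rightarrow> real) \<Rightarrow> fun_pair \<Rightarrow> fun_pair \<Rightarrow> real" where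
  "pair_inner Q \<gamma> f g = star_inner Q \<gamma> (fst f) (fst g) + star_inner Q \<gamma> (snd f) (snd g)"

definition pair_norm :: "nat \<Rightarrow> (nat \<Rightarrow> real) \<Rightarrow> fun_pair \<Rightarrow> real" where
  "pair_norm Q \<gamma> f = sqrt (pair_inner Q \<gamma> f f)"

definition pair_diff :: "fun_pair \<Rightarrow> fun_pair \<Rightarrow> fun_pair" where
  "pair_diff f g = (\<lambda>u. fst f u - fst g u, \<lambda>u. snd f u - snd g u)"

(* Used for finite H only. *)
definition pair_span :: "fun_pair set \<Rightarrow> fun_pair set" where
  "pair_span H = {(\<lambda>u. \<Sum>h\<in>H. k h * fst h u, \<lambda>u. \<Sum>h\<in>H. k h * snd h u) | k. True}"

(* The element g of S with f - g orthogonal to S.  It is unique only up to equality almost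
   everywhere (pairs of functions stand for their L^2 classes), which does not affect pair_norm. *)
definition pair_proj :: "nat \<Rightarrow> (nat \<Rightarrow> real) \<Rightarrow> fun_pair set \<Rightarrow> fun_pair \<Rightarrow> fun_pair" where
  "pair_proj Q \<gamma> S f = (SOME g. g \<in> S \<and> (\<forall>h\<in>S. pair_inner Q \<gamma> (pair_diff f g) h = 0))"

definition pair_proj_perp :: "nat \<Rightarrow> (nat \<Rightarrow> real) \<Rightarrow> fun_pair set \<Rightarrow> fun_pair \<Rightarrow> fun_pair" where
  "pair_proj_perp Q \<gamma> S f = pair_diff f (pair_proj Q \<gamma> S f)"

(* In s_fun and t_fun the index q runs over 1..2Q. *)
definition s_fun :: "nat \<Rightarrow> (nat \<Rightarrow> real) \<Rightarrow> nat \<Rightarrow> real \<Rightarrow> real" where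
  "s_fun Q \<gamma> q u =
     (if q \<le> Q then fst (rot_transpose (\<gamma> 2) (sgn (centre \<gamma>))) * sigma q u
      else snd (rot_transpose (\<gamma> 2) (sgn (centre \<gamma>))) * varsigma (q - Q) u)"

(* The components of rho_dot are the derivatives of sigma^T m and varsigma^T n. *)
definition t_fun :: "nat \<Rightarrow> real \<Rightarrow> (nat \<Rightarrow> real) \<Rightarrow> nat \<Rightarrow> real \<Rightarrow> real" where
  "t_fun Q \<alpha> \<gamma> q = proj_perp_w Q \<alpha> \<gamma> (\<lambda>u. v_fun Q \<alpha> \<gamma> u / (norm (rho_dot Q \<gamma> u))\<^sup>2 *
     (if q \<le> Q then snd (rho_dot Q \<gamma> u) * deriv (sigma q) u
      else - fst (rho_dot Q \<gamma> u) * deriv (varsigma (q - Q)) u))"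

definition cross_range :: "nat \<Rightarrow> (nat \<Rightarrow> real) \<Rightarrow> real \<Rightarrow> real" where
  "cross_range Q \<gamma> u = inner (sgn (perp (centre \<gamma>))) (rot (\<gamma> 2) (rho Q \<gamma> u))"

definition gens_A :: "nat \<Rightarrow> real \<Rightarrow> real \<Rightarrow> (nat \<Rightarrow> real) \<Rightarrow> fun_pair set" where
  "gens_A Q \<alpha> L \<gamma> = (\<lambda>q. (\<lambda>u. sqrt L * w_fun Q \<alpha> \<gamma> u * s_fun Q \<gamma> q u,
                          \<lambda>u. (1 + \<alpha>) * t_fun Q \<alpha> \<gamma> q u)) ` {1..2 * Q}"

definition pair_range :: "nat \<Rightarrow> real \<Rightarrow> real \<Rightarrow> (nat \<Rightarrow> real) \<Rightarrow> fun_pair" where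
  "pair_range Q \<alpha> L \<gamma> = (\<lambda>u. sqrt L * w_fun Q \<alpha> \<gamma> u, \<lambda>u. 0)"

definition pair_orient :: "nat \<Rightarrow> real \<Rightarrow> real \<Rightarrow> (nat \<Rightarrow> real) \<Rightarrow> fun_pair" where
  "pair_orient Q \<alpha> L \<gamma> = (\<lambda>u. sqrt L * w_fun Q \<alpha> \<gamma> u * cross_range Q \<gamma> u,
                          \<lambda>u. (\<alpha> + 1) * proj_perp_w Q \<alpha> \<gamma> (v_fun Q \<alpha> \<gamma>) u)"

definition space_B :: "nat \<Rightarrow> real \<Rightarrow> real \<Rightarrow> (nat \<Rightarrow> real) \<Rightarrow> fun_pair set" where
  "space_B Q \<alpha> L \<gamma> = pair_span (insert (pair_orient Q \<alpha> L \<gamma>) (gens_A Q \<alpha> L \<gamma>))"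

definition space_D :: "nat \<Rightarrow> real \<Rightarrow> real \<Rightarrow> (nat \<Rightarrow> real) \<Rightarrow> fun_pair set" where
  "space_D Q \<alpha> L \<gamma> = pair_span (insert (pair_range Q \<alpha> L \<gamma>) (gens_A Q \<alpha> L \<gamma>))"

definition fisher_matrix ::
    "nat \<Rightarrow> real \<Rightarrow> real \<Rightarrow> real \<Rightarrow> real \<Rightarrow> real \<Rightarrow> (nat \<Rightarrow> real) \<Rightarrow> real mat" where
  "fisher_matrix Q \<alpha> L M N0 E \<gamma> =
     (let w = w_fun Q \<alpha> \<gamma>; v = v_fun Q \<alpha> \<gamma>; P = proj_perp_w Q \<alpha> \<gamma>
      in Matrix.mat (3 + 2 * Q) (3 + 2 * Q) (\<lambda>(i, j).
        1 / (star_norm Q \<gamma> w)\<^sup>2 * (2 * E / N0) *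
        (L * star_inner Q \<gamma> (\<lambda>u. w u * mu Q \<gamma> i u) (\<lambda>u. w u * mu Q \<gamma> j u)
         + M * star_inner Q \<gamma> (\<lambda>u. w u * cos (phi Q \<gamma> u) * eta Q \<gamma> i u)
                              (\<lambda>u. w u * cos (phi Q \<gamma> u) * eta Q \<gamma> j u)
         + (\<alpha> + 1)\<^sup>2 * star_inner Q \<gamma> (P (\<lambda>u. v u * xi Q \<gamma> i u)) (P (\<lambda>u. v u * xi Q \<gamma> j u)))))"

(* The bound for the parameter with index i; mat_inverse is None exactly for singular matrices. *)
definition cramer_rao ::
    "nat \<Rightarrow> real \<Rightarrow> real \<Rightarrow> real \<Rightarrow> real \<Rightarrow> real \<Rightarrow> (nat \<Rightarrow> real) \<Rightarrow> nat \<Rightarrow> real" where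
  "cramer_rao Q \<alpha> L M N0 E \<gamma> i = the (mat_inverse (fisher_matrix Q \<alpha> L M N0 E \<gamma>)) $$ (i, i)"

definition point_range_bound :: "real \<Rightarrow> real \<Rightarrow> real \<Rightarrow> real" where
  "point_range_bound L N0 E = inverse (2 * E / N0) * inverse L"

definition point_direction_bound :: "real \<Rightarrow> real \<Rightarrow> real \<Rightarrow> real \<Rightarrow> real" where
  "point_direction_bound M dir N0 E = inverse (2 * E / N0) * inverse (M * (cos dir)\<^sup>2)"

end

(* Multiplying the Fisher matrix by a constant turns it into the Gram matrix of one feature per
   parameter.  Rotating the whole configuration about the radar changes neither the distances nor
   the aspect angle, so the features of direction and orientation are opposite up to a term in the
   angular component.  As the range grows, the features converge and that angular term becomes
   orthogonal to everything else; the limiting matrix is the Gram matrix of the pairs that define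
   the spaces B and D, bordered by an independent entry for the direction.  Diagonal entries of its
   inverse are reciprocals of squared distances, and inversion is continuous.

   What remains is that the limiting pairs are linearly independent.  On the visible part of the
   contour a linear relation amounts to two identities between trigonometric polynomials, which
   extend to the whole circle.  The one for the angular parts carries a multiple of w; evaluated at
   a point whose tangent is perpendicular to the line of sight, it shows that the multiple vanishes,
   and comparing coefficients gives the rest. *)

theory Submission
  imports Defs "Jordan_Normal_Form.Determinant" "HOL-Complex_Analysis.Complex_Analysis"
begin

section \<open>Inverse matrices\<close>

text \<open>Both sides of each relation vary with the range: the bounds grow like its fourth power
  because \<open>E\<close> decays, and on the right the spaces, w and v are taken at the same finite
  range. So neither side has a limit that could be compared directly. The factor
  \<open>||w||^2 / (2 E / N0)\<close> is split off on both sides; what remains is an entry of the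
  inverse of the normalised Fisher matrix on the left, and an entry of the inverse Gram matrix at
  range d, a direction term, or their sum on the right. The two remainders tend to the same nonzero
  number. No parameter is rescaled: the derivative of the distance with respect to the direction
  stays bounded, since the factor d in it cancels exactly. The visible part of the contour moves
  with the range, and for \<alpha> = 0 the function v jumps at its edge. Convergence is therefore
  only almost everywhere, and the edge has to be a null set. This comes from the finiteness of the
  zeros of an entire function; the same analyticity carries identities beyond the visible part, so
  no convexity of the contour enters.\<close>

lemma mat_inverse_eqI:
  fixes A :: "'a :: field mat"
  assumes A: "A \<in> carrier_mat n n" and B: "B \<in> carrier_mat n n" and AB: "A * B = 1\<^sub>m n"
  shows "the (mat_inverse A) = B"
proof (cases "mat_inverse A")
  case None
  have "B * A = 1\<^sub>m n" by (rule mat_mult_left_right_inverse[OF A B AB])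
  then have "A \<in> Units (ring_mat TYPE('a) n ())"
    using A B AB by (auto simp: Units_def ring_mat_def)
  with mat_inverse(1)[OF A None, of "()"] show ?thesis by blast
next
  case (Some C)
  from mat_inverse(2)[OF A this] have C: "C * A = 1\<^sub>m n" "C \<in> carrier_mat n n" by auto
  have "C = C * (A * B)" using C AB by simp
  also have "\<dots> = (C * A) * B" by (rule assoc_mult_mat[symmetric, OF C(2) A B])
  also have "\<dots> = B" using C B by simp
  finally show ?thesis using Some by simp
qed

text \<open>Evaluates \<open>cramer_rao\<close>: \<open>c\<close> becomes the scalar in front of the
  Fisher matrix, and \<open>B\<close> a right inverse obtained elsewhere as a function of indices.
  For square matrices over a field a right inverse is the inverse, which
  \<open>the (mat_inverse _)\<close> returns.\<close>

lemma mat_inverse_entry: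
  fixes f :: "nat \<Rightarrow> nat \<Rightarrow> 'a :: field"
  assumes inv: "\<And>i k. i < n \<Longrightarrow> k < n \<Longrightarrow> (\<Sum>j<n. f i j * B j k) = of_bool (i = k)"
    and c: "c \<noteq> 0" and "i < n" "k < n"
  shows "the (mat_inverse (Matrix.mat n n (\<lambda>(i, j). c * f i j))) $$ (i, k) = B i k / c"
proof -
  have "the (mat_inverse (Matrix.mat n n (\<lambda>(i, j). c * f i j)))
      = Matrix.mat n n (\<lambda>(i, j). B i j / c)"
  proof (rule mat_inverse_eqI)
    show "Matrix.mat n n (\<lambda>(i, j). c * f i j) * Matrix.mat n n (\<lambda>(i, j). B i j / c) = 1\<^sub>m n"
      by (rule eq_matI) (use c in \<open>auto simp: scalar_prod_def inv lessThan_atLeast0[symmetric]\<close>)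
  qed auto
  then show ?thesis using assms by simp
qed

text \<open>By the Leibniz formula the determinant is a polynomial in the entries.\<close>

lemma tendsto_det:
  fixes f :: "'b \<Rightarrow> nat \<Rightarrow> nat \<Rightarrow> real"
  assumes "\<And>i j. i < n \<Longrightarrow> j < n \<Longrightarrow> ((\<lambda>d. f d i j) \<longlongrightarrow> g i j) F"
  shows "((\<lambda>d. Determinant.det (Matrix.mat n n (\<lambda>(i, j). f d i j))) \<longlongrightarrow>
    Determinant.det (Matrix.mat n n (\<lambda>(i, j). g i j))) F"
proof -
  have *: "Determinant.det (Matrix.mat n n (\<lambda>(i, j). h i j)) =
      (\<Sum>p \<in> {p. p permutes {0..<n}}. signof p * (\<Prod>i = 0..<n. h i (p i)))"
    for h :: "nat \<Rightarrow> nat \<Rightarrow> real"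
    by (subst det_def', auto intro!: sum.cong prod.cong)
  show ?thesis unfolding *
    by (intro tendsto_sum tendsto_mult tendsto_const tendsto_prod assms) auto
qed

lemma tendsto_adj_mat:
  fixes f :: "'b \<Rightarrow> nat \<Rightarrow> nat \<Rightarrow> real"
  assumes "\<And>i j. i < n \<Longrightarrow> j < n \<Longrightarrow> ((\<lambda>d. f d i j) \<longlongrightarrow> g i j) F"
    and ij: "i < n" "j < n"
  shows "((\<lambda>d. adj_mat (Matrix.mat n n (\<lambda>(i, j). f d i j)) $$ (i, j)) \<longlongrightarrow>
    adj_mat (Matrix.mat n n (\<lambda>(i, j). g i j)) $$ (i, j)) F"
proof -
  \<comment> \<open>\<open>?s k\<close> enumerates the indices other than \<open>k\<close>, so a
    minor is again a matrix given by an entry function and \<open>tendsto_det\<close> applies to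
    it.\<close>
  let ?s = "\<lambda>i i'. if i' < i then i' else Suc i'"
  have *: "adj_mat (Matrix.mat n n (\<lambda>(i, j). h i j)) $$ (i, j) = (-1) ^ (j + i) *
      Determinant.det (Matrix.mat (n - 1) (n - 1) (\<lambda>(i', j'). h (?s j i') (?s i j')))"
    for h :: "nat \<Rightarrow> nat \<Rightarrow> real"
  proof -
    have "mat_delete (Matrix.mat n n (\<lambda>(i, j). h i j)) j i
        = Matrix.mat (n - 1) (n - 1) (\<lambda>(i', j'). h (?s j i') (?s i j'))"
      by (rule eq_matI) (auto simp: mat_delete_def)
    then show ?thesis using ij by (simp add: adj_mat_def cofactor_def)
  qed
  show ?thesis unfolding *
    by (intro tendsto_mult tendsto_const tendsto_det[of "n - 1"
          "\<lambda>d i' j'. f d (?s j i') (?s i j')" "\<lambda>i' j'. g (?s j i') (?s i j')"] assms(1)) auto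
qed

text \<open>Adjugate over determinant: both are continuous in the entries, and injectivity of the
  limit keeps the determinant away from zero. The matrices \<open>f d\<close> may be singular at
  first, hence the eventual statement. The inverses are handed over as entry functions, so that all
  later algebra consists of sums over indices.\<close>

lemma inverse_entries_tendsto:
  fixes f :: "'b \<Rightarrow> nat \<Rightarrow> nat \<Rightarrow> real"
  assumes lim: "\<And>i j. i < n \<Longrightarrow> j < n \<Longrightarrow> ((\<lambda>d. f d i j) \<longlongrightarrow> g i j) F"
    and inj: "\<And>v. (\<And>i. i < n \<Longrightarrow> (\<Sum>j<n. g i j * v j) = 0) \<Longrightarrow> (\<And>j. j < n \<Longrightarrow> v j = 0)"
  obtains B Bd where
    "\<And>i k. i < n \<Longrightarrow> k < n \<Longrightarrow> (\<Sum>j<n. g i j * B j k) = of_bool (i = k)"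
    "\<forall>\<^sub>F d in F. \<forall>i<n. \<forall>k<n. (\<Sum>j<n. f d i j * Bd d j k) = of_bool (i = k)"
    "\<And>i k. i < n \<Longrightarrow> k < n \<Longrightarrow> ((\<lambda>d. Bd d i k) \<longlongrightarrow> B i k) F"
proof -
  define M where "M h = Matrix.mat n n (\<lambda>(i, j). h i j)" for h :: "nat \<Rightarrow> nat \<Rightarrow> real"
  define I where "I h i j = adj_mat (M h) $$ (i, j) / Determinant.det (M h)"
    for h :: "nat \<Rightarrow> nat \<Rightarrow> real" and i j
  have M: "M h \<in> carrier_mat n n" for h by (simp add: M_def)
  have inv: "(\<Sum>j<n. h i j * I h j k) = of_bool (i = k)"
    if "Determinant.det (M h) \<noteq> 0" "i < n" "k < n" for h i k
  proof -
    have "(\<Sum>j<n. h i j * adj_mat (M h) $$ (j, k)) = (M h * adj_mat (M h)) $$ (i, k)"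
      using that adj_mat(1)[OF M[of h]]
      by (auto simp: M_def scalar_prod_def lessThan_atLeast0)
    also have "\<dots> = of_bool (i = k) * Determinant.det (M h)"
      using that by (simp add: adj_mat(2)[OF M])
    finally have *: "(\<Sum>j<n. h i j * adj_mat (M h) $$ (j, k)) = of_bool (i = k) * Determinant.det (M h)" .
    have "(\<Sum>j<n. h i j * I h j k) = (\<Sum>j<n. h i j * adj_mat (M h) $$ (j, k)) / Determinant.det (M h)"
      by (simp add: I_def sum_divide_distrib)
    then show ?thesis using * that by simp
  qed
  have det: "Determinant.det (M g) \<noteq> 0"
  proof
    assume "Determinant.det (M g) = 0"
    then obtain v where v: "v \<in> carrier_vec n" "v \<noteq> 0\<^sub>v n" "M g *\<^sub>v v = 0\<^sub>v n"
      using det_0_iff_vec_prod_zero[OF M] by auto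
    have "(\<Sum>j<n. g i j * Matrix.vec_index v j) = 0" if "i < n" for i
    proof -
      have "(\<Sum>j<n. g i j * Matrix.vec_index v j) = Matrix.vec_index (M g *\<^sub>v v) i"
        using that v(1) by (auto simp: M_def scalar_prod_def lessThan_atLeast0)
      then show ?thesis using v that by simp
    qed
    then have "Matrix.vec_index v j = 0" if "j < n" for j using inj[of "\<lambda>j. Matrix.vec_index v j"] that by blast
    then have "v = 0\<^sub>v n" using v(1) by (intro eq_vecI) auto
    with v show False by blast
  qed
  have detlim: "((\<lambda>d. Determinant.det (M (f d))) \<longlongrightarrow> Determinant.det (M g)) F"
    unfolding M_def by (rule tendsto_det[OF lim])
  show thesis
  proof (rule that[of "I g" "\<lambda>d. I (f d)"])
    show "(\<Sum>j<n. g i j * I g j k) = of_bool (i = k)" if "i < n" "k < n" for i k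
      using inv det that by blast
    show "\<forall>\<^sub>F d in F. \<forall>i<n. \<forall>k<n. (\<Sum>j<n. f d i j * I (f d) j k) = of_bool (i = k)"
      using tendsto_imp_eventually_ne[OF detlim det] by eventually_elim (use inv in auto)
    show "((\<lambda>d. I (f d) i k) \<longlongrightarrow> I g i k) F" if "i < n" "k < n" for i k
      unfolding I_def using detlim det that
      by (intro tendsto_divide) (auto simp: M_def intro!: tendsto_adj_mat lim)
  qed
qed

section \<open>Trigonometric polynomials\<close>

text \<open>Restrictions of entire functions to the real line. Closure under sums and products
  covers products of trigonometric polynomials without tracking degrees or coefficients.\<close>

definition entire_real :: "(real \<Rightarrow> real) \<Rightarrow> bool" where
  "entire_real f \<longleftrightarrow> (\<exists>F. F holomorphic_on UNIV \<and> (\<forall>u. F (of_real u) = of_real (f u)))"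

lemma entire_realI:
  assumes "F holomorphic_on UNIV" "\<And>u. F (of_real u) = of_real (f u)"
  shows "entire_real f"
  using assms unfolding entire_real_def by blast

named_theorems entire_intros

lemma entire_real_const [entire_intros]: "entire_real (\<lambda>u. k)"
  by (rule entire_realI[of "\<lambda>z. of_real k"]) auto

lemma entire_real_cos [entire_intros]: "entire_real (\<lambda>u. cos (k * u))"
  by (rule entire_realI[of "\<lambda>z. cos (of_real k * z)"])
    (auto intro!: holomorphic_intros simp flip: cos_of_real)

lemma entire_real_sin [entire_intros]: "entire_real (\<lambda>u. sin (k * u))"
  by (rule entire_realI[of "\<lambda>z. sin (of_real k * z)"])
    (auto intro!: holomorphic_intros simp flip: sin_of_real)

lemma entire_real_add [entire_intros]:
  assumes "entire_real f" "entire_real g"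
  shows "entire_real (\<lambda>u. f u + g u)"
proof -
  from assms obtain F G where "F holomorphic_on UNIV" "\<And>u. F (of_real u) = of_real (f u)"
    "G holomorphic_on UNIV" "\<And>u. G (of_real u) = of_real (g u)"
    unfolding entire_real_def by blast
  then show ?thesis
    by (intro entire_realI[of "\<lambda>z. F z + G z"]) (auto intro!: holomorphic_intros)
qed

lemma entire_real_mult [entire_intros]:
  assumes "entire_real f" "entire_real g"
  shows "entire_real (\<lambda>u. f u * g u)"
proof -
  from assms obtain F G where "F holomorphic_on UNIV" "\<And>u. F (of_real u) = of_real (f u)"
    "G holomorphic_on UNIV" "\<And>u. G (of_real u) = of_real (g u)"
    unfolding entire_real_def by blast
  then show ?thesis
    by (intro entire_realI[of "\<lambda>z. F z * G z"]) (auto intro!: holomorphic_intros)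
qed

lemma entire_real_minus [entire_intros]: "entire_real f \<Longrightarrow> entire_real (\<lambda>u. - f u)"
  using entire_real_mult[OF entire_real_const[of "-1"], of f] by simp

lemma entire_real_diff [entire_intros]:
  "entire_real f \<Longrightarrow> entire_real g \<Longrightarrow> entire_real (\<lambda>u. f u - g u)"
  using entire_real_add[OF _ entire_real_minus, of f g] by simp

lemma entire_real_power [entire_intros]: "entire_real f \<Longrightarrow> entire_real (\<lambda>u. f u ^ n)"
  by (induction n) (auto intro: entire_intros)

lemma entire_real_sum [entire_intros]:
  "(\<And>i. i \<in> S \<Longrightarrow> entire_real (f i)) \<Longrightarrow> entire_real (\<lambda>u. \<Sum>i\<in>S. f i u)"
  by (induction S rule: infinite_finite_induct) (auto intro: entire_intros)

text \<open>The identity theorem: an infinite subset of a compact interval has a limit point.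
  Infinitude is therefore all that has to be known about the parameters at which a relation
  holds.\<close>

lemma entire_real_eq_0:
  assumes "entire_real f" and inf: "infinite U" and U: "U \<subseteq> {l..r}" and "\<And>u. u \<in> U \<Longrightarrow> f u = 0"
  shows "f u = 0"
proof -
  obtain F where F: "F holomorphic_on UNIV" "\<And>u. F (of_real u) = of_real (f u)"
    using assms(1) unfolding entire_real_def by blast
  obtain t where t: "t islimpt U"
    using Heine_Borel_imp_Bolzano_Weierstrass[OF compact_Icc inf U] by blast
  have "complex_of_real t islimpt complex_of_real ` U"
    unfolding islimpt_approachable
  proof (intro allI impI)
    fix e :: real assume "e > 0"
    then obtain s where "s \<in> U" "s \<noteq> t" "dist s t < e"
      using t unfolding islimpt_approachable by blast
    then show "\<exists>z\<in>complex_of_real ` U. z \<noteq> complex_of_real t \<and> dist z (complex_of_real t) < e"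
      by (intro bexI[of _ "complex_of_real s"]) (auto simp: dist_of_real)
  qed
  then have "F (of_real u) = 0"
    by (rule analytic_continuation[OF F(1), of "complex_of_real ` U", rotated 4]) (use assms(4) F(2) in auto)
  then show ?thesis using F(2) by simp
qed

lemma entire_real_finite_zeros:
  assumes "entire_real f" "f u \<noteq> 0"
  shows "finite {v \<in> {l..r}. f v = 0}"
proof (rule ccontr)
  assume inf: "infinite {v \<in> {l..r}. f v = 0}"
  have "f u = 0" by (rule entire_real_eq_0[OF assms(1) inf, of l r]) auto
  with assms(2) show False by contradiction
qed

text \<open>Two finite sets of zeros cannot cover an interval; these functions thus form a ring
  without zero divisors.\<close>

lemma entire_real_mult_eq_0:
  assumes "entire_real f" "entire_real g" "\<And>u. f u * g u = 0"
  shows "(\<forall>u. f u = 0) \<or> (\<forall>u. g u = 0)"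
proof (rule ccontr)
  assume "\<not> ?thesis"
  then obtain u v where "f u \<noteq> 0" "g v \<noteq> 0" by auto
  then have fin: "finite ({u \<in> {0..1}. f u = 0} \<union> {u \<in> {0..1}. g u = 0})"
    using entire_real_finite_zeros[OF assms(1)] entire_real_finite_zeros[OF assms(2)] by (intro finite_UnI)
  have eq: "{u \<in> {0..1}. f u = 0} \<union> {u \<in> {0..1}. g u = 0} = {0..1}" using assms(3) by auto
  show False using fin infinite_Icc[of "0::real" 1] unfolding eq by simp
qed

section \<open>Trigonometric sums and comparison of coefficients\<close>

definition cos_sum :: "nat \<Rightarrow> (nat \<Rightarrow> real) \<Rightarrow> real \<Rightarrow> real" where
  "cos_sum Q A u = (\<Sum>q=1..Q. A q * cos (real q * u))"

definition sin_sum :: "nat \<Rightarrow> (nat \<Rightarrow> real) \<Rightarrow> real \<Rightarrow> real" where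
  "sin_sum Q A u = (\<Sum>q=1..Q. A q * sin (real q * u))"

definition dcos_sum :: "nat \<Rightarrow> (nat \<Rightarrow> real) \<Rightarrow> real \<Rightarrow> real" where
  "dcos_sum Q A u = (\<Sum>q=1..Q. A q * (- real q * sin (real q * u)))"

definition dsin_sum :: "nat \<Rightarrow> (nat \<Rightarrow> real) \<Rightarrow> real \<Rightarrow> real" where
  "dsin_sum Q A u = (\<Sum>q=1..Q. A q * (real q * cos (real q * u)))"

lemma trig_sum_entire [entire_intros]:
  "entire_real (cos_sum Q A)" "entire_real (sin_sum Q A)"
  "entire_real (dcos_sum Q A)" "entire_real (dsin_sum Q A)"
  unfolding cos_sum_def[abs_def] sin_sum_def[abs_def] dcos_sum_def[abs_def] dsin_sum_def[abs_def]
  by (intro entire_intros)+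

lemma has_real_derivative_cos_sum [derivative_intros]:
  "(cos_sum Q A has_real_derivative dcos_sum Q A u) (at u within S)"
  unfolding cos_sum_def[abs_def] dcos_sum_def[abs_def]
  by (auto intro!: derivative_eq_intros sum.cong simp: algebra_simps)

lemma has_real_derivative_sin_sum [derivative_intros]:
  "(sin_sum Q A has_real_derivative dsin_sum Q A u) (at u within S)"
  unfolding sin_sum_def[abs_def] dsin_sum_def[abs_def]
  by (auto intro!: derivative_eq_intros sum.cong simp: algebra_simps)

lemma trig_sum_periodic:
  "cos_sum Q A (u + 2 * pi * of_int n) = cos_sum Q A u"
  "sin_sum Q A (u + 2 * pi * of_int n) = sin_sum Q A u"
  "dcos_sum Q A (u + 2 * pi * of_int n) = dcos_sum Q A u"
  "dsin_sum Q A (u + 2 * pi * of_int n) = dsin_sum Q A u"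
proof -
  have *: "cis (real q * (u + 2 * pi * of_int n)) = cis (real q * u)" for q
  proof -
    have "cis (real q * (u + 2 * pi * of_int n)) = cis (real q * u) * cis (2 * pi * of_int (int q * n))"
      by (simp add: cis_mult algebra_simps)
    also have "cis (2 * pi * of_int (int q * n)) = 1" by (rule cis_multiple_2pi) simp
    finally show ?thesis by simp
  qed
  have c: "cos (real q * (u + 2 * pi * of_int n)) = cos (real q * u)"
    "sin (real q * (u + 2 * pi * of_int n)) = sin (real q * u)" for q
    using arg_cong[OF *, of Re q] arg_cong[OF *, of Im q] by auto
  show "cos_sum Q A (u + 2 * pi * of_int n) = cos_sum Q A u"
    "sin_sum Q A (u + 2 * pi * of_int n) = sin_sum Q A u"
    "dcos_sum Q A (u + 2 * pi * of_int n) = dcos_sum Q A u"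
    "dsin_sum Q A (u + 2 * pi * of_int n) = dsin_sum Q A u"
    by (simp_all add: cos_sum_def sin_sum_def dcos_sum_def dsin_sum_def c)
qed

text \<open>Multiplied by \<open>cis (Q * u)\<close>, the sum becomes a polynomial of degree at most
  \<open>2 * Q\<close> in \<open>cis u\<close>. It has infinitely many roots on the unit circle, so
  all its coefficients vanish.\<close>

lemma trig_sum_eq_0:
  assumes "\<And>u. k + cos_sum Q A u + sin_sum Q B u = 0"
  shows "k = 0" "q \<in> {1..Q} \<Longrightarrow> A q = 0" "q \<in> {1..Q} \<Longrightarrow> B q = 0"
proof -
  \<comment> \<open>\<open>c n\<close> is the Fourier coefficient at frequency \<open>n - Q\<close>:
    half of \<open>A - i B\<close> at positive and half of \<open>A + i B\<close> at negative
    frequencies.\<close>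
  define c where "c n = (if n = Q then of_real k
      else if n > Q then Complex (A (n - Q) / 2) (- B (n - Q) / 2)
      else Complex (A (Q - n) / 2) (B (Q - n) / 2))" for n
  have zero: "(\<Sum>n\<le>2*Q. c n * cis u ^ n) = 0" for u
  proof -
    let ?t = "\<lambda>n. c n * cis u ^ n"
    have cis_diff: "cis u ^ (Q - q) = cis (real Q * u) * cis (- (real q * u))" if "q \<le> Q" for q
      using that by (subst Complex.DeMoivre) (simp add: cis_mult left_diff_distrib)
    have cis_add: "cis u ^ (Q + q) = cis (real Q * u) * cis (real q * u)" for q
      by (subst Complex.DeMoivre) (simp add: cis_mult distrib_right)
    have "{..2*Q} = {..<Q} \<union> ({Q} \<union> {Q+1..2*Q})" by auto
    then have "(\<Sum>n\<le>2*Q. ?t n) = sum ?t ({..<Q} \<union> ({Q} \<union> {Q+1..2*Q}))" by simp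
    also have "\<dots> = sum ?t {..<Q} + (?t Q + sum ?t {Q+1..2*Q})"
      by (subst sum.union_disjoint) auto
    also have "sum ?t {..<Q} = (\<Sum>q=1..Q. Complex (A q / 2) (B q / 2) * cis u ^ (Q - q))"
      by (rule sum.reindex_bij_witness[of _ "\<lambda>q. Q - q" "\<lambda>q. Q - q"]) (auto simp: c_def)
    also have "\<dots> = cis (real Q * u) * (\<Sum>q=1..Q. Complex (A q / 2) (B q / 2) * cis (- (real q * u)))"
      by (auto simp: sum_distrib_left cis_diff intro!: sum.cong)
    also have "sum ?t {Q+1..2*Q} = (\<Sum>q=1..Q. Complex (A q / 2) (- B q / 2) * cis u ^ (Q + q))"
      by (rule sum.reindex_bij_witness[of _ "\<lambda>q. Q + q" "\<lambda>q. q - Q"]) (auto simp: c_def)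
    also have "\<dots> = cis (real Q * u) * (\<Sum>q=1..Q. Complex (A q / 2) (- B q / 2) * cis (real q * u))"
      by (auto simp: sum_distrib_left cis_add intro!: sum.cong)
    also have "?t Q = cis (real Q * u) * of_real k"
      by (simp add: c_def Complex.DeMoivre)
    also have "cis (real Q * u) * (\<Sum>q=1..Q. Complex (A q / 2) (B q / 2) * cis (- (real q * u)))
       + (cis (real Q * u) * of_real k + cis (real Q * u) * (\<Sum>q=1..Q. Complex (A q / 2) (- B q / 2) * cis (real q * u)))
      = cis (real Q * u) * (of_real k + (\<Sum>q=1..Q. Complex (A q / 2) (B q / 2) * cis (- (real q * u))
         + Complex (A q / 2) (- B q / 2) * cis (real q * u)))"
      by (simp add: algebra_simps sum.distrib)
    also have "(\<Sum>q=1..Q. Complex (A q / 2) (B q / 2) * cis (- (real q * u))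
         + Complex (A q / 2) (- B q / 2) * cis (real q * u))
        = (\<Sum>q=1..Q. of_real (A q * cos (real q * u) + B q * sin (real q * u)))"
      by (intro sum.cong) (auto simp: complex_eq_iff algebra_simps)
    also have "of_real k + (\<Sum>q=1..Q. of_real (A q * cos (real q * u) + B q * sin (real q * u)))
        = complex_of_real (k + cos_sum Q A u + sin_sum Q B u)"
      by (simp add: cos_sum_def sin_sum_def sum.distrib)
    finally show ?thesis using assms by simp
  qed
  have "infinite (range cis)"
  proof
    assume "finite (range cis)"
    then have "finite (Im ` range cis)" by blast
    moreover have "{-1..1} \<subseteq> Im ` range cis"
    proof
      fix t :: real assume "t \<in> {-1..1}"
      then have "t = Im (cis (arcsin t))" by simp
      then show "t \<in> Im ` range cis" by blast
    qed
    ultimately show False using infinite_Icc[of "-1::real" 1] finite_subset[of "{-1..1}" "Im ` range cis"] by simp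
  qed
  moreover have "range cis \<subseteq> {z. (\<Sum>n\<le>2*Q. c n * z ^ n) = 0}" using zero by auto
  ultimately have "\<not> finite {z. (\<Sum>n\<le>2*Q. c n * z ^ n) = 0}" using finite_subset by blast
  then have c0: "c n = 0" if "n \<le> 2*Q" for n
    using polyfun_finite_roots[of c "2*Q"] that by blast
  show "k = 0" using c0[of Q] by (simp add: c_def)
  show "A q = 0" "B q = 0" if "q \<in> {1..Q}"
    using c0[of "Q + q"] that by (auto simp: c_def complex_eq_iff)
qed

section \<open>Independence of the limiting pairs for a regular contour\<close>

locale trig_contour =
  fixes Q :: nat and a b :: "nat \<Rightarrow> real" and x y :: real
  assumes Q: "Q \<ge> 1" and a1: "a 1 > 0" and b1: "b 1 > 0" and unit: "x\<^sup>2 + y\<^sup>2 = 1"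
    and regular: "\<And>u. dcos_sum Q a u \<noteq> 0 \<or> dsin_sum Q b u \<noteq> 0"
begin

definition speed where "speed u = sqrt ((dcos_sum Q a u)\<^sup>2 + (dsin_sum Q b u)\<^sup>2)"
text \<open>Here \<open>(x, y)\<close> is the line of sight in the axes of the target.
  \<open>hgt\<close> and \<open>tng\<close> are the speed times the sine and the cosine of the
  limiting aspect angle, so \<open>hgt u > 0\<close> describes the visible part. \<open>crs\<close>
  is the cross-range coordinate of the contour point, and \<open>hgt\<close> is minus its
  derivative.\<close>

definition hgt where "hgt u = y * dcos_sum Q a u - x * dsin_sum Q b u"
definition tng where "tng u = x * dcos_sum Q a u + y * dsin_sum Q b u"
definition crs where "crs u = x * sin_sum Q b u - y * cos_sum Q a u"

lemma speed_pos: "speed u > 0"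
  using regular[of u] by (auto simp: speed_def sum_power2_gt_zero_iff)

lemma speed_sq: "(speed u)\<^sup>2 = (dcos_sum Q a u)\<^sup>2 + (dsin_sum Q b u)\<^sup>2"
  by (simp add: speed_def)

lemma hgt_tng: "(hgt u)\<^sup>2 + (tng u)\<^sup>2 = (speed u)\<^sup>2"
proof -
  have "(hgt u)\<^sup>2 + (tng u)\<^sup>2 = (x\<^sup>2 + y\<^sup>2) * (speed u)\<^sup>2"
    unfolding speed_sq by (simp add: hgt_def tng_def power2_eq_square algebra_simps)
  then show ?thesis using unit by simp
qed

text \<open>The coefficients at frequency 1 are \<open>p * a 1\<close> and \<open>s * b 1\<close>,
  and \<open>a 1\<close>, \<open>b 1\<close> are positive.\<close>

lemma combination_not_constant:
  assumes "p \<noteq> 0 \<or> s \<noteq> 0"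
  shows "\<exists>u. p * cos_sum Q a u + s * sin_sum Q b u \<noteq> k"
proof (rule ccontr)
  assume *: "\<not> ?thesis"
  have "- k + cos_sum Q (\<lambda>q. p * a q) u + sin_sum Q (\<lambda>q. s * b q) u = 0" for u
  proof -
    have "p * cos_sum Q a u + s * sin_sum Q b u = k" using * by blast
    then show ?thesis by (simp add: cos_sum_def sin_sum_def sum_distrib_left mult.assoc)
  qed
  from trig_sum_eq_0(2,3)[OF this, of 1] Q a1 b1 assms show False by auto
qed

lemma derivative_combination_nonzero:
  assumes "p \<noteq> 0 \<or> s \<noteq> 0"
  shows "\<exists>u. p * dcos_sum Q a u + s * dsin_sum Q b u \<noteq> 0"
proof (rule ccontr)
  assume "\<not> ?thesis"
  then have "p * dcos_sum Q a u + s * dsin_sum Q b u = 0" for u by blast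
  then have "((\<lambda>u. p * cos_sum Q a u + s * sin_sum Q b u) has_real_derivative 0) (at u)" for u
    by (auto intro!: derivative_eq_intros simp: mult.commute)
  then have "\<forall>u. p * cos_sum Q a u + s * sin_sum Q b u = p * cos_sum Q a 0 + s * sin_sum Q b 0"
    by (intro allI DERIV_isconst_all) blast
  then show False using combination_not_constant[OF assms] by blast
qed

text \<open>\<open>tng\<close> is the derivative of the periodic coordinate along the line of sight,
  so Rolle's theorem applies.\<close>

lemma tng_zero: "\<exists>u. tng u = 0"
proof -
  let ?g = "\<lambda>u. x * cos_sum Q a u + y * sin_sum Q b u"
  have d: "(?g has_real_derivative tng u) (at u within S)" for u S
    by (auto intro!: derivative_eq_intros simp: tng_def)
  have "\<exists>z. 0 < z \<and> z < 2 * pi \<and> ((\<lambda>v. tng z * v) = (\<lambda>v. 0))"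
  proof (rule Rolle_deriv)
    show "?g 0 = ?g (2 * pi)"
      using trig_sum_periodic(1)[of Q a 0 1] trig_sum_periodic(2)[of Q b 0 1] by simp
    show "continuous_on {0..2 * pi} ?g" using d DERIV_continuous_on by blast
    show "(?g has_derivative (\<lambda>v. tng z * v)) (at z)" for z
      using d unfolding has_field_derivative_def by simp
  qed simp
  then obtain z where "(\<lambda>v. tng z * v) = (\<lambda>v. 0)" by blast
  from fun_cong[OF this, of 1] show ?thesis by auto
qed

text \<open>If \<open>hgt\<close> were nowhere positive, a periodic function with this derivative
  would be monotone and hence constant. So part of the contour is visible, whatever its
  shape.\<close>

lemma hgt_positive: "\<exists>u\<in>{0<..<2 * pi}. hgt u > 0"
proof (rule ccontr)
  assume *: "\<not> ?thesis"
  let ?g = "\<lambda>u. y * cos_sum Q a u + (- x) * sin_sum Q b u"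
  have d: "(?g has_real_derivative hgt u) (at u within S)" for u S
    by (auto intro!: derivative_eq_intros simp: hgt_def)
  have c: "continuous_on S ?g" for S using d DERIV_continuous_on by blast
  have mono: "?g t \<le> ?g s" if "0 \<le> s" "s \<le> t" "t \<le> 2 * pi" for s t
  proof (cases "s < t")
    case True
    show ?thesis
    proof (rule DERIV_nonpos_imp_decreasing_open[where f = ?g])
      show "s \<le> t" "continuous_on {s..t} ?g" using c that by auto
      fix u assume "s < u" "u < t"
      then show "\<exists>l. (?g has_real_derivative l) (at u) \<and> l \<le> 0"
        using d * that by (intro exI[of _ "hgt u"]) (auto simp: not_less)
    qed
  qed (use that in simp)
  have per: "?g 0 = ?g (2 * pi)"
    using trig_sum_periodic(1)[of Q a 0 1] trig_sum_periodic(2)[of Q b 0 1] by simp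
  have const: "?g t - ?g 0 = 0" if "t \<in> {0..2*pi}" for t
    using mono[of 0 t] mono[of t "2*pi"] per that by simp
  have ent: "entire_real (\<lambda>t. ?g t - ?g 0)" by (intro entire_intros)
  have "?g t - ?g 0 = 0" for t
    by (rule entire_real_eq_0[where f = "\<lambda>t. ?g t - ?g 0" and U = "{0..2*pi}" and l = 0 and r = "2*pi"])
      (rule ent, simp_all only: const infinite_Icc_iff subset_refl, simp)
  then have "\<forall>t. ?g t = ?g 0" by (metis eq_iff_diff_eq_0)
  moreover have "y \<noteq> 0 \<or> - x \<noteq> 0" using unit by auto
  ultimately show False using combination_not_constant by blast
qed

text \<open>\<open>k\<close>, \<open>k'\<close>, \<open>A\<close> and \<open>B\<close> are the
  coefficients of range, orientation and contour parameters in a linear relation between the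
  limiting pairs, and \<open>\<kappa>\<close> is the multiple of w split off by the projection. The
  angular relation is cleared of denominators, so that both sides are entire. The range relation
  alone leaves \<open>A\<close> or \<open>B\<close> undetermined when the line of sight is parallel
  to an axis of the target; the angular relation fills this gap.\<close>

lemma nondegenerate:
  assumes U: "infinite U" "U \<subseteq> {0..2*pi}"
    and range: "\<And>u. u \<in> U \<Longrightarrow> k + k' * crs u + x * cos_sum Q A u + y * sin_sum Q B u = 0"
    and angle: "\<And>u. u \<in> U \<Longrightarrow> tng u * (k' * (speed u)\<^sup>2 + dsin_sum Q b u * dcos_sum Q A u
        - dcos_sum Q a u * dsin_sum Q B u) = \<kappa> * hgt u * (speed u)\<^sup>2"
  shows "k = 0 \<and> k' = 0 \<and> (\<forall>q\<in>{1..Q}. A q = 0 \<and> B q = 0)"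
proof -
  have "entire_real (\<lambda>u. k + k' * crs u + x * cos_sum Q A u + y * sin_sum Q B u)"
    unfolding crs_def by (intro entire_intros)
  then have range': "k + k' * crs u + x * cos_sum Q A u + y * sin_sum Q B u = 0" for u
    using entire_real_eq_0[OF _ U, of _ u] range by auto
  have ent: "entire_real tng" "entire_real hgt" "entire_real (\<lambda>u. (speed u)\<^sup>2)"
    unfolding tng_def[abs_def] hgt_def[abs_def] speed_sq by (intro entire_intros)+
  let ?T = "\<lambda>u. k' * (speed u)\<^sup>2 + dsin_sum Q b u * dcos_sum Q A u - dcos_sum Q a u * dsin_sum Q B u"
  have "entire_real (\<lambda>u. tng u * ?T u - \<kappa> * hgt u * (speed u)\<^sup>2)"
    by (intro entire_intros ent)
  then have angle': "tng u * ?T u - \<kappa> * hgt u * (speed u)\<^sup>2 = 0" for u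
    by (rule entire_real_eq_0[OF _ U]) (simp add: angle)
  \<comment> \<open>At \<open>u0\<close> the value of \<open>hgt\<close> is plus or minus the speed,
    so \<open>angle'\<close> is compatible only with \<open>\<kappa> = 0\<close>.\<close>
  obtain u0 where u0: "tng u0 = 0" using tng_zero by blast
  then have "hgt u0 \<noteq> 0" using hgt_tng[of u0] speed_pos[of u0] by auto
  then have "\<kappa> = 0" using angle'[of u0] u0 speed_pos[of u0] by auto
  then have "tng u * ?T u = 0" for u using angle'[of u] by simp
  then have "(\<forall>u. tng u = 0) \<or> (\<forall>u. ?T u = 0)"
    by (intro entire_real_mult_eq_0) (intro entire_intros ent)+
  moreover have tng: "\<exists>u. tng u \<noteq> 0"
  proof -
    have "x \<noteq> 0 \<or> y \<noteq> 0" using unit by auto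
    then show ?thesis unfolding tng_def by (rule derivative_combination_nonzero)
  qed
  ultimately have T: "?T u = 0" for u by blast
  have "k + cos_sum Q (\<lambda>q. x * A q - k' * y * a q) u + sin_sum Q (\<lambda>q. y * B q + k' * x * b q) u = 0" for u
    using range'[of u]
    by (simp add: crs_def cos_sum_def sin_sum_def sum_distrib_left sum.distrib sum_subtractf algebra_simps)
  note coeffs = trig_sum_eq_0[OF this]
  have k: "k = 0" by (rule coeffs(1))
  have A: "x * A q = k' * y * a q" and B: "y * B q = - (k' * x * b q)" if "q \<in> {1..Q}" for q
    using coeffs(2,3)[OF that] by auto
  \<comment> \<open>\<open>A\<close> and \<open>B\<close> express \<open>x * A\<close> through
    \<open>a\<close> and \<open>y * B\<close> through \<open>b\<close>. If \<open>x\<close> or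
    \<open>y\<close> is 0, frequency 1 decides. Otherwise multiplying \<open>T\<close> by
    \<open>x * y\<close> allows both to be substituted, and the result factors because
    \<open>x\<^sup>2 + y\<^sup>2 = 1\<close>.\<close>
  have k': "k' = 0"
  proof (cases "x = 0 \<or> y = 0")
    case True
    then show ?thesis using A[of 1] B[of 1] Q a1 b1 unit by auto
  next
    case False
    have dA: "x * dcos_sum Q A u = k' * y * dcos_sum Q a u" for u
      unfolding dcos_sum_def sum_distrib_left
      by (intro sum.cong refl) (use A in \<open>simp only: mult.assoc[symmetric]\<close>)
    have dB: "y * dsin_sum Q B u = - (k' * x * dsin_sum Q b u)" for u
      unfolding dsin_sum_def sum_distrib_left sum_negf[symmetric]
      by (intro sum.cong refl) (use B in \<open>simp add: mult.assoc[symmetric]\<close>)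
    have "k' * (tng u * (y * dcos_sum Q a u + x * dsin_sum Q b u)) = 0" for u
    proof -
      let ?p = "dcos_sum Q a u" and ?s = "dsin_sum Q b u"
      have "k' * (tng u * (y * ?p + x * ?s)) = k' * x * y * (?p\<^sup>2 + ?s\<^sup>2) + (x\<^sup>2 + y\<^sup>2) * k' * ?p * ?s"
        by (simp add: tng_def power2_eq_square algebra_simps)
      also have "\<dots> = k' * x * y * (?p\<^sup>2 + ?s\<^sup>2) + y * (k' * y * ?p) * ?s - x * ?p * (- (k' * x * ?s))"
        by (simp add: power2_eq_square algebra_simps)
      also have "\<dots> = x * y * ?T u"
        unfolding dA[symmetric] dB[symmetric] speed_sq by (simp add: algebra_simps)
      finally show ?thesis using T by simp
    qed
    moreover have "\<not> (\<forall>u. tng u * (y * dcos_sum Q a u + x * dsin_sum Q b u) = 0)"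
    proof
      assume "\<forall>u. tng u * (y * dcos_sum Q a u + x * dsin_sum Q b u) = 0"
      then have "(\<forall>u. tng u = 0) \<or> (\<forall>u. y * dcos_sum Q a u + x * dsin_sum Q b u = 0)"
        by (intro entire_real_mult_eq_0) (auto intro!: entire_intros ent)
      moreover have "y \<noteq> 0 \<or> x \<noteq> 0" using unit by auto
      ultimately show False using tng derivative_combination_nonzero[of y x] by blast
    qed
    ultimately show ?thesis by auto
  qed
  have T': "dsin_sum Q b u * dcos_sum Q A u - dcos_sum Q a u * dsin_sum Q B u = 0" for u
    using T[of u] k' by simp
  have AB: "x * A q = 0" "y * B q = 0" if "q \<in> {1..Q}" for q
    using A[OF that] B[OF that] k' by auto
  have zero_imp: "D q = 0" if "\<And>u. dcos_sum Q D u = 0" "q \<in> {1..Q}" for D q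
  proof -
    have "0 + cos_sum Q (\<lambda>q. 0) u + sin_sum Q (\<lambda>q. - real q * D q) u = 0" for u
      using that(1)[of u] by (simp add: dcos_sum_def cos_sum_def sin_sum_def algebra_simps)
    from trig_sum_eq_0(3)[OF this that(2)] that(2) show ?thesis by auto
  qed
  have zero_imp': "D q = 0" if "\<And>u. dsin_sum Q D u = 0" "q \<in> {1..Q}" for D q
  proof -
    have "0 + cos_sum Q (\<lambda>q. real q * D q) u + sin_sum Q (\<lambda>q. 0) u = 0" for u
      using that(1)[of u] by (simp add: dsin_sum_def cos_sum_def sin_sum_def algebra_simps)
    from trig_sum_eq_0(2)[OF this that(2)] that(2) show ?thesis by auto
  qed
  have "A q = 0 \<and> B q = 0" if q: "q \<in> {1..Q}" for q
  proof -
    consider "x \<noteq> 0" "y \<noteq> 0" | "x = 0" "y \<noteq> 0" | "x \<noteq> 0" "y = 0" using unit by (cases "x = 0"; cases "y = 0") auto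
    then show ?thesis
    proof cases
      case 1
      then show ?thesis using AB[OF q] by simp
    next
      \<comment> \<open>The line of sight is the second axis: \<open>A\<close> has dropped out of
        the range relation and is recovered from \<open>T'\<close>, in which the factor
        \<open>dsin_sum Q b\<close> is not identically zero.\<close>
      case 2
      then have B0: "B q = 0" if "q \<in> {1..Q}" for q using AB[OF that] by simp
      then have "dsin_sum Q b u * dcos_sum Q A u = 0" for u
        using T'[of u] by (simp add: dsin_sum_def[of Q B])
      then have "(\<forall>u. dsin_sum Q b u = 0) \<or> (\<forall>u. dcos_sum Q A u = 0)"
        by (intro entire_real_mult_eq_0 entire_intros)
      then show ?thesis using derivative_combination_nonzero[of 0 1] zero_imp[of A] q B0 by auto
    next
      case 3
      then have A0: "A q = 0" if "q \<in> {1..Q}" for q using AB[OF that] by simp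
      then have "dcos_sum Q a u * dsin_sum Q B u = 0" for u
        using T'[of u] by (simp add: dcos_sum_def[of Q A])
      then have "(\<forall>u. dcos_sum Q a u = 0) \<or> (\<forall>u. dsin_sum Q B u = 0)"
        by (intro entire_real_mult_eq_0 entire_intros)
      then show ?thesis using derivative_combination_nonzero[of 1 0] zero_imp'[of B] q A0 by auto
    qed
  qed
  then show ?thesis using k k' by blast
qed

end

section \<open>Dominated convergence on a period\<close>

definition bounded_measurable :: "(real \<Rightarrow> real) \<Rightarrow> bool" where
  "bounded_measurable f \<longleftrightarrow> f \<in> borel_measurable borel \<and> (\<exists>C. \<forall>u\<in>{0..2*pi}. \<bar>f u\<bar> \<le> C)"

named_theorems bm_intros

lemma bounded_measurable_continuous:
  assumes "continuous_on UNIV f"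
  shows "bounded_measurable f"
proof -
  have "compact (f ` {0..2*pi})"
    using assms by (intro compact_continuous_image continuous_on_subset[OF assms]) auto
  then obtain C where "\<forall>z\<in>f ` {0..2*pi}. norm z \<le> C"
    using compact_imp_bounded bounded_iff by blast
  then show ?thesis
    using assms by (auto simp: bounded_measurable_def intro!: borel_measurable_continuous_onI)
qed

lemma bounded_measurable_add [bm_intros]:
  assumes "bounded_measurable f" "bounded_measurable g"
  shows "bounded_measurable (\<lambda>u. f u + g u)"
proof -
  from assms obtain C D where "\<forall>u\<in>{0..2*pi}. \<bar>f u\<bar> \<le> C" "\<forall>u\<in>{0..2*pi}. \<bar>g u\<bar> \<le> D"
    unfolding bounded_measurable_def by blast
  then have "\<forall>u\<in>{0..2*pi}. \<bar>f u + g u\<bar> \<le> C + D" by (meson abs_triangle_ineq add_mono order_trans)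
  then show ?thesis using assms unfolding bounded_measurable_def by auto
qed

lemma bounded_measurable_mult [bm_intros]:
  assumes "bounded_measurable f" "bounded_measurable g"
  shows "bounded_measurable (\<lambda>u. f u * g u)"
proof -
  from assms obtain C D where "\<forall>u\<in>{0..2*pi}. \<bar>f u\<bar> \<le> C" "\<forall>u\<in>{0..2*pi}. \<bar>g u\<bar> \<le> D"
    unfolding bounded_measurable_def by blast
  then have "\<forall>u\<in>{0..2*pi}. \<bar>f u * g u\<bar> \<le> C * D"
    unfolding abs_mult by (meson abs_ge_zero mult_mono order_trans)
  then show ?thesis using assms unfolding bounded_measurable_def by auto
qed

lemma bounded_measurable_const [bm_intros]: "bounded_measurable (\<lambda>u. c)"
  by (rule bounded_measurable_continuous) (rule continuous_on_const)

lemma bounded_measurable_if [bm_intros]: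
  "(P \<Longrightarrow> bounded_measurable f) \<Longrightarrow> (\<not> P \<Longrightarrow> bounded_measurable g) \<Longrightarrow>
    bounded_measurable (\<lambda>u. if P then f u else g u)"
  by (cases P) auto

lemma bounded_measurable_minus [bm_intros]:
  "bounded_measurable f \<Longrightarrow> bounded_measurable (\<lambda>u. - f u)"
  using bounded_measurable_mult[OF bounded_measurable_const[of "-1"], of f] by simp

lemma bounded_measurable_diff [bm_intros]:
  "bounded_measurable f \<Longrightarrow> bounded_measurable g \<Longrightarrow> bounded_measurable (\<lambda>u. f u - g u)"
  using bounded_measurable_add[OF _ bounded_measurable_minus, of f g] by simp

lemma bounded_measurable_sum [bm_intros]:
  "(\<And>i. i \<in> S \<Longrightarrow> bounded_measurable (f i)) \<Longrightarrow> bounded_measurable (\<lambda>u. \<Sum>i\<in>S. f i u)"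
  by (induction S rule: infinite_finite_induct) (auto intro: bm_intros)

lemma bounded_measurable_set_integrable:
  assumes "bounded_measurable f"
  shows "set_integrable lborel {0..2*pi} f"
proof -
  from assms obtain C where C: "\<forall>u\<in>{0..2*pi}. \<bar>f u\<bar> \<le> C" and [measurable]: "f \<in> borel_measurable borel"
    unfolding bounded_measurable_def by blast
  have "integrable lborel (\<lambda>u. indicator {0..2*pi} u *\<^sub>R C)"
    using borel_integrable_compact[of "{0..2*pi}" "\<lambda>_. C"]
    by (simp add: indicator_def if_distrib[of "\<lambda>a. a * C"] cong: if_cong)
  then show ?thesis
    unfolding set_integrable_def
    by (rule Bochner_Integration.integrable_bound) (use C in \<open>auto simp: indicator_def intro!: AE_I2 order_trans[OF _ abs_ge_self]\<close>)
qed

text \<open>Convergence made for dominated convergence over one period and stable under algebraic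
  operations. The bound is eventual, because at short range the contour may pass near the radar. The
  limit is almost everywhere, because v jumps at the edge of visibility when \<alpha> = 0.
  Measurability is asked for every \<open>d\<close>; it survives division by zero.\<close>

definition bconv :: "(real \<Rightarrow> real \<Rightarrow> real) \<Rightarrow> (real \<Rightarrow> real) \<Rightarrow> bool" where
  "bconv F f \<longleftrightarrow> (\<forall>d. F d \<in> borel_measurable borel) \<and> bounded_measurable f \<and>
     (\<exists>C. \<forall>\<^sub>F d in at_top. \<forall>u\<in>{0..2*pi}. \<bar>F d u\<bar> \<le> C) \<and>
     (AE u in lborel. u \<in> {0..2*pi} \<longrightarrow> ((\<lambda>d. F d u) \<longlongrightarrow> f u) at_top)"

named_theorems bconv_intros

lemma bconvI:
  assumes "\<And>d. F d \<in> borel_measurable borel" "bounded_measurable f"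
    "\<forall>\<^sub>F d in at_top. \<forall>u\<in>{0..2*pi}. \<bar>F d u\<bar> \<le> C"
    "AE u in lborel. u \<in> {0..2*pi} \<longrightarrow> ((\<lambda>d. F d u) \<longlongrightarrow> f u) at_top"
  shows "bconv F f"
  using assms unfolding bconv_def by blast

lemma bconv_measurable: "bconv F f \<Longrightarrow> F d \<in> borel_measurable borel"
  by (simp add: bconv_def)

lemma bconv_bounded_measurable: "bconv F f \<Longrightarrow> bounded_measurable f"
  by (simp add: bconv_def)

lemma bconv_eventually_bounded_measurable:
  assumes "bconv F f"
  shows "\<forall>\<^sub>F d in at_top. bounded_measurable (F d)"
proof -
  from assms obtain C where C: "\<forall>\<^sub>F d in at_top. \<forall>u\<in>{0..2*pi}. \<bar>F d u\<bar> \<le> C"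
    unfolding bconv_def by blast
  show ?thesis using C
    by eventually_elim (use assms in \<open>auto simp: bounded_measurable_def bconv_def\<close>)
qed

lemma bconv_const [bconv_intros]: "bounded_measurable f \<Longrightarrow> bconv (\<lambda>d. f) f"
  by (auto simp: bconv_def bounded_measurable_def)

lemma bconv_scalar:
  assumes "(c \<longlongrightarrow> l) at_top"
  shows "bconv (\<lambda>d u. c d) (\<lambda>u. l)"
proof (rule bconvI)
  have "\<forall>\<^sub>F d in at_top. dist (c d) l < 1" by (rule tendstoD[OF assms]) simp
  then show "\<forall>\<^sub>F d in at_top. \<forall>u\<in>{0..2*pi}. \<bar>c d\<bar> \<le> \<bar>l\<bar> + 1"
    by eventually_elim (auto simp: dist_real_def)
qed (use assms in \<open>auto intro: bm_intros\<close>)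

lemma bconv_inverse_range [bconv_intros]: "bconv (\<lambda>d u. 1 / d) (\<lambda>u. 0)"
  by (rule bconv_scalar) real_asymp

lemma bconv_add [bconv_intros]:
  assumes "bconv F f" "bconv G g"
  shows "bconv (\<lambda>d u. F d u + G d u) (\<lambda>u. f u + g u)"
proof -
  from assms obtain C D where C: "\<forall>\<^sub>F d in at_top. \<forall>u\<in>{0..2*pi}. \<bar>F d u\<bar> \<le> C"
    and D: "\<forall>\<^sub>F d in at_top. \<forall>u\<in>{0..2*pi}. \<bar>G d u\<bar> \<le> D"
    unfolding bconv_def by blast
  have "AE u in lborel. u \<in> {0..2*pi} \<longrightarrow> ((\<lambda>d. F d u) \<longlongrightarrow> f u) at_top"
    and "AE u in lborel. u \<in> {0..2*pi} \<longrightarrow> ((\<lambda>d. G d u) \<longlongrightarrow> g u) at_top"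
    using assms unfolding bconv_def by blast+
  then have lim: "AE u in lborel. u \<in> {0..2*pi} \<longrightarrow> ((\<lambda>d. F d u + G d u) \<longlongrightarrow> f u + g u) at_top"
    by eventually_elim (auto intro: tendsto_add)
  have bound: "\<forall>\<^sub>F d in at_top. \<forall>u\<in>{0..2*pi}. \<bar>F d u + G d u\<bar> \<le> C + D"
    using C D by eventually_elim (meson abs_triangle_ineq add_mono order_trans)
  show ?thesis
    by (rule bconvI[OF _ _ bound lim]) (intro borel_measurable_add borel_measurable_times bconv_measurable[OF assms(1)] bconv_measurable[OF assms(2)] bm_intros bconv_bounded_measurable[OF assms(1)] bconv_bounded_measurable[OF assms(2)])+
qed

lemma bconv_mult [bconv_intros]:
  assumes "bconv F f" "bconv G g"
  shows "bconv (\<lambda>d u. F d u * G d u) (\<lambda>u. f u * g u)"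
proof -
  from assms obtain C D where C: "\<forall>\<^sub>F d in at_top. \<forall>u\<in>{0..2*pi}. \<bar>F d u\<bar> \<le> C"
    and D: "\<forall>\<^sub>F d in at_top. \<forall>u\<in>{0..2*pi}. \<bar>G d u\<bar> \<le> D"
    unfolding bconv_def by blast
  have "AE u in lborel. u \<in> {0..2*pi} \<longrightarrow> ((\<lambda>d. F d u) \<longlongrightarrow> f u) at_top"
    and "AE u in lborel. u \<in> {0..2*pi} \<longrightarrow> ((\<lambda>d. G d u) \<longlongrightarrow> g u) at_top"
    using assms unfolding bconv_def by blast+
  then have lim: "AE u in lborel. u \<in> {0..2*pi} \<longrightarrow> ((\<lambda>d. F d u * G d u) \<longlongrightarrow> f u * g u) at_top"
    by eventually_elim (auto intro: tendsto_mult)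
  have bound: "\<forall>\<^sub>F d in at_top. \<forall>u\<in>{0..2*pi}. \<bar>F d u * G d u\<bar> \<le> C * D"
    using C D unfolding abs_mult by eventually_elim (meson abs_ge_zero mult_mono order_trans)
  show ?thesis
    by (rule bconvI[OF _ _ bound lim]) (intro borel_measurable_add borel_measurable_times bconv_measurable[OF assms(1)] bconv_measurable[OF assms(2)] bm_intros bconv_bounded_measurable[OF assms(1)] bconv_bounded_measurable[OF assms(2)])+
qed

lemma bconv_minus [bconv_intros]:
  "bconv F f \<Longrightarrow> bconv (\<lambda>d u. - F d u) (\<lambda>u. - f u)"
  using bconv_mult[OF bconv_const[OF bounded_measurable_const[of "-1"]], of F f] by simp

lemma bconv_diff [bconv_intros]:
  "bconv F f \<Longrightarrow> bconv G g \<Longrightarrow> bconv (\<lambda>d u. F d u - G d u) (\<lambda>u. f u - g u)"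
  using bconv_add[OF _ bconv_minus, of F f G g] by simp

text \<open>Since \<open>0 powr 0 = 0\<close>, the exponent 0 produces the indicator of the positive
  reals, which jumps at 0; a positive exponent gives a continuous function.\<close>

lemma tendsto_positive_part_powr:
  fixes a l :: real
  assumes F: "(F \<longlongrightarrow> l) at_top" and a: "a > 0 \<or> l \<noteq> 0"
  shows "((\<lambda>d. max (F d) 0 powr a) \<longlongrightarrow> max l 0 powr a) at_top"
proof (cases "l < 0")
  case True
  have "\<forall>\<^sub>F d in at_top. F d < 0" using order_tendstoD(2)[OF F True] .
  then have "\<forall>\<^sub>F d in at_top. max (F d) 0 powr a = max l 0 powr a"
    by eventually_elim (use True in simp)
  then show ?thesis by (rule tendsto_eventually)
next
  case False
  have m: "((\<lambda>d. max (F d) 0) \<longlongrightarrow> max l 0) at_top" by (intro tendsto_max F tendsto_const)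
  show ?thesis
  proof (rule tendsto_powr'[OF m tendsto_const])
    show "max l 0 \<noteq> 0 \<or> 0 < a \<and> (\<forall>\<^sub>F d in at_top. 0 \<le> max (F d) 0)"
      using a False by auto
  qed
qed

text \<open>The exponent is \<open>\<alpha> + 1\<close> for w and \<open>\<alpha>\<close> for v.
  Only the latter can be 0, and then the zeros of the limit must form a null set.\<close>

lemma bconv_positive_part_powr:
  assumes F: "bconv F f" and a: "a \<ge> 0"
    and ae: "a = 0 \<Longrightarrow> AE u in lborel. u \<in> {0..2*pi} \<longrightarrow> f u \<noteq> 0"
  shows "bconv (\<lambda>d u. max (F d u) 0 powr a) (\<lambda>u. max (f u) 0 powr a)"
proof -
  have bd: "\<bar>max t 0 powr a\<bar> \<le> max C 0 powr a" if "\<bar>t\<bar> \<le> C" for t C :: real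
    using that a by (auto intro!: powr_mono2)
  from F obtain C where C: "\<forall>\<^sub>F d in at_top. \<forall>u\<in>{0..2*pi}. \<bar>F d u\<bar> \<le> C"
    unfolding bconv_def by blast
  obtain C' where C': "\<forall>u\<in>{0..2*pi}. \<bar>f u\<bar> \<le> C'" and [measurable]: "f \<in> borel_measurable borel"
    using F unfolding bconv_def bounded_measurable_def by blast
  have [measurable]: "F d \<in> borel_measurable borel" for d using F unfolding bconv_def by blast
  have ae': "AE u in lborel. u \<in> {0..2*pi} \<longrightarrow> a > 0 \<or> f u \<noteq> 0"
    using ae a by (cases "a = 0") auto
  have "AE u in lborel. u \<in> {0..2*pi} \<longrightarrow> ((\<lambda>d. F d u) \<longlongrightarrow> f u) at_top"
    using F unfolding bconv_def by blast
  with ae' have lim: "AE u in lborel. u \<in> {0..2*pi} \<longrightarrow>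
      ((\<lambda>d. max (F d u) 0 powr a) \<longlongrightarrow> max (f u) 0 powr a) at_top"
    by eventually_elim (auto intro: tendsto_positive_part_powr)
  show ?thesis
  proof (rule bconvI[OF _ _ _ lim])
    show "\<forall>\<^sub>F d in at_top. \<forall>u\<in>{0..2*pi}. \<bar>max (F d u) 0 powr a\<bar> \<le> max C 0 powr a"
      using C by eventually_elim (use bd in blast)
    show "bounded_measurable (\<lambda>u. max (f u) 0 powr a)"
      unfolding bounded_measurable_def
      using C' bd by (intro conjI exI[of _ "max C' 0 powr a"]) (measurable, blast)
  qed measurable
qed

text \<open>Used for the reciprocal of the normalised distance; the uniform lower bound
  \<open>m\<close> provides the dominating constant.\<close>

lemma bconv_inverse_sqrt:
  assumes F: "bconv F (\<lambda>u. 1)" and m: "m > 0"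
    and low: "\<forall>\<^sub>F d in at_top. \<forall>u\<in>{0..2*pi}. F d u \<ge> m"
  shows "bconv (\<lambda>d u. 1 / sqrt (F d u)) (\<lambda>u. 1)"
proof -
  have [measurable]: "F d \<in> borel_measurable borel" for d using F unfolding bconv_def by blast
  have "AE u in lborel. u \<in> {0..2*pi} \<longrightarrow> ((\<lambda>d. F d u) \<longlongrightarrow> 1) at_top"
    using F unfolding bconv_def by blast
  then have lim: "AE u in lborel. u \<in> {0..2*pi} \<longrightarrow> ((\<lambda>d. 1 / sqrt (F d u)) \<longlongrightarrow> 1) at_top"
    by eventually_elim (auto intro!: tendsto_eq_intros)
  show ?thesis
  proof (rule bconvI[OF _ _ _ lim])
    show "\<forall>\<^sub>F d in at_top. \<forall>u\<in>{0..2*pi}. \<bar>1 / sqrt (F d u)\<bar> \<le> 1 / sqrt m"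
      using low
    proof eventually_elim
      case (elim d)
      show ?case
      proof
        fix u assume "u \<in> {0..2*pi}"
        with elim have "m \<le> F d u" by blast
        then show "\<bar>1 / sqrt (F d u)\<bar> \<le> 1 / sqrt m"
          using m by (auto simp: abs_if intro!: divide_left_mono)
      qed
    qed
  qed (auto intro: bm_intros)
qed

section \<open>The star product with a positive weight\<close>

locale weighted_period =
  fixes s :: "real \<Rightarrow> real"
  assumes weight_continuous: "continuous_on UNIV s" and weight_pos: "\<And>u. s u > 0"
begin

definition wint :: "(real \<Rightarrow> real) \<Rightarrow> (real \<Rightarrow> real) \<Rightarrow> real" where
  "wint f g = (LBINT u:{0..2*pi}. f u * g u * s u)"

lemma wint_integrable:
  "bounded_measurable f \<Longrightarrow> bounded_measurable g \<Longrightarrow> set_integrable lborel {0..2*pi} (\<lambda>u. f u * g u * s u)"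
  by (intro bounded_measurable_set_integrable bm_intros bounded_measurable_continuous[OF weight_continuous])

lemma wint_commute: "wint f g = wint g f"
  by (simp add: wint_def mult.commute mult.left_commute)

lemma wint_scale: "wint (\<lambda>u. c * f u) g = c * wint f g"
  unfolding wint_def by (simp add: mult.assoc)

lemma wint_scale_right: "wint f (\<lambda>u. c * g u) = c * wint f g"
  using wint_scale[of c g f] by (simp add: wint_commute)

lemma wint_add:
  assumes "bounded_measurable f" "bounded_measurable g" "bounded_measurable h"
  shows "wint (\<lambda>u. f u + g u) h = wint f h + wint g h"
  unfolding wint_def distrib_right
  by (intro set_integral_add wint_integrable assms)

lemma wint_diff:
  assumes "bounded_measurable f" "bounded_measurable g" "bounded_measurable h"
  shows "wint (\<lambda>u. f u - g u) h = wint f h - wint g h"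
  unfolding wint_def left_diff_distrib
  by (intro set_integral_diff wint_integrable assms)

lemma wint_zero: "wint (\<lambda>u. 0) h = 0"
  by (simp add: wint_def)

lemma wint_sum:
  assumes "\<And>i. i \<in> S \<Longrightarrow> bounded_measurable (f i)" "bounded_measurable h"
  shows "wint (\<lambda>u. \<Sum>i\<in>S. c i * f i u) h = (\<Sum>i\<in>S. c i * wint (f i) h)"
  using assms(1)
proof (induction S rule: infinite_finite_induct)
  case (insert i S)
  then show ?case
    using assms(2) by (simp add: wint_add wint_scale bm_intros)
qed (simp_all add: wint_zero)

lemma wint_nonneg: "wint f f \<ge> 0"
  unfolding wint_def set_lebesgue_integral_def
  by (intro Bochner_Integration.integral_nonneg) (use weight_pos in \<open>auto simp: less_imp_le indicator_def\<close>)

lemma wint_eq_0_AE: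
  assumes "bounded_measurable f" "wint f f = 0"
  shows "AE u in lborel. u \<in> {0..2*pi} \<longrightarrow> f u = 0"
proof -
  have "AE u in lborel. indicator {0..2*pi} u *\<^sub>R (f u * f u * s u) = (0::real)"
    using assms(2) wint_integrable[OF assms(1) assms(1)] weight_pos
    unfolding wint_def set_lebesgue_integral_def set_integrable_def
    by (subst (asm) integral_nonneg_eq_0_iff_AE) (auto simp: less_imp_le)
  then show ?thesis
    by eventually_elim (use weight_pos in \<open>auto simp: less_imp_neq[symmetric]\<close>)
qed

lemma wint_tendsto:
  assumes "bconv F f" "bconv G g"
  shows "((\<lambda>d. wint (F d) (G d)) \<longlongrightarrow> wint f g) at_top"
proof -
  have H: "bconv (\<lambda>d u. F d u * G d u * s u) (\<lambda>u. f u * g u * s u)"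
    by (intro bconv_intros assms bounded_measurable_continuous[OF weight_continuous])
  then obtain C where C: "\<forall>\<^sub>F d in at_top. \<forall>u\<in>{0..2*pi}. \<bar>F d u * G d u * s u\<bar> \<le> C"
    unfolding bconv_def by blast
  have [measurable]: "(\<lambda>u. f u * g u * s u) \<in> borel_measurable borel"
    "(\<lambda>u. F d u * G d u * s u) \<in> borel_measurable borel" for d
    using H unfolding bconv_def bounded_measurable_def by blast+
  show ?thesis
    unfolding wint_def set_lebesgue_integral_def
  proof (rule integral_dominated_convergence_at_top)
    show "integrable lborel (\<lambda>u. indicator {0..2*pi} u *\<^sub>R C)"
      using bounded_measurable_set_integrable[OF bounded_measurable_const[of C]]
      by (simp add: set_integrable_def)
    have "AE u in lborel. u \<in> {0..2*pi} \<longrightarrow>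
        ((\<lambda>d. F d u * G d u * s u) \<longlongrightarrow> f u * g u * s u) at_top"
      using H unfolding bconv_def by blast
    then show "AE u in lborel. ((\<lambda>d. indicator {0..2*pi} u *\<^sub>R (F d u * G d u * s u)) \<longlongrightarrow>
        indicator {0..2*pi} u *\<^sub>R (f u * g u * s u)) at_top"
      by eventually_elim (auto simp: indicator_def)
    show "\<forall>\<^sub>F d in at_top. AE u in lborel. norm (indicator {0..2*pi} u *\<^sub>R (F d u * G d u * s u))
        \<le> indicator {0..2*pi} u *\<^sub>R C"
      using C by eventually_elim (auto simp: indicator_def)
  qed measurable
qed

text \<open>The projection \<open>proj_perp_w\<close> with w as an argument, so that w can vary with
  the range and pass to its limit.\<close>

definition remove :: "(real \<Rightarrow> real) \<Rightarrow> (real \<Rightarrow> real) \<Rightarrow> real \<Rightarrow> real" where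
  "remove w f = (\<lambda>u. f u - wint f w / wint w w * w u)"

lemma bconv_remove [bconv_intros]:
  assumes "bconv W w" "bconv F f" "wint w w \<noteq> 0"
  shows "bconv (\<lambda>d. remove (W d) (F d)) (remove w f)"
  unfolding remove_def
  by (intro bconv_intros assms bconv_scalar tendsto_divide wint_tendsto)

lemma bounded_measurable_remove [bm_intros]:
  "bounded_measurable w \<Longrightarrow> bounded_measurable f \<Longrightarrow> bounded_measurable (remove w f)"
  unfolding remove_def by (intro bm_intros)

lemma remove_sum:
  assumes "\<And>i. i \<in> S \<Longrightarrow> bounded_measurable (f i)" "bounded_measurable w"
  shows "remove w (\<lambda>u. \<Sum>i\<in>S. c i * f i u) = (\<lambda>u. \<Sum>i\<in>S. c i * remove w (f i) u)"
  unfolding remove_def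
  by (simp add: wint_sum assms sum_distrib_right sum_distrib_left sum_divide_distrib sum_subtractf algebra_simps)

end

section \<open>Derivatives of range and angles\<close>

lemma bounded_linear_to_complex: "bounded_linear to_complex"
proof -
  have "bounded_linear (\<lambda>x. complex_of_real (fst x) + \<i> * complex_of_real (snd x))"
    by (intro bounded_linear_add bounded_linear_compose[OF bounded_linear_of_real bounded_linear_fst]
        bounded_linear_compose[OF bounded_linear_mult_right]
        bounded_linear_compose[OF bounded_linear_of_real bounded_linear_snd])
  moreover have "to_complex = (\<lambda>x. complex_of_real (fst x) + \<i> * complex_of_real (snd x))"
    by (simp add: fun_eq_iff to_complex_def Complex_eq)
  ultimately show ?thesis by simp
qed

lemma to_complex_eq_0_iff: "to_complex z = 0 \<longleftrightarrow> z = 0"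
  by (auto simp: to_complex_def complex_eq_iff prod_eq_iff)

lemma norm_to_complex: "norm (to_complex z) = norm z"
  by (simp add: to_complex_def norm_prod_def cmod_def)

definition cross :: "real \<times> real \<Rightarrow> real \<times> real \<Rightarrow> real" where
  "cross p q = fst p * snd q - snd p * fst q"

lemma partial_norm:
  assumes z: "((\<lambda>t. z (\<gamma>(i := t))) has_vector_derivative D) (at (\<gamma> i))" and nz: "z \<gamma> \<noteq> 0"
  shows "partial (\<lambda>\<gamma>'. norm (z \<gamma>')) \<gamma> i = inner (z \<gamma>) D / norm (z \<gamma> :: real \<times> real)"
proof -
  have "(norm has_derivative (\<lambda>h. inner h (sgn (z (\<gamma>(i := \<gamma> i)))))) (at (z (\<gamma>(i := \<gamma> i))))"
    by (rule has_derivative_norm) (use nz in simp)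
  then have "((\<lambda>t. norm (z (\<gamma>(i := t)))) has_derivative
      (\<lambda>h. inner (h *\<^sub>R D) (sgn (z (\<gamma>(i := \<gamma> i)))))) (at (\<gamma> i))"
    by (rule has_derivative_compose[OF z[unfolded has_vector_derivative_def]])
  then have "((\<lambda>t. norm (z (\<gamma>(i := t)))) has_real_derivative inner D (sgn (z \<gamma>))) (at (\<gamma> i))"
    unfolding has_field_derivative_def by (simp add: mult.commute[of _ "inner D _"])
  from DERIV_imp_deriv[OF this] show ?thesis
    by (simp add: partial_def sgn_div_norm inner_commute divide_inverse_commute)
qed

text \<open>The quotient inside \<open>partial_angle\<close> equals 1 at the base point, off the
  cut, so near it \<open>Arg\<close> is the imaginary part of \<open>Ln\<close>; the derivative is
  the imaginary part of \<open>D / z\<close>.\<close>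

lemma partial_angle_eq:
  assumes z: "((\<lambda>t. z (\<gamma>(i := t))) has_vector_derivative D) (at (\<gamma> i))" and nz: "z \<gamma> \<noteq> 0"
  shows "partial_angle z \<gamma> i = cross (z \<gamma>) D / (norm (z \<gamma>))\<^sup>2"
proof -
  define \<zeta> where "\<zeta> t = to_complex (z (\<gamma>(i := t))) / to_complex (z \<gamma>)" for t
  have nz': "to_complex (z \<gamma>) \<noteq> 0" using nz by (simp add: to_complex_eq_0_iff)
  have one: "\<zeta> (\<gamma> i) = 1" using nz' by (simp add: \<zeta>_def)
  have \<zeta>: "(\<zeta> has_vector_derivative to_complex D / to_complex (z \<gamma>)) (at (\<gamma> i))"
    unfolding \<zeta>_def
    by (intro bounded_linear.has_vector_derivative[OF bounded_linear_divide]
        bounded_linear.has_vector_derivative[OF bounded_linear_to_complex] z)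
  have "((Ln \<circ> \<zeta>) has_vector_derivative to_complex D / to_complex (z \<gamma>) * inverse (\<zeta> (\<gamma> i))) (at (\<gamma> i))"
    by (rule field_vector_diff_chain_at[OF \<zeta> has_field_derivative_Ln]) (simp add: one)
  then have "((\<lambda>t. Im ((Ln \<circ> \<zeta>) t)) has_vector_derivative
      Im (to_complex D / to_complex (z \<gamma>) * inverse (\<zeta> (\<gamma> i)))) (at (\<gamma> i))"
    by (rule bounded_linear.has_vector_derivative[OF bounded_linear_Im])
  then have L: "((\<lambda>t. Im (Ln (\<zeta> t))) has_real_derivative Im (to_complex D / to_complex (z \<gamma>))) (at (\<gamma> i))"
    by (simp add: one has_real_derivative_iff_has_vector_derivative)
  have "(\<zeta> \<longlongrightarrow> 1) (at (\<gamma> i))"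
    using has_vector_derivative_continuous[OF \<zeta>] one by (simp add: isCont_def)
  then have "\<forall>\<^sub>F t in nhds (\<gamma> i). \<zeta> t \<noteq> 0"
    using one tendsto_imp_eventually_ne[of \<zeta> 1 "at (\<gamma> i)" 0]
    by (simp add: eventually_nhds_conv_at)
  then have "\<forall>\<^sub>F t in nhds (\<gamma> i). Im (Ln (\<zeta> t)) = Arg (\<zeta> t)"
    by eventually_elim (simp add: Arg_eq_Im_Ln)
  with L have "((\<lambda>t. Arg (\<zeta> t)) has_real_derivative Im (to_complex D / to_complex (z \<gamma>))) (at (\<gamma> i))"
    by (subst DERIV_cong_ev[OF refl _ refl, symmetric]) auto
  from DERIV_imp_deriv[OF this]
  have "partial_angle z \<gamma> i = Im (to_complex D / to_complex (z \<gamma>))"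
    by (simp add: partial_angle_def partial_def \<zeta>_def)
  also have "\<dots> = cross (z \<gamma>) D / (norm (z \<gamma>))\<^sup>2"
    by (simp add: to_complex_def cross_def norm_prod_def Im_divide algebra_simps)
  finally show ?thesis .
qed

lemma cos_sin_polar_angle_diff:
  assumes "p \<noteq> 0" "q \<noteq> 0"
  shows "sin (polar_angle p - polar_angle q) = cross q p / (norm p * norm q)"
    and "cos (polar_angle p - polar_angle q) = inner p q / (norm p * norm q)"
proof -
  have "to_complex p \<noteq> 0" "to_complex q \<noteq> 0" using assms by (auto simp: to_complex_eq_0_iff)
  note * = cos_Arg[OF this(1)] sin_Arg[OF this(1)] cos_Arg[OF this(2)] sin_Arg[OF this(2)]
  show "sin (polar_angle p - polar_angle q) = cross q p / (norm p * norm q)"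
    unfolding polar_angle_def sin_diff * norm_to_complex
    by (simp add: to_complex_def cross_def mult.commute flip: diff_divide_distrib)
  show "cos (polar_angle p - polar_angle q) = inner p q / (norm p * norm q)"
    unfolding polar_angle_def cos_diff * norm_to_complex
    by (simp add: to_complex_def inner_prod_def flip: add_divide_distrib)
qed

lemma cos_polar_angle: "p \<noteq> 0 \<Longrightarrow> cos (polar_angle p) = fst p / norm p"
  by (subst polar_angle_def, subst cos_Arg)
    (auto simp: to_complex_eq_0_iff norm_to_complex, simp add: to_complex_def)

section \<open>Rotations and the derivatives of the contour\<close>

lemma sincos_sq: "cos t * cos t + sin t * sin t = (1::real)"
  using sin_cos_squared_add3 by simp

lemma rotation_identities:
  fixes c s :: real
  shows "(c * p - s * q) * (c * p' - s * q') + (s * p + c * q) * (s * p' + c * q') =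
      (c * c + s * s) * (p * p' + q * q')"
    and "(c * p - s * q) * (s * p' + c * q') - (s * p + c * q) * (c * p' - s * q') =
      (c * c + s * s) * (p * q' - q * p')"
  by (simp_all add: algebra_simps)

lemma inner_rot: "inner (rot t p) (rot t q) = inner p q"
proof -
  have "inner (rot t p) (rot t q) = (cos t * cos t + sin t * sin t) * inner p q"
    by (simp only: rot_def inner_prod_def fst_conv snd_conv inner_real_def rotation_identities)
  then show ?thesis by (simp add: sincos_sq)
qed

lemma cross_rot: "cross (rot t p) (rot t q) = cross p q"
proof -
  have "cross (rot t p) (rot t q) = (cos t * cos t + sin t * sin t) * cross p q"
    by (simp only: rot_def cross_def fst_conv snd_conv rotation_identities)
  then show ?thesis by (simp add: sincos_sq)
qed

lemma norm_rot: "norm (rot t p) = norm p"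
  by (simp add: norm_eq_sqrt_inner inner_rot)

lemma norm_pair: "norm (p, q) = sqrt (p\<^sup>2 + q\<^sup>2)" for p q :: real
  by (simp add: norm_prod_def)

lemma rho_eq: "rho Q \<gamma> u = (cos_sum Q (coeff_a \<gamma>) u, sin_sum Q (coeff_b Q \<gamma>) u)"
  by (simp add: rho_def cos_sum_def sin_sum_def sigma_def varsigma_def mult.commute)

lemma rho_has_vector_derivative:
  "(rho Q \<gamma> has_vector_derivative (dcos_sum Q (coeff_a \<gamma>) u, dsin_sum Q (coeff_b Q \<gamma>) u)) (at u)"
  unfolding rho_eq[abs_def]
  by (intro has_vector_derivative_Pair)
    (auto simp flip: has_real_derivative_iff_has_vector_derivative intro!: derivative_intros)

lemma rho_dot_eq: "rho_dot Q \<gamma> u = (dcos_sum Q (coeff_a \<gamma>) u, dsin_sum Q (coeff_b Q \<gamma>) u)"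
  unfolding rho_dot_def by (rule vector_derivative_at[OF rho_has_vector_derivative])

lemma bounded_linear_rot: "bounded_linear (rot t)"
  unfolding rot_def
  by (intro bounded_linear_Pair bounded_linear_sub bounded_linear_add
      bounded_linear_compose[OF bounded_linear_mult_right] bounded_linear_fst bounded_linear_snd)

lemma contour_dot_eq: "contour_dot Q \<gamma> u = rot (\<gamma> 2) (rho_dot Q \<gamma> u)"
proof -
  have "(contour Q \<gamma> has_vector_derivative 0 + rot (\<gamma> 2) (dcos_sum Q (coeff_a \<gamma>) u, dsin_sum Q (coeff_b Q \<gamma>) u)) (at u)"
    unfolding contour_def[abs_def]
    by (intro has_vector_derivative_add has_vector_derivative_const
        bounded_linear.has_vector_derivative[OF bounded_linear_rot] rho_has_vector_derivative)
  then show ?thesis unfolding contour_dot_def rho_dot_eq using vector_derivative_at by fastforce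
qed

text \<open>The contour in the axes of the target. Distances and aspect angles can be computed here,
  and direction and orientation enter only through their difference.\<close>

definition local_contour :: "nat \<Rightarrow> (nat \<Rightarrow> real) \<Rightarrow> real \<Rightarrow> real \<times> real" where
  "local_contour Q \<gamma> u = (\<gamma> 0 * cos (\<gamma> 1 - \<gamma> 2) + cos_sum Q (coeff_a \<gamma>) u,
     \<gamma> 0 * sin (\<gamma> 1 - \<gamma> 2) + sin_sum Q (coeff_b Q \<gamma>) u)"

lemma rotated_direction:
  "cos p = cos q * cos (p - q) - sin q * sin (p - q)"
  "sin p = sin q * cos (p - q) + cos q * sin (p - q)" for p q :: real
  using cos_add[of q "p - q"] sin_add[of q "p - q"] by simp_all

lemma contour_eq: "contour Q \<gamma> u = rot (\<gamma> 2) (local_contour Q \<gamma> u)"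
  unfolding contour_def centre_def rot_def local_contour_def rho_eq
    rotated_direction[of "\<gamma> 1" "\<gamma> 2"]
  by (simp add: algebra_simps)

text \<open>The coefficient sequences of a unit step in parameter \<open>i\<close>. They can also be
  1 at \<open>q = 0\<close> or beyond \<open>Q\<close>, as \<open>unit_a 2 0\<close> is; this lets
  \<open>coeff_upd\<close> hold for every \<open>q\<close>, and the sums over \<open>1..Q\<close>
  never see these entries.\<close>

definition unit_a :: "nat \<Rightarrow> nat \<Rightarrow> real" where "unit_a i q = of_bool (2 + q = i)"
definition unit_b :: "nat \<Rightarrow> nat \<Rightarrow> nat \<Rightarrow> real" where "unit_b Q i q = of_bool (2 + Q + q = i)"

lemma coeff_upd:
  "coeff_a (\<gamma>(i := t)) q = coeff_a \<gamma> q + (t - \<gamma> i) * unit_a i q"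
  "coeff_b Q (\<gamma>(i := t)) q = coeff_b Q \<gamma> q + (t - \<gamma> i) * unit_b Q i q"
  by (auto simp: coeff_a_def coeff_b_def unit_a_def unit_b_def)

lemma trig_sum_linear:
  "cos_sum Q (\<lambda>q. A q + k * B q) u = cos_sum Q A u + k * cos_sum Q B u"
  "sin_sum Q (\<lambda>q. A q + k * B q) u = sin_sum Q A u + k * sin_sum Q B u"
  "dcos_sum Q (\<lambda>q. A q + k * B q) u = dcos_sum Q A u + k * dcos_sum Q B u"
  "dsin_sum Q (\<lambda>q. A q + k * B q) u = dsin_sum Q A u + k * dsin_sum Q B u"
  by (simp_all add: cos_sum_def sin_sum_def dcos_sum_def dsin_sum_def sum_distrib_left sum.distrib sum_negf sum_subtractf algebra_simps)

lemma coeff_upd_fun: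
  "coeff_a (\<gamma>(i := t)) = (\<lambda>q. coeff_a \<gamma> q + (t - \<gamma> i) * unit_a i q)"
  "coeff_b Q (\<gamma>(i := t)) = (\<lambda>q. coeff_b Q \<gamma> q + (t - \<gamma> i) * unit_b Q i q)"
  by (rule ext, rule coeff_upd)+

lemma param_has_derivative:
  "((\<lambda>t. (\<gamma>(i := t)) k) has_real_derivative of_bool (i = k)) (at s)" for \<gamma> :: "nat \<Rightarrow> real"
  by (cases "i = k") (auto intro: derivative_eq_intros)

text \<open>The derivative with respect to parameter \<open>i\<close> in the axes of the target. The
  rotation by the orientation is applied in \<open>contour_has_partial\<close> and cancels in inner
  and cross products with the contour.\<close>

definition contour_grad :: "nat \<Rightarrow> (nat \<Rightarrow> real) \<Rightarrow> nat \<Rightarrow> real \<Rightarrow> real \<times> real" where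
  "contour_grad Q \<gamma> i u =
    (of_bool (i = 0) * cos (\<gamma> 1 - \<gamma> 2) - of_bool (i = 1) * (\<gamma> 0 * sin (\<gamma> 1 - \<gamma> 2))
       - of_bool (i = 2) * sin_sum Q (coeff_b Q \<gamma>) u + cos_sum Q (unit_a i) u,
     of_bool (i = 0) * sin (\<gamma> 1 - \<gamma> 2) + of_bool (i = 1) * (\<gamma> 0 * cos (\<gamma> 1 - \<gamma> 2))
       + of_bool (i = 2) * cos_sum Q (coeff_a \<gamma>) u + sin_sum Q (unit_b Q i) u)"

lemma contour_has_partial:
  "((\<lambda>t. contour Q (\<gamma>(i := t)) u) has_vector_derivative rot (\<gamma> 2) (contour_grad Q \<gamma> i u)) (at (\<gamma> i))"
proof -
  let ?r = "\<lambda>t. cos_sum Q (coeff_a \<gamma>) u + (t - \<gamma> i) * cos_sum Q (unit_a i) u"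
  let ?s = "\<lambda>t. sin_sum Q (coeff_b Q \<gamma>) u + (t - \<gamma> i) * sin_sum Q (unit_b Q i) u"
  let ?p = "\<lambda>k t. (\<gamma>(i := t)) k"
  note p = param_has_derivative[of \<gamma> i, THEN DERIV_cong]
  have eq: "contour Q (\<gamma>(i := t)) u =
     (?p 0 t * cos (?p 1 t) + (cos (?p 2 t) * ?r t - sin (?p 2 t) * ?s t),
      ?p 0 t * sin (?p 1 t) + (sin (?p 2 t) * ?r t + cos (?p 2 t) * ?s t))" for t
    by (simp only: contour_def centre_def rho_eq coeff_upd_fun trig_sum_linear rot_def fst_conv snd_conv add_Pair)
  show ?thesis unfolding eq rot_def contour_grad_def fst_conv snd_conv
    by (intro has_vector_derivative_Pair; unfold has_real_derivative_iff_has_vector_derivative[symmetric])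
      (rule derivative_eq_intros param_has_derivative refl | 
        (simp add: rotated_direction[of "\<gamma> 1" "\<gamma> 2"] algebra_simps del: One_nat_def; fail))+
qed

lemma contour_dot_has_partial:
  "((\<lambda>t. contour_dot Q (\<gamma>(i := t)) u) has_vector_derivative
     rot (\<gamma> 2) (dcos_sum Q (unit_a i) u - of_bool (i = 2) * dsin_sum Q (coeff_b Q \<gamma>) u,
       dsin_sum Q (unit_b Q i) u + of_bool (i = 2) * dcos_sum Q (coeff_a \<gamma>) u)) (at (\<gamma> i))"
proof -
  let ?r = "\<lambda>t. dcos_sum Q (coeff_a \<gamma>) u + (t - \<gamma> i) * dcos_sum Q (unit_a i) u"
  let ?s = "\<lambda>t. dsin_sum Q (coeff_b Q \<gamma>) u + (t - \<gamma> i) * dsin_sum Q (unit_b Q i) u"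
  let ?p = "\<lambda>k t. (\<gamma>(i := t)) k"
  have eq: "contour_dot Q (\<gamma>(i := t)) u =
     (cos (?p 2 t) * ?r t - sin (?p 2 t) * ?s t, sin (?p 2 t) * ?r t + cos (?p 2 t) * ?s t)" for t
    by (simp only: contour_dot_eq rho_dot_eq coeff_upd_fun trig_sum_linear rot_def fst_conv snd_conv)
  show ?thesis unfolding eq rot_def fst_conv snd_conv
    by (intro has_vector_derivative_Pair; unfold has_real_derivative_iff_has_vector_derivative[symmetric])
      (rule derivative_eq_intros param_has_derivative refl | (simp add: algebra_simps; fail))+
qed

section \<open>A target at long range\<close>

text \<open>The range is varied as \<open>\<gamma>(0 := d)\<close>; the line of sight in the axes of
  the target, the shape and the speed do not change with \<open>d\<close>.\<close>

locale far_target = trig_contour Q "coeff_a \<gamma>" "coeff_b Q \<gamma>" x y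
    for Q and \<gamma> :: "nat \<Rightarrow> real" and x y +
  fixes \<alpha> :: real
  assumes x_eq: "x = cos (\<gamma> 1 - \<gamma> 2)" and y_eq: "y = sin (\<gamma> 1 - \<gamma> 2)" and \<alpha>: "\<alpha> \<ge> 0"
begin

abbreviation "r1 \<equiv> cos_sum Q (coeff_a \<gamma>)"
abbreviation "r2 \<equiv> sin_sum Q (coeff_b Q \<gamma>)"
abbreviation "p1 \<equiv> dcos_sum Q (coeff_a \<gamma>)"
abbreviation "p2 \<equiv> dsin_sum Q (coeff_b Q \<gamma>)"

lemma continuous_trig_sum:
  "continuous_on S (cos_sum Q A)" "continuous_on S (sin_sum Q A)"
  "continuous_on S (dcos_sum Q A)" "continuous_on S (dsin_sum Q A)"
  unfolding cos_sum_def[abs_def] sin_sum_def[abs_def] dcos_sum_def[abs_def] dsin_sum_def[abs_def]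
  by (intro continuous_intros)+

lemma continuous_speed: "continuous_on S speed"
  unfolding speed_def[abs_def] by (intro continuous_intros continuous_trig_sum)

sublocale weighted_period speed
  by unfold_locales (fact continuous_speed speed_pos)+

lemma far_coeffs:
  "coeff_a (\<gamma>(0 := d)) = coeff_a \<gamma>" "coeff_b Q (\<gamma>(0 := d)) = coeff_b Q \<gamma>"
  by (simp_all add: coeff_a_def[abs_def] coeff_b_def[abs_def])

lemma far_upd: "(\<gamma>(0 := d)) 0 = d" "(\<gamma>(0 := d)) 1 = \<gamma> 1" "(\<gamma>(0 := d)) 2 = \<gamma> 2"
  by simp_all

lemma far_rho_dot: "rho_dot Q (\<gamma>(0 := d)) u = (p1 u, p2 u)"
  unfolding rho_dot_eq far_coeffs ..

lemma far_contour_dot: "contour_dot Q (\<gamma>(0 := d)) u = rot (\<gamma> 2) (p1 u, p2 u)"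
  unfolding contour_dot_eq far_rho_dot by simp

lemma norm_far_contour_dot: "norm (contour_dot Q (\<gamma>(0 := d)) u) = speed u"
  unfolding far_contour_dot norm_rot by (simp add: norm_pair speed_def)

lemma star_inner_eq: "star_inner Q (\<gamma>(0 := d)) f g = wint f g"
  by (simp add: star_inner_def wint_def norm_far_contour_dot)

lemma star_norm_sq: "(star_norm Q (\<gamma>(0 := d)) f)\<^sup>2 = wint f f"
  by (simp add: star_norm_def star_inner_eq wint_nonneg)

lemma proj_perp_w_eq: "proj_perp_w Q \<alpha> (\<gamma>(0 := d)) f = remove (w_fun Q \<alpha> (\<gamma>(0 := d))) f"
  by (simp add: proj_perp_w_def remove_def star_inner_eq)

lemma pair_inner_eq:
  "pair_inner Q (\<gamma>(0 := d)) f g = wint (fst f) (fst g) + wint (snd f) (snd g)"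
  by (simp add: pair_inner_def star_inner_eq)

text \<open>\<open>X\<close> and \<open>Y\<close> are the coordinates of the contour point in the
  axes of the target, divided by the range; they tend to the line of sight. \<open>iota\<close> is
  the reciprocal of their norm, so the distance is \<open>d / iota d u\<close>. The shape
  \<open>r * (1 / d)\<close> fits the rules for \<open>bconv\<close>.\<close>

definition X where "X d u = x + r1 u * (1 / d)"
definition Y where "Y d u = y + r2 u * (1 / d)"
definition iota where "iota d u = 1 / sqrt ((X d u)\<^sup>2 + (Y d u)\<^sup>2)"

text \<open>In the direction entry the factor \<open>d\<close> from moving the centre cancels
  against the small angle between line of sight and contour point (see \<open>crs_XY'\<close>). What
  is left is exactly minus the orientation entry.\<close>

definition mu_far where
  "mu_far d i u = iota d u * (if i = 0 then X d u * x + Y d u * y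
     else if i = 1 then crs u else if i = 2 then - crs u
     else X d u * cos_sum Q (unit_a i) u + Y d u * sin_sum Q (unit_b Q i) u)"

text \<open>Every entry except that of the direction carries a factor \<open>1 / d\<close>: at long
  range only turning about the radar moves the bearing.\<close>

definition eta_far where
  "eta_far d i u = iota d u * iota d u * (if i = 0 then (X d u * y - Y d u * x) * (1 / d)
     else if i = 1 then X d u * x + Y d u * y else if i = 2 then (X d u * r1 u + Y d u * r2 u) * (1 / d)
     else (X d u * sin_sum Q (unit_b Q i) u - Y d u * cos_sum Q (unit_a i) u) * (1 / d))"

text \<open>Beyond this range the part of \<open>X\<^sup>2 + Y\<^sup>2\<close> linear in
  \<open>1 / d\<close> is at most 1/2 in absolute value, which leaves at least 1 - 1/2. The final 1
  makes positivity immediate.\<close>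

definition far :: real where
  "far = 4 * ((\<Sum>q=1..Q. \<bar>coeff_a \<gamma> q\<bar>) + (\<Sum>q=1..Q. \<bar>coeff_b Q \<gamma> q\<bar>)) + 1"

lemma far_pos: "far > 0"
  unfolding far_def by (intro add_nonneg_pos mult_nonneg_nonneg add_nonneg_nonneg sum_nonneg) auto

lemma norm_bound:
  assumes "d \<ge> far"
  shows "(X d u)\<^sup>2 + (Y d u)\<^sup>2 \<ge> 1 / 2"
proof -
  let ?S = "(\<Sum>q=1..Q. \<bar>coeff_a \<gamma> q\<bar>) + (\<Sum>q=1..Q. \<bar>coeff_b Q \<gamma> q\<bar>)"
  have d: "d > 0" using assms far_pos by linarith
  have r: "\<bar>r1 u\<bar> \<le> (\<Sum>q=1..Q. \<bar>coeff_a \<gamma> q\<bar>)" "\<bar>r2 u\<bar> \<le> (\<Sum>q=1..Q. \<bar>coeff_b Q \<gamma> q\<bar>)"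
    unfolding cos_sum_def sin_sum_def
    by (rule order_trans[OF sum_abs], intro sum_mono, simp add: abs_mult mult_left_le)+
  have xy: "\<bar>x\<bar> \<le> 1" "\<bar>y\<bar> \<le> 1" unfolding x_eq y_eq by auto
  have "\<bar>x * r1 u + y * r2 u\<bar> \<le> \<bar>x\<bar> * \<bar>r1 u\<bar> + \<bar>y\<bar> * \<bar>r2 u\<bar>"
    unfolding abs_mult[symmetric] by (rule abs_triangle_ineq)
  also have "\<dots> \<le> 1 * \<bar>r1 u\<bar> + 1 * \<bar>r2 u\<bar>"
    using xy by (intro add_mono mult_right_mono) auto
  also have "\<dots> \<le> ?S" using r by simp
  also have "\<dots> \<le> d / 4" using assms unfolding far_def by (simp add: field_simps)
  finally have "\<bar>x * r1 u + y * r2 u\<bar> \<le> d / 4" .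
  then have "\<bar>(x * r1 u + y * r2 u) * (1 / d)\<bar> \<le> 1 / 4"
    using d by (simp add: abs_mult field_simps)
  moreover have "(X d u)\<^sup>2 + (Y d u)\<^sup>2 =
      (x\<^sup>2 + y\<^sup>2) + 2 * ((x * r1 u + y * r2 u) * (1 / d)) + ((r1 u * (1/d))\<^sup>2 + (r2 u * (1/d))\<^sup>2)"
    by (simp add: X_def Y_def power2_eq_square algebra_simps)
  moreover have "(r1 u * (1/d))\<^sup>2 + (r2 u * (1/d))\<^sup>2 \<ge> 0" by simp
  ultimately show ?thesis unfolding unit by linarith
qed

lemma eventually_far: "\<forall>\<^sub>F d in at_top. d \<ge> far"
  by (rule eventually_ge_at_top)

lemma bconv_XY: "bconv X (\<lambda>u. x)" "bconv Y (\<lambda>u. y)"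
proof -
  have "bconv (\<lambda>d u. x + r1 u * (1 / d)) (\<lambda>u. x + r1 u * 0)"
    by (intro bconv_intros bounded_measurable_continuous continuous_trig_sum continuous_intros)
  then show "bconv X (\<lambda>u. x)" by (simp add: X_def[abs_def])
  have "bconv (\<lambda>d u. y + r2 u * (1 / d)) (\<lambda>u. y + r2 u * 0)"
    by (intro bconv_intros bounded_measurable_continuous continuous_trig_sum continuous_intros)
  then show "bconv Y (\<lambda>u. y)" by (simp add: Y_def[abs_def])
qed

lemma bconv_iota: "bconv iota (\<lambda>u. 1)"
proof -
  have "bconv (\<lambda>d u. X d u * X d u + Y d u * Y d u) (\<lambda>u. x * x + y * y)"
    by (intro bconv_intros bconv_XY)
  moreover have "x * x + y * y = 1" using unit by (simp add: power2_eq_square)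
  ultimately have "bconv (\<lambda>d u. (X d u)\<^sup>2 + (Y d u)\<^sup>2) (\<lambda>u. 1)"
    by (simp add: power2_eq_square)
  then have "bconv (\<lambda>d u. 1 / sqrt ((X d u)\<^sup>2 + (Y d u)\<^sup>2)) (\<lambda>u. 1)"
    by (rule bconv_inverse_sqrt[where m = "1/2"])
      (simp, intro eventually_mono[OF eventually_far] ballI norm_bound)
  then show ?thesis by (simp add: iota_def[abs_def])
qed

lemma far_local_contour:
  "d \<noteq> 0 \<Longrightarrow> local_contour Q (\<gamma>(0 := d)) u = (d * X d u, d * Y d u)"
  unfolding local_contour_def far_coeffs far_upd x_eq[symmetric] y_eq[symmetric]
  by (simp add: X_def Y_def algebra_simps)

lemma far_contour: "d \<noteq> 0 \<Longrightarrow> contour Q (\<gamma>(0 := d)) u = rot (\<gamma> 2) (d * X d u, d * Y d u)"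
  unfolding contour_eq by (subst far_local_contour) auto

lemma norm_far_contour:
  assumes "d > 0"
  shows "norm (contour Q (\<gamma>(0 := d)) u) = d / iota d u"
proof -
  have "norm (contour Q (\<gamma>(0 := d)) u) = sqrt ((d * X d u)\<^sup>2 + (d * Y d u)\<^sup>2)"
    using assms by (subst far_contour) (simp_all only: norm_rot norm_pair less_imp_neq[symmetric] not_False_eq_True)
  also have "(d * X d u)\<^sup>2 + (d * Y d u)\<^sup>2 = d\<^sup>2 * ((X d u)\<^sup>2 + (Y d u)\<^sup>2)"
    by (simp add: power_mult_distrib distrib_left)
  also have "sqrt \<dots> = d / iota d u" using assms by (simp add: iota_def real_sqrt_mult)
  finally show ?thesis .
qed

context
  fixes d assumes d: "d \<ge> far"
begin

lemma d_pos: "d > 0" using d far_pos by linarith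

lemma d_nonzero: "d \<noteq> 0" using d_pos by simp

lemma iota_pos: "iota d u > 0"
  using norm_bound[OF d, of u] unfolding iota_def by (auto intro!: divide_pos_pos simp: real_sqrt_gt_zero)

lemma far_contour_nonzero: "contour Q (\<gamma>(0 := d)) u \<noteq> 0"
  using norm_far_contour[OF d_pos, of u] d_pos iota_pos[of u] by auto

lemma far_contour_dot_nonzero: "contour_dot Q (\<gamma>(0 := d)) u \<noteq> 0"
  using norm_far_contour_dot[of d u] speed_pos[of u] by auto

lemma sin_aspect:
  "sin (phi Q (\<gamma>(0 := d)) u - beta Q (\<gamma>(0 := d)) u) = (p1 u * Y d u - p2 u * X d u) * iota d u * (1 / speed u)"
  unfolding phi_def beta_def cos_sin_polar_angle_diff(1)[OF far_contour_nonzero far_contour_dot_nonzero]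
    norm_far_contour[OF d_pos] norm_far_contour_dot
  unfolding far_contour[OF d_nonzero] far_contour_dot cross_rot
  using d_pos by (simp add: cross_def divide_simps) (simp add: algebra_simps)

lemma cos_aspect:
  "cos (phi Q (\<gamma>(0 := d)) u - beta Q (\<gamma>(0 := d)) u) = (p1 u * X d u + p2 u * Y d u) * iota d u * (1 / speed u)"
  unfolding phi_def beta_def cos_sin_polar_angle_diff(2)[OF far_contour_nonzero far_contour_dot_nonzero]
    norm_far_contour[OF d_pos] norm_far_contour_dot
  unfolding far_contour[OF d_nonzero] far_contour_dot inner_rot
  using d_pos by (simp add: inner_prod_def divide_simps) (simp add: algebra_simps)

lemma cos_phi: "cos (phi Q (\<gamma>(0 := d)) u) = (cos (\<gamma> 2) * X d u - sin (\<gamma> 2) * Y d u) * iota d u"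
  unfolding phi_def cos_polar_angle[OF far_contour_nonzero] norm_far_contour[OF d_pos]
  unfolding far_contour[OF d_nonzero]
  using d_pos by (simp add: rot_def divide_simps) (simp add: algebra_simps)

end

text \<open>The tangent turns with the orientation at rate 1 and does not depend on the centre: for
  range and direction the formula gives 0 by \<open>unit_sums_0\<close>.\<close>

definition beta_grad where
  "beta_grad i u = (if i = 2 then 1
     else (p1 u * dsin_sum Q (unit_b Q i) u - p2 u * dcos_sum Q (unit_a i) u) * (1 / (speed u)\<^sup>2))"

lemma unit_sums_0:
  assumes "i \<le> 2"
  shows "cos_sum Q (unit_a i) u = 0" "sin_sum Q (unit_b Q i) u = 0"
    "dcos_sum Q (unit_a i) u = 0" "dsin_sum Q (unit_b Q i) u = 0"
  using assms
  by (auto simp: cos_sum_def sin_sum_def dcos_sum_def dsin_sum_def unit_a_def unit_b_def intro!: sum.neutral)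

lemma crs_XY: "d \<noteq> 0 \<Longrightarrow> X d u * r2 u - Y d u * r1 u = crs u"
  by (simp add: X_def Y_def crs_def field_simps)

lemma crs_XY': "d \<noteq> 0 \<Longrightarrow> d * (Y d u * x - X d u * y) = crs u"
  by (simp add: X_def Y_def crs_def field_simps)

lemma far_grad:
  "contour_grad Q (\<gamma>(0 := d)) i u =
    (if i = 0 then (x, y) else if i = 1 then (- d * y, d * x) else if i = 2 then (- r2 u, r1 u)
     else (cos_sum Q (unit_a i) u, sin_sum Q (unit_b Q i) u))"
proof -
  consider "i = 0" | "i = 1" | "i = 2" | "i \<ge> 3" by linarith
  then show ?thesis
    unfolding contour_grad_def far_coeffs
    by cases (auto simp: unit_sums_0 x_eq y_eq)
qed

context
  fixes d assumes d: "d \<ge> far"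
begin

lemma mu_eq: "mu Q (\<gamma>(0 := d)) i u = mu_far d i u"
proof -
  have "mu Q (\<gamma>(0 := d)) i u = inner (contour Q (\<gamma>(0 := d)) u)
      (rot ((\<gamma>(0 := d)) 2) (contour_grad Q (\<gamma>(0 := d)) i u)) / norm (contour Q (\<gamma>(0 := d)) u)"
    unfolding mu_def distance_def by (rule partial_norm[OF contour_has_partial far_contour_nonzero[OF d]])
  also have "\<dots> = inner (d * X d u, d * Y d u) (contour_grad Q (\<gamma>(0 := d)) i u) / (d / iota d u)"
    unfolding norm_far_contour[OF d_pos[OF d]] unfolding far_contour[OF d_nonzero[OF d]] far_upd inner_rot ..
  also have "\<dots> = iota d u * inner (X d u, Y d u) (contour_grad Q (\<gamma>(0 := d)) i u)"
    using d_pos[OF d] iota_pos[OF d, of u] by (simp add: inner_prod_def divide_simps) (simp add: algebra_simps)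
  also have "inner (X d u, Y d u) (contour_grad Q (\<gamma>(0 := d)) i u) =
     (if i = 0 then X d u * x + Y d u * y
     else if i = 1 then crs u else if i = 2 then - crs u
     else X d u * cos_sum Q (unit_a i) u + Y d u * sin_sum Q (unit_b Q i) u)"
    unfolding far_grad
    using crs_XY[OF d_nonzero[OF d], of u, symmetric] crs_XY'[OF d_nonzero[OF d], of u, symmetric]
    by (auto simp: inner_prod_def algebra_simps)
  also have "iota d u * \<dots> = mu_far d i u"
    unfolding mu_far_def ..
  finally show ?thesis .
qed

lemma eta_eq: "eta Q (\<gamma>(0 := d)) i u = eta_far d i u"
proof -
  have "eta Q (\<gamma>(0 := d)) i u = cross (contour Q (\<gamma>(0 := d)) u)
      (rot ((\<gamma>(0 := d)) 2) (contour_grad Q (\<gamma>(0 := d)) i u)) / (norm (contour Q (\<gamma>(0 := d)) u))\<^sup>2"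
    unfolding eta_def by (rule partial_angle_eq[OF contour_has_partial far_contour_nonzero[OF d]])
  also have "\<dots> = cross (d * X d u, d * Y d u) (contour_grad Q (\<gamma>(0 := d)) i u) / (d / iota d u)\<^sup>2"
    unfolding norm_far_contour[OF d_pos[OF d]] unfolding far_contour[OF d_nonzero[OF d]] far_upd cross_rot ..
  also have "\<dots> = iota d u * iota d u * (cross (X d u, Y d u) (contour_grad Q (\<gamma>(0 := d)) i u) * (1 / d))"
    using d_pos[OF d] iota_pos[OF d, of u]
    by (simp add: cross_def divide_simps power2_eq_square) (simp add: algebra_simps)
  also have "\<dots> = eta_far d i u"
    unfolding far_grad eta_far_def
    using d_pos[OF d] by (auto simp: cross_def field_simps)
  finally show ?thesis .
qed

lemma beta_grad_eq: "partial_angle (\<lambda>\<gamma>'. contour_dot Q \<gamma>' u) (\<gamma>(0 := d)) i = beta_grad i u"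
proof -
  have "partial_angle (\<lambda>\<gamma>'. contour_dot Q \<gamma>' u) (\<gamma>(0 := d)) i =
      cross (p1 u, p2 u) (dcos_sum Q (unit_a i) u - of_bool (i = 2) * p2 u,
        dsin_sum Q (unit_b Q i) u + of_bool (i = 2) * p1 u) / (speed u)\<^sup>2"
    unfolding partial_angle_eq[OF contour_dot_has_partial far_contour_dot_nonzero[OF d]]
      norm_far_contour_dot
    unfolding far_contour_dot far_upd cross_rot far_coeffs ..
  also have "\<dots> = beta_grad i u"
    using speed_pos[of u] speed_sq[of u] unit_sums_0[of i u]
    by (auto simp: beta_grad_def cross_def power2_eq_square)
  finally show ?thesis .
qed

lemma xi_eq: "xi Q (\<gamma>(0 := d)) i u = eta_far d i u - beta_grad i u"
  unfolding xi_def eta_eq beta_grad_eq ..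

end

section \<open>Limits of the weights and features\<close>

definition vis where "vis d u = (p1 u * Y d u - p2 u * X d u) * iota d u * (1 / speed u)"
definition w_far where "w_far d u = max (vis d u) 0 powr (\<alpha> + 1)"
definition v_far where "v_far d u = max (vis d u) 0 powr \<alpha> *
  ((p1 u * X d u + p2 u * Y d u) * iota d u * (1 / speed u))"

definition w_lim where "w_lim u = max (hgt u / speed u) 0 powr (\<alpha> + 1)"
definition v_lim where "v_lim u = max (hgt u / speed u) 0 powr \<alpha> * (tng u / speed u)"

lemma w_fun_eq: "d \<ge> far \<Longrightarrow> w_fun Q \<alpha> (\<gamma>(0 := d)) = w_far d"
  unfolding w_fun_def sin_bar_def w_far_def vis_def by (rule ext) (subst sin_aspect, auto)

lemma v_fun_eq: "d \<ge> far \<Longrightarrow> v_fun Q \<alpha> (\<gamma>(0 := d)) = v_far d"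
  unfolding v_fun_def sin_bar_def v_far_def vis_def
  by (rule ext) (subst sin_aspect, simp, subst cos_aspect, auto)

lemma bm_trig_sum [bm_intros]:
  "bounded_measurable (cos_sum Q A)" "bounded_measurable (sin_sum Q A)"
  "bounded_measurable (dcos_sum Q A)" "bounded_measurable (dsin_sum Q A)"
  by (rule bounded_measurable_continuous, rule continuous_trig_sum)+

lemma bm_inverse_speed [bm_intros]:
  "bounded_measurable (\<lambda>u. 1 / speed u)" "bounded_measurable (\<lambda>u. 1 / (speed u)\<^sup>2)"
  by (rule bounded_measurable_continuous, intro continuous_intros continuous_speed,
      use speed_pos in \<open>auto simp: less_imp_neq[symmetric]\<close>)+

lemma bm_crs [bm_intros]: "bounded_measurable crs"
  unfolding crs_def[abs_def] by (intro bm_intros)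

lemma bconv_vis: "bconv vis (\<lambda>u. hgt u / speed u)"
proof -
  have "bconv (\<lambda>d u. (p1 u * Y d u - p2 u * X d u) * iota d u * (1 / speed u))
     (\<lambda>u. (p1 u * y - p2 u * x) * 1 * (1 / speed u))"
    by (intro bconv_intros bconv_XY bconv_iota bm_intros)
  then show ?thesis by (simp add: vis_def[abs_def] hgt_def[abs_def] mult.commute)
qed

text \<open>For \<alpha> = 0 the limit of v rests on this: \<open>hgt\<close> is entire and not
  identically zero, so it has finitely many zeros in a period.\<close>

lemma hgt_nonzero_AE: "AE u in lborel. u \<in> {0..2*pi} \<longrightarrow> hgt u / speed u \<noteq> 0"
proof -
  have "entire_real hgt" unfolding hgt_def[abs_def] by (intro entire_intros)
  moreover obtain u where "hgt u \<noteq> 0" using hgt_positive by force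
  ultimately have "finite {u \<in> {0..2*pi}. hgt u = 0}" by (rule entire_real_finite_zeros)
  then have "AE u in lborel. u \<notin> {u \<in> {0..2*pi}. hgt u = 0}"
    by (intro AE_not_in finite_imp_null_set_lborel)
  then show ?thesis by eventually_elim (use speed_pos in \<open>auto simp: less_imp_neq[symmetric]\<close>)
qed

lemma bconv_w: "bconv w_far w_lim"
  unfolding w_far_def[abs_def] w_lim_def[abs_def]
  by (rule bconv_positive_part_powr[OF bconv_vis]) (use \<alpha> in auto)

lemma bconv_v: "bconv v_far v_lim"
proof -
  have "bconv (\<lambda>d u. max (vis d u) 0 powr \<alpha> * ((p1 u * X d u + p2 u * Y d u) * iota d u * (1 / speed u)))
     (\<lambda>u. max (hgt u / speed u) 0 powr \<alpha> * ((p1 u * x + p2 u * y) * 1 * (1 / speed u)))"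
    by (intro bconv_mult[OF bconv_positive_part_powr[OF bconv_vis \<alpha> hgt_nonzero_AE]]
        bconv_intros bconv_XY bconv_iota bm_intros)
  then show ?thesis by (simp add: v_far_def[abs_def] v_lim_def[abs_def] tng_def[abs_def] mult.commute)
qed

lemma bm_lim [bm_intros]: "bounded_measurable w_lim" "bounded_measurable v_lim"
  using bconv_bounded_measurable bconv_w bconv_v by blast+

text \<open>\<open>idx\<close> sends a parameter to its limiting pair (range, orientation, generators of \<open>\<A>\<close>): in the
  limit, direction and orientation differ only by a sign, except in the angular part.\<close>

definition idx :: "nat \<Rightarrow> nat" where "idx i = (if i \<le> 1 then i else i - 1)"
definition sg :: "nat \<Rightarrow> real" where "sg i = (if i = 2 then -1 else 1)"

text \<open>\<open>rng\<close> and \<open>ang\<close> are the limits of the derivatives of distance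
  and aspect angle, up to the sign \<open>sg\<close>. For \<open>l \<ge> 2\<close> the parameter
  behind index \<open>l\<close> is \<open>l + 1\<close>, because direction and orientation share
  \<open>l = 1\<close>.\<close>

definition rng :: "nat \<Rightarrow> real \<Rightarrow> real" where
  "rng l u = (if l = 0 then 1 else if l = 1 then crs u
     else x * cos_sum Q (unit_a (l + 1)) u + y * sin_sum Q (unit_b Q (l + 1)) u)"

definition ang :: "nat \<Rightarrow> real \<Rightarrow> real" where
  "ang l u = (if l = 0 then 0 else if l = 1 then 1
     else (p2 u * dcos_sum Q (unit_a (l + 1)) u - p1 u * dsin_sum Q (unit_b Q (l + 1)) u) * (1 / (speed u)\<^sup>2))"

lemma bm_rng_ang [bm_intros]: "bounded_measurable (rng l)" "bounded_measurable (ang l)"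
proof -
  show "bounded_measurable (rng l)"
    unfolding rng_def[abs_def] by (intro bm_intros)
  show "bounded_measurable (ang l)"
    unfolding ang_def[abs_def] by (intro bm_intros)
qed

lemma bconv_cong_limit: "bconv F f \<Longrightarrow> (\<And>u. f u = g u) \<Longrightarrow> bconv F g"
  by (subgoal_tac "f = g") auto

lemma bconv_mu: "bconv (\<lambda>d. mu_far d i) (\<lambda>u. sg i * rng (idx i) u)"
proof -
  consider "i = 0" | "i = 1" | "i = 2" | "i \<ge> 3" by linarith
  then show ?thesis
  proof cases
    case 1
    have "bconv (\<lambda>d u. iota d u * (X d u * x + Y d u * y)) (\<lambda>u. 1 * (x * x + y * y))"
      by (intro bconv_intros bconv_XY bconv_iota bm_intros)
    then show ?thesis
      using 1 unit by (simp add: mu_far_def[abs_def] sg_def idx_def rng_def power2_eq_square)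
  next
    case 2
    have "bconv (\<lambda>d u. iota d u * crs u) (\<lambda>u. 1 * crs u)"
      by (intro bconv_intros bconv_XY bconv_iota bm_intros)
    then show ?thesis using 2 by (simp add: mu_far_def[abs_def] sg_def idx_def rng_def)
  next
    case 3
    have "bconv (\<lambda>d u. iota d u * - crs u) (\<lambda>u. 1 * - crs u)"
      by (intro bconv_intros bconv_XY bconv_iota bm_intros)
    then show ?thesis using 3 by (simp add: mu_far_def[abs_def] sg_def idx_def rng_def)
  next
    case 4
    have "bconv (\<lambda>d u. iota d u * (X d u * cos_sum Q (unit_a i) u + Y d u * sin_sum Q (unit_b Q i) u))
       (\<lambda>u. 1 * (x * cos_sum Q (unit_a i) u + y * sin_sum Q (unit_b Q i) u))"
      by (intro bconv_intros bconv_XY bconv_iota bm_intros)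
    moreover have "i - 1 \<noteq> 0" "i - 1 \<noteq> 1" "i - 1 + 1 = i" "i \<noteq> 0" "i \<noteq> 1" "i \<noteq> 2" "\<not> i \<le> 1"
      using 4 by auto
    ultimately show ?thesis by (simp only: mu_far_def[abs_def] sg_def idx_def rng_def if_False mult_1)
  qed
qed

text \<open>The single nonzero limit is the origin of the border entry for the direction.\<close>

lemma bconv_eta: "bconv (\<lambda>d. eta_far d i) (\<lambda>u. of_bool (i = 1))"
proof -
  consider "i = 0" | "i = 1" | "i = 2" | "i \<ge> 3" by linarith
  then show ?thesis
  proof cases
    case 1
    have "bconv (\<lambda>d u. iota d u * iota d u * ((X d u * y - Y d u * x) * (1 / d)))
      (\<lambda>u. 1 * 1 * ((x * y - y * x) * 0))"
      by (intro bconv_intros bconv_XY bconv_iota bm_intros)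
    then show ?thesis using 1 by (simp add: eta_far_def[abs_def])
  next
    case 2
    have "bconv (\<lambda>d u. iota d u * iota d u * (X d u * x + Y d u * y)) (\<lambda>u. 1 * 1 * (x * x + y * y))"
      by (intro bconv_intros bconv_XY bconv_iota bm_intros)
    then show ?thesis using 2 unit by (simp add: eta_far_def[abs_def] power2_eq_square)
  next
    case 3
    have "bconv (\<lambda>d u. iota d u * iota d u * ((X d u * r1 u + Y d u * r2 u) * (1 / d)))
      (\<lambda>u. 1 * 1 * ((x * r1 u + y * r2 u) * 0))"
      by (intro bconv_intros bconv_XY bconv_iota bm_intros)
    then show ?thesis using 3 by (simp add: eta_far_def[abs_def])
  next
    case 4
    have "bconv (\<lambda>d u. iota d u * iota d u *
        ((X d u * sin_sum Q (unit_b Q i) u - Y d u * cos_sum Q (unit_a i) u) * (1 / d)))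
      (\<lambda>u. 1 * 1 * ((x * sin_sum Q (unit_b Q i) u - y * cos_sum Q (unit_a i) u) * 0))"
      by (intro bconv_intros bconv_XY bconv_iota bm_intros)
    then show ?thesis using 4 by (simp add: eta_far_def[abs_def])
  qed
qed

lemma bm_beta_grad [bm_intros]: "bounded_measurable (beta_grad i)"
  unfolding beta_grad_def[abs_def] by (intro bm_intros)

lemma bconv_xi: "bconv (\<lambda>d u. eta_far d i u - beta_grad i u) (\<lambda>u. sg i * ang (idx i) u)"
proof -
  have "bconv (\<lambda>d u. eta_far d i u - beta_grad i u) (\<lambda>u. of_bool (i = 1) - beta_grad i u)"
    by (intro bconv_intros bconv_eta bm_intros)
  moreover have "of_bool (i = 1) - beta_grad i u = sg i * ang (idx i) u" for u
  proof -
    consider "i = 0" | "i = 1" | "i = 2" | "i \<ge> 3" by linarith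
    then show ?thesis
      by cases (auto simp: beta_grad_def sg_def ang_def idx_def unit_sums_0 algebra_simps)
  qed
  ultimately show ?thesis by (rule bconv_cong_limit)
qed

lemma bconv_cos_phi:
  "bconv (\<lambda>d u. (cos (\<gamma> 2) * X d u - sin (\<gamma> 2) * Y d u) * iota d u) (\<lambda>u. cos (\<gamma> 1))"
proof -
  have "bconv (\<lambda>d u. (cos (\<gamma> 2) * X d u - sin (\<gamma> 2) * Y d u) * iota d u)
     (\<lambda>u. (cos (\<gamma> 2) * x - sin (\<gamma> 2) * y) * 1)"
    by (intro bconv_intros bconv_XY bconv_iota bm_intros)
  then show ?thesis
    unfolding x_eq y_eq rotated_direction(1)[of "\<gamma> 1" "\<gamma> 2", symmetric] by simp
qed

text \<open>The visible part contains a nonempty open set, which cannot lie in the union of a null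
  set and a finite set. This converts relations that hold almost everywhere into infinite zero sets,
  as the identity theorem requires.\<close>

lemma visible_infinite:
  assumes "AE u in lborel. u \<in> {0..2*pi} \<longrightarrow> P u"
  shows "infinite {u \<in> {0..2*pi}. hgt u > 0 \<and> P u}"
proof
  let ?O = "{0<..<2*pi} \<inter> {u. hgt u > 0}"
  assume "finite {u \<in> {0..2*pi}. hgt u > 0 \<and> P u}"
  then have "AE u in lborel. u \<notin> {u \<in> {0..2*pi}. hgt u > 0 \<and> P u}"
    by (intro AE_not_in finite_imp_null_set_lborel)
  with assms have ae: "AE u in lborel. u \<notin> ?O" by eventually_elim auto
  have cont: "continuous_on UNIV hgt"
    unfolding hgt_def[abs_def] by (intro continuous_intros continuous_trig_sum)
  have op: "open ?O" by (intro open_Int open_greaterThanLessThan open_Collect_less cont continuous_on_const)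
  then have "?O \<in> null_sets lborel"
    using ae AE_iff_null_sets[of ?O lborel] by auto
  then have "negligible ?O" by (simp add: negligible_iff_null_sets null_sets_completionI)
  moreover have "?O \<noteq> {}" using hgt_positive by auto
  ultimately show False using open_not_negligible[OF op] by blast
qed

lemma w_lim_pos: "hgt u > 0 \<Longrightarrow> w_lim u > 0"
  using speed_pos[of u] divide_pos_pos[of "hgt u" "speed u"] by (simp add: w_lim_def)

lemma wint_w_pos: "wint w_lim w_lim > 0"
proof -
  have "wint w_lim w_lim \<noteq> 0"
  proof
    assume "wint w_lim w_lim = 0"
    then have "AE u in lborel. u \<in> {0..2*pi} \<longrightarrow> w_lim u = 0"
      by (rule wint_eq_0_AE[OF bm_lim(1)])
    then have inf: "infinite {u \<in> {0..2*pi}. hgt u > 0 \<and> w_lim u = 0}" by (rule visible_infinite)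
    have "{u \<in> {0..2*pi}. hgt u > 0 \<and> w_lim u = 0} = {}" using w_lim_pos by force
    with inf show False by (metis finite.emptyI)
  qed
  then show ?thesis using wint_nonneg[of w_lim] by simp
qed

end

section \<open>Gram matrices\<close>

context far_target
begin

text \<open>\<open>w\<close> and \<open>v\<close> are arguments because the matrix is needed twice:
  at finite range, where it describes the projections in the claim, and with the limiting functions,
  for which independence is proved.\<close>

definition gram where
  "gram L w v l k = L * wint (\<lambda>u. w u * rng l u) (\<lambda>u. w u * rng k u)
     + (\<alpha> + 1)\<^sup>2 * wint (remove w (\<lambda>u. v u * ang l u)) (remove w (\<lambda>u. v u * ang k u))"

text \<open>With \<open>s = 1\<close> this picks the coefficients of \<open>a\<close>, with
  \<open>s = 1 + Q\<close> those of \<open>b\<close>.\<close>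

lemma sum_delta_shift:
  fixes v g :: "nat \<Rightarrow> real"
  assumes "s \<ge> 1" "s \<le> 1 + Q"
  shows "(\<Sum>l=2..<2+2*Q. v l * (\<Sum>q=1..Q. of_bool (s + q = l) * g q)) = (\<Sum>q=1..Q. v (s + q) * g q)"
proof -
  have "(\<Sum>l=2..<2+2*Q. v l * (\<Sum>q=1..Q. of_bool (s + q = l) * g q))
      = (\<Sum>q=1..Q. \<Sum>l=2..<2+2*Q. of_bool (s + q = l) * (v l * g q))"
    unfolding sum_distrib_left by (subst sum.swap) (simp add: mult.left_commute)
  also have "\<dots> = (\<Sum>q=1..Q. v (s + q) * g q)"
  proof (rule sum.cong[OF refl])
    fix q assume "q \<in> {1..Q}"
    then have "s + q \<in> {2..<2+2*Q}" using assms by auto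
    moreover have "(\<Sum>l=2..<2+2*Q. of_bool (s + q = l) * (v l * g q))
        = (\<Sum>l=2..<2+2*Q. if l = s + q then v l * g q else 0)"
      by (intro sum.cong) auto
    ultimately show "(\<Sum>l=2..<2+2*Q. of_bool (s + q = l) * (v l * g q)) = v (s + q) * g q" by simp
  qed
  finally show ?thesis .
qed

lemma sum_split2: "(\<Sum>l<2+n. f l) = f 0 + f 1 + (\<Sum>l=2..<2+n. f l)" for f :: "nat \<Rightarrow> real"
  by (induction n) (auto simp: numeral_2_eq_2)

lemma unit_a_Suc: "unit_a (l + 1) q = of_bool (1 + q = l)" and
  unit_b_Suc: "unit_b Q (l + 1) q = of_bool ((1 + Q) + q = l)"
  by (auto simp: unit_a_def unit_b_def)

text \<open>Collects a combination of features into trigonometric sums whose coefficients are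
  entries of \<open>v\<close>, the form that \<open>nondegenerate\<close> asks for.\<close>

lemma rng_combination:
  "(\<Sum>l<2+2*Q. v l * rng l u) =
     v 0 + v 1 * crs u + x * cos_sum Q (\<lambda>q. v (1 + q)) u + y * sin_sum Q (\<lambda>q. v (1 + Q + q)) u"
proof -
  have "(\<Sum>l=2..<2+2*Q. v l * rng l u) = x * (\<Sum>l=2..<2+2*Q. v l * cos_sum Q (unit_a (l + 1)) u)
      + y * (\<Sum>l=2..<2+2*Q. v l * sin_sum Q (unit_b Q (l + 1)) u)"
    unfolding sum_distrib_left sum.distrib[symmetric]
    by (intro sum.cong) (auto simp: rng_def algebra_simps)
  also have "(\<Sum>l=2..<2+2*Q. v l * cos_sum Q (unit_a (l + 1)) u) = cos_sum Q (\<lambda>q. v (1 + q)) u"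
    unfolding cos_sum_def unit_a_Suc by (rule sum_delta_shift) auto
  also have "(\<Sum>l=2..<2+2*Q. v l * sin_sum Q (unit_b Q (l + 1)) u) = sin_sum Q (\<lambda>q. v (1 + Q + q)) u"
    unfolding sin_sum_def unit_b_Suc by (rule sum_delta_shift) auto
  finally show ?thesis unfolding sum_split2 by (simp add: rng_def)
qed

lemma ang_combination:
  "(\<Sum>l<2+2*Q. v l * ang l u) = v 1 + (p2 u * dcos_sum Q (\<lambda>q. v (1 + q)) u
     - p1 u * dsin_sum Q (\<lambda>q. v (1 + Q + q)) u) * (1 / (speed u)\<^sup>2)"
proof -
  have "(\<Sum>l=2..<2+2*Q. v l * ang l u) = (p2 u * (\<Sum>l=2..<2+2*Q. v l * dcos_sum Q (unit_a (l + 1)) u)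
      - p1 u * (\<Sum>l=2..<2+2*Q. v l * dsin_sum Q (unit_b Q (l + 1)) u)) * (1 / (speed u)\<^sup>2)"
    unfolding sum_distrib_left sum_subtractf[symmetric] sum_distrib_right
    by (intro sum.cong) (auto simp: ang_def algebra_simps)
  also have "(\<Sum>l=2..<2+2*Q. v l * dcos_sum Q (unit_a (l + 1)) u) = dcos_sum Q (\<lambda>q. v (1 + q)) u"
    unfolding dcos_sum_def unit_a_Suc by (rule sum_delta_shift) auto
  also have "(\<Sum>l=2..<2+2*Q. v l * dsin_sum Q (unit_b Q (l + 1)) u) = dsin_sum Q (\<lambda>q. v (1 + Q + q)) u"
    unfolding dsin_sum_def unit_b_Suc by (rule sum_delta_shift) auto
  finally show ?thesis unfolding sum_split2 by (simp add: ang_def)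
qed

lemma wint_sum_sum:
  assumes "\<And>i. i \<in> S \<Longrightarrow> bounded_measurable (f i)"
  shows "wint (\<lambda>u. \<Sum>i\<in>S. c i * f i u) (\<lambda>u. \<Sum>i\<in>S. c i * f i u)
    = (\<Sum>i\<in>S. c i * (\<Sum>k\<in>S. c k * wint (f i) (f k)))"
proof -
  have "wint (\<lambda>u. \<Sum>i\<in>S. c i * f i u) (\<lambda>u. \<Sum>i\<in>S. c i * f i u)
      = (\<Sum>i\<in>S. c i * wint (f i) (\<lambda>u. \<Sum>i\<in>S. c i * f i u))"
    by (intro wint_sum assms bm_intros bounded_measurable_const)
  also have "\<dots> = (\<Sum>i\<in>S. c i * wint (\<lambda>u. \<Sum>i\<in>S. c i * f i u) (f i))"
    by (simp only: wint_commute)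
  also have "\<dots> = (\<Sum>i\<in>S. c i * (\<Sum>k\<in>S. c k * wint (f k) (f i)))"
    by (intro sum.cong refl arg_cong2[where f = "(*)"] wint_sum assms)
  finally show ?thesis by (simp only: wint_commute)
qed

lemma gram_form:
  assumes w: "bounded_measurable w" and v: "bounded_measurable v"
  shows "(\<Sum>l<n. c l * (\<Sum>k<n. c k * gram L w v l k)) =
     L * wint (\<lambda>u. \<Sum>l<n. c l * (w u * rng l u)) (\<lambda>u. \<Sum>l<n. c l * (w u * rng l u))
     + (\<alpha> + 1)\<^sup>2 * wint (remove w (\<lambda>u. \<Sum>l<n. c l * (v u * ang l u)))
         (remove w (\<lambda>u. \<Sum>l<n. c l * (v u * ang l u)))"
proof -
  have "remove w (\<lambda>u. \<Sum>l<n. c l * (v u * ang l u)) = (\<lambda>u. \<Sum>l<n. c l * remove w (\<lambda>u. v u * ang l u) u)"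
    by (intro remove_sum bm_intros w v)
  moreover have "wint (\<lambda>u. \<Sum>l<n. c l * (w u * rng l u)) (\<lambda>u. \<Sum>l<n. c l * (w u * rng l u))
    = (\<Sum>i<n. c i * (\<Sum>k<n. c k * wint (\<lambda>u. w u * rng i u) (\<lambda>u. w u * rng k u)))"
    by (intro wint_sum_sum bm_intros w)
  moreover have "wint (\<lambda>u. \<Sum>l<n. c l * remove w (\<lambda>u. v u * ang l u) u) (\<lambda>u. \<Sum>l<n. c l * remove w (\<lambda>u. v u * ang l u) u)
    = (\<Sum>i<n. c i * (\<Sum>k<n. c k * wint (remove w (\<lambda>u. v u * ang i u)) (remove w (\<lambda>u. v u * ang k u))))"
    by (intro wint_sum_sum bm_intros w v)
  ultimately show ?thesis
    unfolding gram_def by (simp add: sum_distrib_left sum.distrib algebra_simps)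
qed

text \<open>The quadratic form is a sum of two squared norms, so both vanish, and the relation holds
  at infinitely many visible points. Assuming \<open>\<le> 0\<close> instead of \<open>= 0\<close>
  serves two uses: injectivity, and positivity of the diagonal of the inverse.\<close>

lemma gram_positive_definite:
  assumes L: "L > 0" and le: "(\<Sum>l<2+2*Q. c l * (\<Sum>k<2+2*Q. c k * gram L w_lim v_lim l k)) \<le> 0"
    and l: "l < 2 + 2*Q"
  shows "c l = 0"
proof -
  define n where "n = 2 + 2*Q"
  let ?F = "\<lambda>u. \<Sum>l<n. c l * (w_lim u * rng l u)"
  let ?V = "\<lambda>u. \<Sum>l<n. c l * (v_lim u * ang l u)"
  let ?R = "remove w_lim ?V"
  \<comment> \<open>The coefficient subtracted by the projection; it becomes the factor of
    \<open>hgt\<close> in the angular relation.\<close>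
  define \<kappa> where "\<kappa> = wint ?V w_lim / wint w_lim w_lim"
  have bm: "bounded_measurable ?F" "bounded_measurable ?R" by (intro bm_intros)+
  have nn: "L * wint ?F ?F \<ge> 0" "(\<alpha> + 1)\<^sup>2 * wint ?R ?R \<ge> 0"
    using L wint_nonneg by simp_all
  then have "L * wint ?F ?F = 0" "(\<alpha> + 1)\<^sup>2 * wint ?R ?R = 0"
    using le[folded n_def] unfolding gram_form[OF bm_lim] by linarith+
  then have "wint ?F ?F = 0" "wint ?R ?R = 0" using L \<alpha> by auto
  from wint_eq_0_AE[OF bm(1) this(1)] wint_eq_0_AE[OF bm(2) this(2)]
  have "AE u in lborel. u \<in> {0..2*pi} \<longrightarrow> ?F u = 0 \<and> ?R u = 0" by eventually_elim blast
  then have inf: "infinite {u \<in> {0..2*pi}. hgt u > 0 \<and> ?F u = 0 \<and> ?R u = 0}"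
    by (rule visible_infinite)
  have "c 0 = 0 \<and> c 1 = 0 \<and> (\<forall>q\<in>{1..Q}. c (1 + q) = 0 \<and> c (1 + Q + q) = 0)"
  proof (rule nondegenerate[OF inf])
    fix u assume "u \<in> {u \<in> {0..2*pi}. hgt u > 0 \<and> ?F u = 0 \<and> ?R u = 0}"
    then have u: "hgt u > 0" "?F u = 0" "?R u = 0" by auto
    have "?F u = w_lim u * (\<Sum>l<n. c l * rng l u)"
      by (simp add: sum_distrib_left mult.left_commute)
    then show "c 0 + c 1 * crs u + x * cos_sum Q (\<lambda>q. c (1 + q)) u + y * sin_sum Q (\<lambda>q. c (1 + Q + q)) u = 0"
      using u(2) w_lim_pos[OF u(1)] unfolding rng_combination[of c u, folded n_def] by simp
    define s where "s = hgt u / speed u"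
    have s: "s > 0" using u(1) speed_pos[of u] by (simp add: s_def)
    have sp: "speed u > 0" by (rule speed_pos)
    have "?V u = v_lim u * (\<Sum>l<n. c l * ang l u)"
      by (simp add: sum_distrib_left mult.left_commute)
    \<comment> \<open>On the visible part v and w share the positive factor
      \<open>s powr \<alpha>\<close>; dividing by it makes the angular relation analytic.\<close>
    moreover have "v_lim u = s powr \<alpha> * (tng u / speed u)" "w_lim u = s powr \<alpha> * s"
      using s unfolding v_lim_def w_lim_def s_def[symmetric] by (simp_all add: powr_add)
    ultimately have "s powr \<alpha> * (tng u / speed u * (\<Sum>l<n. c l * ang l u)) = s powr \<alpha> * (\<kappa> * s)"
      using u(3) by (simp add: remove_def \<kappa>_def algebra_simps)
    then have "tng u / speed u * (\<Sum>l<n. c l * ang l u) = \<kappa> * s"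
      by (subst (asm) mult_left_cancel) (use s in auto)
    then have "tng u * (\<Sum>l<n. c l * ang l u) = \<kappa> * hgt u"
      using sp by (simp add: s_def)
    then have "tng u * ((\<Sum>l<n. c l * ang l u) * (speed u)\<^sup>2) = \<kappa> * hgt u * (speed u)\<^sup>2"
      by (metis mult.assoc)
    moreover have "(\<Sum>l<n. c l * ang l u) * (speed u)\<^sup>2 = c 1 * (speed u)\<^sup>2
      + p2 u * dcos_sum Q (\<lambda>q. c (1 + q)) u - p1 u * dsin_sum Q (\<lambda>q. c (1 + Q + q)) u"
      unfolding ang_combination[of c u, folded n_def] using sp by (simp add: distrib_right)
    ultimately show "tng u * (c 1 * (speed u)\<^sup>2 + p2 u * dcos_sum Q (\<lambda>q. c (1 + q)) u
        - p1 u * dsin_sum Q (\<lambda>q. c (1 + Q + q)) u) = \<kappa> * hgt u * (speed u)\<^sup>2"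
      by metis
  qed auto
  then have c: "c 0 = 0" "c 1 = 0" "\<And>q. q \<in> {1..Q} \<Longrightarrow> c (1 + q) = 0" "\<And>q. q \<in> {1..Q} \<Longrightarrow> c (1 + Q + q) = 0"
    by blast+
  consider "l = 0" | "l = 1" | "l - 1 \<in> {1..Q}" "l = 1 + (l - 1)"
    | "l - 1 - Q \<in> {1..Q}" "l = 1 + Q + (l - 1 - Q)"
    using l by fastforce
  then show ?thesis using c by cases metis+
qed

text \<open>One family for all pairs of the claim: index 0 is \<open>pair_range\<close>, 1 is
  \<open>pair_orient\<close>, and \<open>q + 1\<close> is the generator \<open>q\<close> in
  \<open>gens_A\<close>. Thus \<open>space_B\<close> and \<open>space_D\<close> are the spans with
  index 0 and index 1 left out.\<close>

definition pair_far where
  "pair_far L d l = (\<lambda>u. sqrt L * w_far d u * rng l u,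
     \<lambda>u. (1 + \<alpha>) * remove (w_far d) (\<lambda>u. v_far d u * ang l u) u)"

lemma pair_inner_far:
  assumes "L \<ge> 0"
  shows "pair_inner Q (\<gamma>(0 := d)) (pair_far L d l) (pair_far L d k) = gram L (w_far d) (v_far d) l k"
proof -
  have *: "sqrt L * (sqrt L * t) = L * t" "(1 + \<alpha>) * ((1 + \<alpha>) * t) = (\<alpha> + 1)\<^sup>2 * t" for t
    using assms by (simp_all add: power2_eq_square add.commute flip: mult.assoc)
  show ?thesis
    unfolding pair_inner_eq pair_far_def fst_conv snd_conv gram_def mult.assoc wint_scale wint_scale_right *
    ..
qed

lemma sqrt_polar: "sqrt ((d * cos t)\<^sup>2 + (d * sin t)\<^sup>2) = \<bar>d\<bar>"
  by (simp add: power_mult_distrib flip: distrib_left)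

lemma sgn_centre: "d > 0 \<Longrightarrow> sgn (centre (\<gamma>(0 := d))) = (cos (\<gamma> 1), sin (\<gamma> 1))"
proof -
  assume d: "d > 0"
  have "norm (centre (\<gamma>(0 := d))) = d"
    unfolding centre_def far_upd norm_pair sqrt_polar using d by simp
  then show ?thesis using d unfolding sgn_div_norm by (simp add: centre_def)
qed

lemma sgn_perp_centre: "d > 0 \<Longrightarrow> sgn (perp (centre (\<gamma>(0 := d)))) = (- sin (\<gamma> 1), cos (\<gamma> 1))"
proof -
  assume d: "d > 0"
  have "norm (perp (centre (\<gamma>(0 := d)))) = d"
    unfolding centre_def far_upd perp_def norm_pair fst_conv snd_conv power2_minus
    by (subst add.commute) (use d in \<open>simp add: sqrt_polar\<close>)
  then show ?thesis using d unfolding sgn_div_norm by (simp add: centre_def perp_def)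
qed

lemma cross_range_eq: "d > 0 \<Longrightarrow> cross_range Q (\<gamma>(0 := d)) u = crs u"
  unfolding cross_range_def
  by (simp only: sgn_perp_centre far_upd rho_eq far_coeffs rot_def inner_prod_def crs_def fst_conv snd_conv)
    (simp add: x_eq y_eq cos_diff sin_diff algebra_simps)

lemma pair_range_eq: "d \<ge> far \<Longrightarrow> pair_range Q \<alpha> L (\<gamma>(0 := d)) = pair_far L d 0"
  by (simp add: pair_range_def pair_far_def w_fun_eq rng_def ang_def remove_def wint_zero)

lemma pair_orient_eq: "d \<ge> far \<Longrightarrow> pair_orient Q \<alpha> L (\<gamma>(0 := d)) = pair_far L d 1"
  by (simp add: pair_orient_def pair_far_def proj_perp_w_eq w_fun_eq v_fun_eq cross_range_eq d_pos
      rng_def ang_def add.commute)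

lemma unit_sums:
  assumes "q \<in> {1..2*Q}"
  shows "cos_sum Q (unit_a (2 + q)) u = (if q \<le> Q then cos (real q * u) else 0)"
    and "sin_sum Q (unit_b Q (2 + q)) u = (if q \<le> Q then 0 else sin (real (q - Q) * u))"
    and "dcos_sum Q (unit_a (2 + q)) u = (if q \<le> Q then - (real q * sin (real q * u)) else 0)"
    and "dsin_sum Q (unit_b Q (2 + q)) u = (if q \<le> Q then 0 else real (q - Q) * cos (real (q - Q) * u))"
proof -
  have s: "(\<Sum>p=1..Q. unit_a (2 + q) p * g p) = (if q \<le> Q then g q else 0)" for g
  proof -
    have "(\<Sum>p=1..Q. unit_a (2 + q) p * g p) = (\<Sum>p=1..Q. if p = q then g p else 0)"
      by (intro sum.cong refl) (auto simp: unit_a_def)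
    then show ?thesis using assms by auto
  qed
  have t: "(\<Sum>p=1..Q. unit_b Q (2 + q) p * g p) = (if q \<le> Q then 0 else g (q - Q))" for g
  proof -
    have "(\<Sum>p=1..Q. unit_b Q (2 + q) p * g p) = (\<Sum>p=1..Q. if p = q - Q then (if Q < q then g p else 0) else 0)"
      by (intro sum.cong refl) (auto simp: unit_b_def)
    then show ?thesis using assms by auto
  qed
  show "cos_sum Q (unit_a (2 + q)) u = (if q \<le> Q then cos (real q * u) else 0)"
    "sin_sum Q (unit_b Q (2 + q)) u = (if q \<le> Q then 0 else sin (real (q - Q) * u))"
    "dcos_sum Q (unit_a (2 + q)) u = (if q \<le> Q then - (real q * sin (real q * u)) else 0)"
    "dsin_sum Q (unit_b Q (2 + q)) u = (if q \<le> Q then 0 else real (q - Q) * cos (real (q - Q) * u))"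
    unfolding cos_sum_def sin_sum_def dcos_sum_def dsin_sum_def s t by simp_all
qed

lemma gens_A_eq:
  assumes d: "d \<ge> far"
  shows "gens_A Q \<alpha> L (\<gamma>(0 := d)) = pair_far L d ` {2..<2+2*Q}"
proof -
  have s: "s_fun Q (\<gamma>(0 := d)) q u = rng (q + 1) u" if "q \<in> {1..2*Q}" for q u
  proof -
    have "rot_transpose (\<gamma> 2) (cos (\<gamma> 1), sin (\<gamma> 1)) = (x, y)"
      by (simp add: rot_transpose_def x_eq y_eq cos_diff sin_diff algebra_simps)
    then have "s_fun Q (\<gamma>(0 := d)) q u = (if q \<le> Q then x * cos (real q * u) else y * sin (real (q - Q) * u))"
      unfolding s_fun_def far_upd sgn_centre[OF d_pos[OF d]] by (simp add: sigma_def varsigma_def)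
    moreover have "rng (q + 1) u = x * cos_sum Q (unit_a (2 + q)) u + y * sin_sum Q (unit_b Q (2 + q)) u"
      using that by (simp add: rng_def)
    ultimately show ?thesis unfolding unit_sums[OF that] by simp
  qed
  have "deriv (sigma q) u = - (real q * sin (real q * u))"
    "deriv (varsigma q) u = real q * cos (real q * u)" for q u
    unfolding sigma_def[abs_def] varsigma_def[abs_def]
    by (rule DERIV_imp_deriv, auto intro!: derivative_eq_intros)+
  note der = this
  have t: "t_fun Q \<alpha> (\<gamma>(0 := d)) q = remove (w_far d) (\<lambda>u. v_far d u * ang (q + 1) u)"
    if "q \<in> {1..2*Q}" for q
  proof -
    have "ang (q + 1) u = (p2 u * dcos_sum Q (unit_a (2 + q)) u - p1 u * dsin_sum Q (unit_b Q (2 + q)) u)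
        * (1 / (speed u)\<^sup>2)" for u
      using that by (simp add: ang_def)
    then have a: "ang (q + 1) u = 1 / (speed u)\<^sup>2 * (if q \<le> Q then p2 u * deriv (sigma q) u
        else - p1 u * deriv (varsigma (q - Q)) u)" for u
      unfolding unit_sums[OF that] der by simp
    have n: "norm (rho_dot Q (\<gamma>(0 := d)) u) = speed u" for u
      unfolding far_rho_dot norm_pair speed_def ..
    show ?thesis
      unfolding t_fun_def proj_perp_w_eq w_fun_eq[OF d] v_fun_eq[OF d] a n
      unfolding far_rho_dot by (simp only: fst_conv snd_conv divide_inverse mult_1 mult.assoc)
  qed
  have "(\<lambda>u. sqrt L * w_fun Q \<alpha> (\<gamma>(0 := d)) u * s_fun Q (\<gamma>(0 := d)) q u,
         \<lambda>u. (1 + \<alpha>) * t_fun Q \<alpha> (\<gamma>(0 := d)) q u) = pair_far L d (q + 1)" if "q \<in> {1..2*Q}" for q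
    unfolding pair_far_def w_fun_eq[OF d] s[OF that] t[OF that] ..
  then have "gens_A Q \<alpha> L (\<gamma>(0 := d)) = (\<lambda>q. pair_far L d (q + 1)) ` {1..2*Q}"
    unfolding gens_A_def by (intro image_cong refl)
  also have "\<dots> = pair_far L d ` ((\<lambda>q. q + 1) ` {1..2*Q})" by (simp only: image_image)
  also have "(\<lambda>q::nat. q + 1) ` {1..2*Q} = {2..<2+2*Q}"
    by (simp only: image_add_atLeastAtMost' flip: atLeastLessThanSuc_atLeastAtMost) auto
  finally show ?thesis .
qed

lemma space_B_eq:
  assumes "d \<ge> far"
  shows "space_B Q \<alpha> L (\<gamma>(0 := d)) = pair_span (pair_far L d ` ({..<2+2*Q} - {0}))"
proof -
  have "{..<2+2*Q} - {0} = insert 1 {2..<2+2*Q}" by auto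
  then show ?thesis
    by (simp only: space_B_def pair_orient_eq[OF assms] gens_A_eq[OF assms] image_insert)
qed

lemma space_D_eq:
  assumes "d \<ge> far"
  shows "space_D Q \<alpha> L (\<gamma>(0 := d)) = pair_span (pair_far L d ` ({..<2+2*Q} - {1}))"
proof -
  have "{..<2+2*Q} - {1} = insert 0 {2..<2+2*Q}" by auto
  then show ?thesis
    by (simp only: space_D_def pair_range_eq[OF assms] gens_A_eq[OF assms] image_insert)
qed

section \<open>Orthogonal projection onto the span of finitely many pairs\<close>

lemma pair_inner_commute: "pair_inner Q (\<gamma>(0 := d)) f g = pair_inner Q (\<gamma>(0 := d)) g f"
  unfolding pair_inner_eq by (simp only: wint_commute)

abbreviation bm_pair :: "fun_pair \<Rightarrow> bool" where
  "bm_pair f \<equiv> bounded_measurable (fst f) \<and> bounded_measurable (snd f)"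

text \<open>\<open>pair_span\<close> sums over a set of pairs, in which coinciding pairs count once.
  Summing over indices avoids this, and \<open>pair_comb_in_span\<close> translates.\<close>

definition pair_comb :: "('i \<Rightarrow> real) \<Rightarrow> ('i \<Rightarrow> fun_pair) \<Rightarrow> 'i set \<Rightarrow> fun_pair" where
  "pair_comb k P S = (\<lambda>u. \<Sum>j\<in>S. k j * fst (P j) u, \<lambda>u. \<Sum>j\<in>S. k j * snd (P j) u)"

lemma bm_pair_comb: "(\<And>j. j \<in> S \<Longrightarrow> bm_pair (P j)) \<Longrightarrow> bm_pair (pair_comb k P S)"
  unfolding pair_comb_def fst_conv snd_conv by (intro conjI bm_intros bounded_measurable_const) auto

lemma pair_inner_comb:
  assumes "\<And>j. j \<in> S \<Longrightarrow> bm_pair (P j)" "bm_pair h"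
  shows "pair_inner Q (\<gamma>(0 := d)) (pair_comb k P S) h = (\<Sum>j\<in>S. k j * pair_inner Q (\<gamma>(0 := d)) (P j) h)"
proof -
  have "wint (\<lambda>u. \<Sum>j\<in>S. k j * fst (P j) u) (fst h) = (\<Sum>j\<in>S. k j * wint (fst (P j)) (fst h))"
    "wint (\<lambda>u. \<Sum>j\<in>S. k j * snd (P j) u) (snd h) = (\<Sum>j\<in>S. k j * wint (snd (P j)) (snd h))"
    by (rule wint_sum; use assms in blast)+
  then show ?thesis
    unfolding pair_inner_eq pair_comb_def fst_conv snd_conv by (simp add: sum.distrib distrib_left)
qed

lemma pair_inner_diff:
  assumes "bm_pair f" "bm_pair g" "bm_pair h"
  shows "pair_inner Q (\<gamma>(0 := d)) (pair_diff f g) h = pair_inner Q (\<gamma>(0 := d)) f h - pair_inner Q (\<gamma>(0 := d)) g h"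
  using assms unfolding pair_inner_eq pair_diff_def fst_conv snd_conv by (simp add: wint_diff)

lemma bm_pair_diff: "bm_pair f \<Longrightarrow> bm_pair g \<Longrightarrow> bm_pair (pair_diff f g)"
  unfolding pair_diff_def fst_conv snd_conv by (auto intro!: bm_intros)

lemma pair_span_iff: "h \<in> pair_span H \<longleftrightarrow> (\<exists>k. h = pair_comb k (\<lambda>p. p) H)"
  by (auto simp: pair_span_def pair_comb_def)

text \<open>A pair that occurs at several indices receives the sum of their coefficients.\<close>

lemma pair_comb_in_span:
  assumes "finite J"
  shows "pair_comb \<kappa> P J \<in> pair_span (P ` J)"
proof -
  have *: "(\<Sum>p\<in>P ` J. (\<Sum>j | j \<in> J \<and> P j = p. \<kappa> j) * F p) = (\<Sum>j\<in>J. \<kappa> j * F (P j))"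
    for F :: "fun_pair \<Rightarrow> real"
    unfolding sum_distrib_right sum.image_gen[OF assms, of _ P]
    by (intro sum.cong refl) auto
  show ?thesis
    unfolding pair_span_iff
    by (rule exI[of _ "\<lambda>p. \<Sum>j | j \<in> J \<and> P j = p. \<kappa> j"])
      (auto simp: pair_comb_def fun_eq_iff *[of "\<lambda>p. fst p _"] *[of "\<lambda>p. snd p _"])
qed

text \<open>Here \<open>b\<close> is the column with index \<open>i\<close> of the inverse Gram matrix.\<close>

lemma pair_norm_residual:
  fixes n i :: nat
  assumes bm: "\<And>j. j < n \<Longrightarrow> bm_pair (P j)"
    and b: "\<And>j. j < n \<Longrightarrow> (\<Sum>k<n. pair_inner Q (\<gamma>(0 := d)) (P j) (P k) * b k) = of_bool (j = i)"
    and i: "i < n" and bi: "b i \<noteq> 0"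
    and f: "f = (\<lambda>u. c * fst (P i) u, \<lambda>u. c * snd (P i) u)"
  shows "(pair_norm Q (\<gamma>(0 := d)) (pair_proj_perp Q (\<gamma>(0 := d)) (pair_span (P ` ({..<n} - {i}))) f))\<^sup>2
    = c\<^sup>2 / b i"
proof -
  let ?ip = "pair_inner Q (\<gamma>(0 := d))"
  let ?S = "pair_span (P ` ({..<n} - {i}))"
  \<comment> \<open>A multiple of the dual vector of \<open>P i\<close>: by \<open>b\<close> it is
    orthogonal to every other \<open>P j\<close>. The scaling makes its coefficient at
    \<open>P i\<close> equal to \<open>c\<close>, so that \<open>f - r\<close>, which is
    \<open>g\<close>, lies in the span.\<close>
  define r where "r = pair_comb (\<lambda>j. c / b i * b j) P {..<n}"
  define g where "g = pair_comb (\<lambda>j. - (c / b i * b j)) P ({..<n} - {i})"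
  have bmf: "bm_pair f" using bm[OF i] unfolding f fst_conv snd_conv by (auto intro!: bm_intros bounded_measurable_const)
  have bmr: "bm_pair r" unfolding r_def by (rule bm_pair_comb) (use bm in auto)
  have bmg: "bm_pair g" unfolding g_def by (rule bm_pair_comb) (use bm in auto)
  have bmS: "bm_pair h" if "h \<in> ?S" for h
    using that unfolding pair_span_iff by (elim exE, hypsubst, intro bm_pair_comb) (use bm in auto)
  have gS: "g \<in> ?S" unfolding g_def by (rule pair_comb_in_span) simp
  have split: "(\<Sum>j<n. c / b i * b j * F j) = c * F i + (\<Sum>j\<in>{..<n} - {i}. c / b i * b j * F j)" for F
    using i bi by (subst sum.remove[of _ i]) auto
  have fg: "pair_diff f g = r"
    unfolding pair_diff_def f g_def r_def pair_comb_def fst_conv snd_conv split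
    by (simp add: sum_negf)
  have Pr: "?ip (P j) r = c / b i * of_bool (j = i)" if "j < n" for j
  proof -
    have "?ip (P j) r = (\<Sum>k<n. c / b i * b k * ?ip (P k) (P j))"
      unfolding pair_inner_commute[of d "P j"] r_def by (rule pair_inner_comb) (use bm that in auto)
    also have "\<dots> = c / b i * (\<Sum>k<n. ?ip (P j) (P k) * b k)"
      unfolding pair_inner_commute[of d _ "P j"] sum_distrib_left by (simp only: mult.assoc mult.commute mult.left_commute)
    finally show ?thesis unfolding b[OF that] .
  qed
  have rS: "?ip h r = 0" if hS: "h \<in> ?S" for h
  proof -
    obtain k where h: "h = pair_comb k (\<lambda>p. p) (P ` ({..<n} - {i}))" using hS unfolding pair_span_iff by blast
    have "?ip h r = (\<Sum>p\<in>P ` ({..<n} - {i}). k p * ?ip p r)"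
      unfolding h by (rule pair_inner_comb) (use bm bmr in auto)
    also have "\<dots> = 0" by (rule sum.neutral) (use Pr in auto)
    finally show ?thesis .
  qed
  have fr: "?ip f r = c\<^sup>2 / b i"
  proof -
    have "?ip f r = c * ?ip (P i) r"
      unfolding f pair_inner_eq fst_conv snd_conv wint_scale by (simp add: distrib_left)
    then show ?thesis using Pr[OF i] by (simp add: power2_eq_square)
  qed
  \<comment> \<open>The pair chosen by \<open>pair_proj\<close> may differ from \<open>g\<close> on
    a null set. Uniqueness is bypassed: both residuals are orthogonal to the span, which reduces the
    squared norm of the chosen one to \<open>?ip f r\<close>.\<close>
  define g' where "g' = pair_proj Q (\<gamma>(0 := d)) ?S f"
  have "g \<in> ?S \<and> (\<forall>h\<in>?S. ?ip (pair_diff f g) h = 0)"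
    using gS rS unfolding fg by (simp add: pair_inner_commute[of d r])
  then have g': "g' \<in> ?S" "\<And>h. h \<in> ?S \<Longrightarrow> ?ip (pair_diff f g') h = 0"
    unfolding g'_def pair_proj_def by (rule someI2; blast)+
  note bmg' = bmS[OF g'(1)]
  let ?e = "pair_diff f g'"
  have bme: "bm_pair ?e" by (rule bm_pair_diff[OF bmf bmg'])
  have "?ip ?e ?e = ?ip f ?e - ?ip g' ?e" by (rule pair_inner_diff[OF bmf bmg' bme])
  also have "?ip g' ?e = 0" using g'(2)[OF g'(1)] by (simp add: pair_inner_commute[of d g'])
  also have "?ip f ?e = ?ip r ?e"
  proof -
    have "?ip r ?e = ?ip f ?e - ?ip g ?e" unfolding fg[symmetric] by (rule pair_inner_diff[OF bmf bmg bme])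
    then show ?thesis using g'(2)[OF gS] by (simp add: pair_inner_commute[of d g])
  qed
  also have "?ip r ?e = ?ip ?e r" by (rule pair_inner_commute)
  also have "\<dots> = ?ip f r - ?ip g' r" by (rule pair_inner_diff[OF bmf bmg' bmr])
  also have "?ip g' r = 0" by (rule rS[OF g'(1)])
  finally have ee: "?ip ?e ?e = c\<^sup>2 / b i" by (simp only: fr diff_0_right)
  have "?ip ?e ?e \<ge> 0" unfolding pair_inner_eq using wint_nonneg by simp
  then show ?thesis
    unfolding pair_norm_def pair_proj_perp_def g'_def[symmetric] using ee by simp
qed

section \<open>The normalised Fisher matrix and its limit\<close>

definition fish where
  "fish L M d i j = L * wint (\<lambda>u. w_far d u * mu_far d i u) (\<lambda>u. w_far d u * mu_far d j u)
     + M * wint (\<lambda>u. w_far d u * ((cos (\<gamma> 2) * X d u - sin (\<gamma> 2) * Y d u) * iota d u) * eta_far d i u)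
           (\<lambda>u. w_far d u * ((cos (\<gamma> 2) * X d u - sin (\<gamma> 2) * Y d u) * iota d u) * eta_far d j u)
     + (\<alpha> + 1)\<^sup>2 * wint (remove (w_far d) (\<lambda>u. v_far d u * (eta_far d i u - beta_grad i u)))
         (remove (w_far d) (\<lambda>u. v_far d u * (eta_far d j u - beta_grad j u)))"

lemma fisher_matrix_eq:
  assumes d: "d \<ge> far"
  shows "fisher_matrix Q \<alpha> L M N0 E (\<gamma>(0 := d)) = Matrix.mat (3 + 2*Q) (3 + 2*Q)
    (\<lambda>(i, j). (1 / wint (w_far d) (w_far d) * (2 * E / N0)) * fish L M d i j)"
  unfolding fisher_matrix_def Let_def star_norm_sq star_inner_eq proj_perp_w_eq
    w_fun_eq[OF d] v_fun_eq[OF d] mu_eq[OF d] eta_eq[OF d] xi_eq[OF d] cos_phi[OF d] fish_def ..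

text \<open>The signs reflect that direction and orientation have opposite limiting features; the
  extra entry comes from the bearing term, in which only the direction survives.\<close>

lemma fish_tendsto:
  "((\<lambda>d. fish L M d i j) \<longlongrightarrow> sg i * sg j * gram L w_lim v_lim (idx i) (idx j)
     + of_bool (i = 1 \<and> j = 1) * (M * (cos (\<gamma> 1))\<^sup>2 * wint w_lim w_lim)) at_top"
proof -
  have w0: "wint w_lim w_lim \<noteq> 0" using wint_w_pos by simp
  have "((\<lambda>d. fish L M d i j) \<longlongrightarrow>
     L * wint (\<lambda>u. w_lim u * (sg i * rng (idx i) u)) (\<lambda>u. w_lim u * (sg j * rng (idx j) u))
     + M * wint (\<lambda>u. w_lim u * cos (\<gamma> 1) * of_bool (i = 1)) (\<lambda>u. w_lim u * cos (\<gamma> 1) * of_bool (j = 1))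
     + (\<alpha> + 1)\<^sup>2 * wint (remove w_lim (\<lambda>u. v_lim u * (sg i * ang (idx i) u)))
         (remove w_lim (\<lambda>u. v_lim u * (sg j * ang (idx j) u)))) at_top"
    unfolding fish_def
    by (intro tendsto_add tendsto_mult tendsto_const wint_tendsto bconv_remove bconv_mult
        bconv_w bconv_v bconv_mu bconv_eta bconv_xi bconv_cos_phi w0)
  moreover have "(\<lambda>u. w_lim u * (sg i * rng (idx i) u)) = (\<lambda>u. sg i * (w_lim u * rng (idx i) u))" for i
    by (simp add: mult.left_commute)
  moreover have "(\<lambda>u. w_lim u * cos (\<gamma> 1) * of_bool (i = 1)) = (\<lambda>u. (of_bool (i = 1) * cos (\<gamma> 1)) * w_lim u)" for i :: nat
    by (simp add: fun_eq_iff)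
  moreover have "remove w_lim (\<lambda>u. v_lim u * (sg i * ang (idx i) u)) = (\<lambda>u. sg i * remove w_lim (\<lambda>u. v_lim u * ang (idx i) u) u)" for i
  proof -
    have "(\<lambda>u. v_lim u * (sg i * ang (idx i) u)) = (\<lambda>u. sg i * (v_lim u * ang (idx i) u))"
      by (simp add: mult.left_commute)
    then show ?thesis by (simp add: remove_def wint_scale right_diff_distrib mult.assoc)
  qed
  ultimately show ?thesis
    by (simp only: wint_scale wint_scale_right gram_def)
      (simp add: algebra_simps power2_eq_square of_bool_conj)
qed

lemma gram_tendsto: "((\<lambda>d. gram L (w_far d) (v_far d) l k) \<longlongrightarrow> gram L w_lim v_lim l k) at_top"
proof -
  have w0: "wint w_lim w_lim \<noteq> 0" using wint_w_pos by simp
  show ?thesis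
    unfolding gram_def
    by (intro tendsto_add tendsto_mult tendsto_const wint_tendsto bconv_remove bconv_mult
        bconv_w bconv_v bconv_const bm_rng_ang w0)
qed

end

lemma sum_split3: "(\<Sum>j<3+n. f j) = f 0 + f 1 + f 2 + (\<Sum>l=2..<2+n. f (l + 1))" for f :: "nat \<Rightarrow> real"
  by (induction n) (auto simp: numeral_3_eq_3 numeral_2_eq_2 add.commute add.left_commute)

text \<open>Applied with \<open>k d = W d / (2 * E d / N0)\<close>, which need not converge; only
  the cofactors have limits to compare.\<close>

lemma asymp_equiv_common_factor:
  fixes p q k :: "real \<Rightarrow> real"
  assumes "\<forall>\<^sub>F d in F. f d = k d * p d" "\<forall>\<^sub>F d in F. g d = k d * q d"
    and "(p \<longlongrightarrow> l) F" "(q \<longlongrightarrow> l) F" "l \<noteq> 0"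
  shows "f \<sim>[F] g"
proof -
  have "p \<sim>[F] q"
    using assms by (meson asymp_equiv_sym asymp_equiv_trans tendsto_imp_asymp_equiv_const)
  then have "(\<lambda>d. k d * p d) \<sim>[F] (\<lambda>d. k d * q d)"
    by (intro asymp_equiv_mult asymp_equiv_refl)
  then show ?thesis using asymp_equiv_cong[OF assms(1,2)] by blast
qed

section \<open>Inverse of the limiting Fisher matrix, and the bounds\<close>

context far_target
begin

text \<open>The coefficients of a parameter perturbation with respect to the limiting pairs: only the
  difference of the perturbations of direction and orientation is seen by them.\<close>

definition contract :: "(nat \<Rightarrow> real) \<Rightarrow> nat \<Rightarrow> real" where
  "contract v l = (if l = 0 then v 0 else if l = 1 then v 1 - v 2 else v (l + 1))"

definition fish_lim where
  "fish_lim L M i j = sg i * sg j * gram L w_lim v_lim (idx i) (idx j)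
     + of_bool (i = 1 \<and> j = 1) * (M * (cos (\<gamma> 1))\<^sup>2 * wint w_lim w_lim)"

text \<open>The limiting matrix is the Gram matrix composed with \<open>contract\<close>, its rows
  copied through \<open>idx\<close> and \<open>sg\<close>, plus the single border entry. Kernel and
  inverse are computed from this form.\<close>

lemma fish_lim_sum:
  "(\<Sum>j<3+2*Q. fish_lim L M i j * v j) =
     sg i * (\<Sum>l<2+2*Q. gram L w_lim v_lim (idx i) l * contract v l)
     + of_bool (i = 1) * (M * (cos (\<gamma> 1))\<^sup>2 * wint w_lim w_lim * v 1)"
proof -
  let ?G = "gram L w_lim v_lim (idx i)" and ?Z = "M * (cos (\<gamma> 1))\<^sup>2 * wint w_lim w_lim"
  have "(\<Sum>l=2..<2+2*Q. fish_lim L M i (l + 1) * v (l + 1)) = sg i * (\<Sum>l=2..<2+2*Q. ?G l * contract v l)"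
    unfolding sum_distrib_left
    by (intro sum.cong refl) (auto simp: fish_lim_def sg_def idx_def contract_def)
  moreover have "fish_lim L M i 0 * v 0 = sg i * (?G 0 * contract v 0)"
    by (simp add: fish_lim_def sg_def[of 0] idx_def[of 0] contract_def)
  moreover have "fish_lim L M i 1 * v 1 + fish_lim L M i 2 * v 2
      = sg i * (?G 1 * contract v 1) + of_bool (i = 1) * (?Z * v 1)"
  proof -
    have *: "fish_lim L M i 1 = sg i * ?G 1 + of_bool (i = 1) * ?Z" "fish_lim L M i 2 = - (sg i * ?G 1)"
      "contract v 1 = v 1 - v 2"
      by (simp_all add: fish_lim_def sg_def[of "Suc 0"] sg_def[of 2] idx_def[of "Suc 0"] idx_def[of 2] contract_def)
    show ?thesis unfolding *
      by (simp only: distrib_right right_diff_distrib mult_minus_left mult.assoc)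
  qed
  ultimately show ?thesis unfolding sum_split3 sum_split2 by (simp only: algebra_simps)
qed

lemma gram_injective:
  assumes L: "L > 0" and v: "\<And>l. l < 2+2*Q \<Longrightarrow> (\<Sum>k<2+2*Q. gram L w_lim v_lim l k * v k) = 0"
    and k: "k < 2+2*Q"
  shows "v k = 0"
proof -
  have "(\<Sum>k<2+2*Q. v k * gram L w_lim v_lim l k) = 0" if "l < 2+2*Q" for l
    using v[OF that] by (simp only: mult.commute)
  then have "(\<Sum>l<2+2*Q. v l * (\<Sum>k<2+2*Q. v k * gram L w_lim v_lim l k)) = 0"
    by (intro sum.neutral) auto
  then show ?thesis using gram_positive_definite[OF L _ k, of v] by simp
qed

text \<open>The rows of direction and orientation have opposite Gram parts, so together they isolate
  the border term and give \<open>v 1 = 0\<close>. The remaining rows say that the Gram matrix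
  annihilates \<open>contract v\<close>, and \<open>v\<close> is recovered from
  \<open>contract v\<close> and \<open>v 1\<close>.\<close>

lemma fish_lim_injective:
  assumes L: "L > 0" and Z: "M * (cos (\<gamma> 1))\<^sup>2 \<noteq> 0"
    and v: "\<And>i. i < 3+2*Q \<Longrightarrow> (\<Sum>j<3+2*Q. fish_lim L M i j * v j) = 0" and j: "j < 3+2*Q"
  shows "v j = 0"
proof -
  let ?G = "\<lambda>i. \<Sum>l<2+2*Q. gram L w_lim v_lim i l * contract v l"
  have two: "?G 1 = 0" using v[of 2] unfolding fish_lim_sum by (simp add: sg_def idx_def)
  have v1: "v 1 = 0"
  proof -
    have "1 < 3 + 2 * Q" by simp
    from v[OF this] two have "M * (cos (\<gamma> 1))\<^sup>2 * wint w_lim w_lim * v 1 = 0"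
      unfolding fish_lim_sum by (simp add: sg_def[of "Suc 0"] idx_def[of "Suc 0"])
    then show ?thesis using Z wint_w_pos by auto
  qed
  have G: "?G l = 0" if l: "l < 2+2*Q" for l
  proof -
    consider "l = 0" | "l = 1" | "l \<ge> 2" by linarith
    then show ?thesis
    proof cases
      case 1
      then show ?thesis using v[of 0] unfolding fish_lim_sum by (simp add: sg_def idx_def)
    next
      case 3
      then have "sg (l + 1) = 1" "idx (l + 1) = l" "l + 1 \<noteq> 1" "l + 1 < 3+2*Q"
        using l by (auto simp: sg_def idx_def)
      then show ?thesis using v[of "l + 1"] unfolding fish_lim_sum by simp
    qed (use two in simp)
  qed
  have c: "contract v l = 0" if "l < 2+2*Q" for l
    by (rule gram_injective[OF L G that])
  consider "j = 0" | "j = 1" | "j = 2" | "j \<ge> 3" by linarith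
  then show ?thesis
  proof cases
    case 1 then show ?thesis using c[of 0] by (simp add: contract_def)
  next
    case 2 then show ?thesis using v1 by simp
  next
    case 3 then show ?thesis using c[of 1] v1 by (simp add: contract_def)
  next
    case 4
    then have "contract v (j - 1) = v j" by (auto simp: contract_def)
    then show ?thesis using c[of "j - 1"] 4 j by simp
  qed
qed

theorem bounds_asymptotics:
  fixes E :: "real \<Rightarrow> real"
  assumes L: "L > 0" and M: "M > 0" and dir: "cos (\<gamma> 1) \<noteq> 0" and N0: "N0 > 0"
    and E: "\<forall>\<^sub>F d in at_top. E d \<noteq> 0"
  shows "(\<lambda>d. cramer_rao Q \<alpha> L M N0 (E d) (\<gamma>(0 := d)) 0) \<sim>[at_top]
         (\<lambda>d. point_range_bound L N0 (E d) *
            inverse (inverse ((star_norm Q (\<gamma>(0 := d)) (w_fun Q \<alpha> (\<gamma>(0 := d))))\<^sup>2) *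
              (pair_norm Q (\<gamma>(0 := d)) (pair_proj_perp Q (\<gamma>(0 := d))
                (space_B Q \<alpha> L (\<gamma>(0 := d))) (w_fun Q \<alpha> (\<gamma>(0 := d)), \<lambda>u. 0)))\<^sup>2))" (is ?range)
    and "(\<lambda>d. cramer_rao Q \<alpha> L M N0 (E d) (\<gamma>(0 := d)) 1) \<sim>[at_top]
         (\<lambda>d. point_direction_bound M (\<gamma> 1) N0 (E d))" (is ?direction)
    and "(\<lambda>d. cramer_rao Q \<alpha> L M N0 (E d) (\<gamma>(0 := d)) 2) \<sim>[at_top]
         (\<lambda>d. point_direction_bound M (\<gamma> 1) N0 (E d) + inverse (2 * E d / N0) *
            inverse (inverse ((star_norm Q (\<gamma>(0 := d)) (w_fun Q \<alpha> (\<gamma>(0 := d))))\<^sup>2) *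
              (pair_norm Q (\<gamma>(0 := d)) (pair_proj_perp Q (\<gamma>(0 := d))
                (space_D Q \<alpha> L (\<gamma>(0 := d))) (pair_orient Q \<alpha> L (\<gamma>(0 := d)))))\<^sup>2))" (is ?orientation)
proof -
  let ?m = "2 + 2*Q" and ?n = "3 + 2*Q"
  define G where "G = gram L w_lim v_lim"
  define W where "W d = wint (w_far d) (w_far d)" for d
  define Z where "Z = M * (cos (\<gamma> 1))\<^sup>2 * wint w_lim w_lim"
  have Z0: "M * (cos (\<gamma> 1))\<^sup>2 > 0" using M dir by simp
  then have Z: "Z > 0" unfolding Z_def using wint_w_pos by simp
  obtain B Bd where B: "\<And>i k. i < ?m \<Longrightarrow> k < ?m \<Longrightarrow> (\<Sum>j<?m. G i j * B j k) = of_bool (i = k)"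
    and Bd: "\<forall>\<^sub>F d in at_top. \<forall>i<?m. \<forall>k<?m. (\<Sum>j<?m. gram L (w_far d) (v_far d) i j * Bd d j k) = of_bool (i = k)"
    and Blim: "\<And>i k. i < ?m \<Longrightarrow> k < ?m \<Longrightarrow> ((\<lambda>d. Bd d i k) \<longlongrightarrow> B i k) at_top"
    using inverse_entries_tendsto[of ?m "\<lambda>d. gram L (w_far d) (v_far d)" G at_top]
      gram_tendsto gram_injective[OF L] unfolding G_def by blast
  have fl: "((\<lambda>d. fish L M d i j) \<longlongrightarrow> fish_lim L M i j) at_top" for i j
    unfolding fish_lim_def by (rule fish_tendsto)
  obtain C Cd where C: "\<And>i k. i < ?n \<Longrightarrow> k < ?n \<Longrightarrow> (\<Sum>j<?n. fish_lim L M i j * C j k) = of_bool (i = k)"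
    and Cd: "\<forall>\<^sub>F d in at_top. \<forall>i<?n. \<forall>k<?n. (\<Sum>j<?n. fish L M d i j * Cd d j k) = of_bool (i = k)"
    and Clim: "\<And>i k. i < ?n \<Longrightarrow> k < ?n \<Longrightarrow> ((\<lambda>d. Cd d i k) \<longlongrightarrow> C i k) at_top"
    using inverse_entries_tendsto[of ?n "fish L M" "fish_lim L M" at_top]
      fl fish_lim_injective[OF L less_imp_neq[OF Z0, symmetric]] by blast
  \<comment> \<open>At column \<open>i\<close> of \<open>B\<close> the quadratic form of
    \<open>G\<close> takes the value \<open>B i i\<close>; were this not positive, the column would
    be zero.\<close>
  have Bpos: "B i i > 0" if i: "i < ?m" for i
  proof (rule ccontr)
    assume neg: "\<not> B i i > 0"
    have "(\<Sum>k<?m. B k i * G l k) = of_bool (l = i)" if "l < ?m" for l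
      using B[OF that i] by (simp only: mult.commute)
    then have "(\<Sum>l<?m. B l i * (\<Sum>k<?m. B k i * G l k)) = (\<Sum>l<?m. B l i * of_bool (l = i))"
      by (intro sum.cong) auto
    also have "\<dots> = (\<Sum>l<?m. if l = i then B l i else 0)" by (intro sum.cong) auto
    also have "\<dots> = B i i" using i by (subst sum.delta) auto
    finally have "(\<Sum>l<?m. B l i * (\<Sum>k<?m. B k i * G l k)) \<le> 0" using neg by linarith
    then have "B l i = 0" if "l < ?m" for l
      using gram_positive_definite[OF L _ that, of "\<lambda>l. B l i"] unfolding G_def by blast
    then have "(\<Sum>j<?m. G i j * B j i) = 0" by (intro sum.neutral) auto
    then show False using B[OF i i] by simp
  qed
  \<comment> \<open>Injectivity makes the columns of the inverse unique, so the entries needed below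
    can be read off from explicit solutions.\<close>
  have C_eq: "C i k = y i" if k: "k < ?n" and i: "i < ?n"
    and y: "\<And>i. i < ?n \<Longrightarrow> (\<Sum>j<?n. fish_lim L M i j * y j) = of_bool (i = k)" for i k y
  proof -
    have "C i k - y i = 0"
    proof (rule fish_lim_injective[OF L less_imp_neq[OF Z0, symmetric] _ i])
      fix i assume "i < ?n"
      then show "(\<Sum>j<?n. fish_lim L M i j * (C j k - y j)) = 0"
        using C[of i k] y[of i] k by (simp only: right_diff_distrib sum_subtractf diff_self)
    qed
    then show ?thesis by simp
  qed
  have idx_less: "idx i < ?m" if "i < ?n" for i using that by (auto simp: idx_def)
  have fs: "(\<Sum>j<?n. fish_lim L M i j * y j) = sg i * (\<Sum>l<?m. G (idx i) l * contract y l) + of_bool (i = 1) * (Z * y 1)"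
    for i y unfolding fish_lim_sum G_def Z_def by (simp only: mult.assoc)
  have C00: "C 0 0 = B 0 0"
  proof -
    \<comment> \<open>\<open>contract y\<close> has to be column 0 of \<open>B\<close>; the
      direction entry is set to 0, whence the minus sign in the orientation entry.\<close>
    define y where "y j = (if j = 0 then B 0 0 else if j = 1 then 0 else if j = 2 then - B 1 0 else B (j - 1) 0)" for j
    have c: "contract y l = B l 0" for l by (simp add: contract_def y_def)
    have "C 0 0 = y 0"
    proof (rule C_eq)
      fix i assume i: "i < ?n"
      have "(\<Sum>l<?m. G (idx i) l * contract y l) = of_bool (idx i = 0)"
        unfolding c using B[OF idx_less[OF i], of 0] by simp
      moreover have "of_bool (i = 1) * (Z * y 1) = 0" by (simp add: y_def)
      ultimately show "(\<Sum>j<?n. fish_lim L M i j * y j) = of_bool (i = 0)"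
        unfolding fs by (auto simp: sg_def idx_def)
    qed auto
    then show ?thesis by (simp add: y_def)
  qed
  have C11: "C 1 1 = 1 / Z"
  proof -
    \<comment> \<open>A common shift of direction and orientation is invisible to the Gram part, so
      only the border entry \<open>Z\<close> counts.\<close>
    define y :: "nat \<Rightarrow> real" where "y j = (if j = 1 \<or> j = 2 then 1 / Z else 0)" for j
    have c: "contract y l = 0" for l by (simp add: contract_def y_def)
    have "C 1 1 = y 1"
    proof (rule C_eq)
      fix i assume i: "i < ?n"
      show "(\<Sum>j<?n. fish_lim L M i j * y j) = of_bool (i = 1)"
        unfolding fs c using Z by (simp add: y_def)
    qed auto
    then show ?thesis by (simp add: y_def)
  qed
  have C22: "C 2 2 = B 1 1 + 1 / Z"
  proof -
    \<comment> \<open>The sign of the orientation row forces \<open>contract y\<close> to be minus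
      column 1 of \<open>B\<close>. In the direction row this leaves -1, which the border entry
      compensates when \<open>y 1 = 1 / Z\<close>; the orientation entry then carries both
      contributions.\<close>
    define y where "y j = (if j = 0 then - B 0 1 else if j = 1 then 1 / Z
      else if j = 2 then 1 / Z + B 1 1 else - B (j - 1) 1)" for j
    have c: "contract y l = - B l 1" for l by (simp add: contract_def y_def)
    have "C 2 2 = y 2"
    proof (rule C_eq)
      fix i assume i: "i < ?n"
      have "(\<Sum>l<?m. G (idx i) l * contract y l) = - of_bool (idx i = 1)"
        unfolding c using B[OF idx_less[OF i], of 1] by (simp only: mult_minus_right sum_negf)
      moreover have "Z * y 1 = 1" using Z by (simp add: y_def)
      ultimately show "(\<Sum>j<?n. fish_lim L M i j * y j) = of_bool (i = 2)"
        unfolding fs by (auto simp: sg_def idx_def)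
    qed auto
    then show ?thesis by (simp add: y_def)
  qed
  have Wlim: "(W \<longlongrightarrow> wint w_lim w_lim) at_top"
    unfolding W_def[abs_def] by (intro wint_tendsto bconv_w)
  have W0: "\<forall>\<^sub>F d in at_top. W d \<noteq> 0"
    by (rule tendsto_imp_eventually_ne[OF Wlim less_imp_neq[OF wint_w_pos, symmetric]])
  have Bd_ne: "\<forall>\<^sub>F d in at_top. Bd d i i \<noteq> 0" if "i < ?m" for i
    by (rule tendsto_imp_eventually_ne[OF Blim less_imp_neq[OF Bpos, symmetric]]) (use that in auto)
  have bound: "\<forall>\<^sub>F d in at_top. cramer_rao Q \<alpha> L M N0 (E d) (\<gamma>(0 := d)) i = W d / (2 * E d / N0) * Cd d i i"
    if i: "i < ?n" for i
    using eventually_far W0 E Cd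
  proof eventually_elim
    case (elim d)
    show ?case
      unfolding cramer_rao_def fisher_matrix_eq[OF elim(1)] W_def[symmetric]
      by (subst mat_inverse_entry[where B = "Cd d"]) (use elim i N0 in \<open>auto simp: field_simps\<close>)
  qed
  have bmw: "\<forall>\<^sub>F d in at_top. bounded_measurable (w_far d) \<and> bounded_measurable (v_far d)"
    using bconv_eventually_bounded_measurable[OF bconv_w] bconv_eventually_bounded_measurable[OF bconv_v]
    by eventually_elim blast
  have residual: "\<forall>\<^sub>F d in at_top. \<forall>f c. f = (\<lambda>u. c * fst (pair_far L d i) u, \<lambda>u. c * snd (pair_far L d i) u) \<longrightarrow>
      (pair_norm Q (\<gamma>(0 := d)) (pair_proj_perp Q (\<gamma>(0 := d))
         (pair_span (pair_far L d ` ({..<?m} - {i}))) f))\<^sup>2 = c\<^sup>2 / Bd d i i"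
    if i: "i < ?m" for i
    using Bd Bd_ne[OF i] bmw
  proof eventually_elim
    case (elim d)
    show ?case
    proof (intro allI impI)
      fix f c assume f: "f = (\<lambda>u. c * fst (pair_far L d i) u, \<lambda>u. c * snd (pair_far L d i) u)"
      show "(pair_norm Q (\<gamma>(0 := d)) (pair_proj_perp Q (\<gamma>(0 := d))
         (pair_span (pair_far L d ` ({..<?m} - {i}))) f))\<^sup>2 = c\<^sup>2 / Bd d i i"
      proof (rule pair_norm_residual[where P = "pair_far L d" and b = "\<lambda>k. Bd d k i", OF _ _ i elim(2) f])
        fix j
        show "bm_pair (pair_far L d j)"
          unfolding pair_far_def fst_conv snd_conv using elim(3)
          by (auto intro!: bm_intros bounded_measurable_const)
        assume "j < ?m"
        then show "(\<Sum>k<?m. pair_inner Q (\<gamma>(0 := d)) (pair_far L d j) (pair_far L d k) * Bd d k i) = of_bool (j = i)"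
          unfolding pair_inner_far[OF less_imp_le[OF L]] using elim(1) i by blast
      qed
    qed
  qed
  show ?range
  proof (rule asymp_equiv_common_factor)
    have "0 < ?n" "0 < ?m" by auto
    from bound[OF this(1)]
    show "\<forall>\<^sub>F d in at_top. cramer_rao Q \<alpha> L M N0 (E d) (\<gamma>(0 := d)) 0 = W d / (2 * E d / N0) * Cd d 0 0" .
    show "\<forall>\<^sub>F d in at_top. point_range_bound L N0 (E d) *
            inverse (inverse ((star_norm Q (\<gamma>(0 := d)) (w_fun Q \<alpha> (\<gamma>(0 := d))))\<^sup>2) *
              (pair_norm Q (\<gamma>(0 := d)) (pair_proj_perp Q (\<gamma>(0 := d))
                (space_B Q \<alpha> L (\<gamma>(0 := d))) (w_fun Q \<alpha> (\<gamma>(0 := d)), \<lambda>u. 0)))\<^sup>2)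
        = W d / (2 * E d / N0) * Bd d 0 0"
      using eventually_far residual[OF \<open>0 < ?m\<close>] Bd_ne[OF \<open>0 < ?m\<close>]
    proof eventually_elim
      case (elim d)
      \<comment> \<open>The pair \<open>(w, 0)\<close> is the range pair up to the factor
        \<open>1 / sqrt L\<close>, whose square cancels the \<open>1 / L\<close> of
        \<open>point_range_bound\<close>.\<close>
      have "(w_far d, \<lambda>u. 0) = (\<lambda>u. 1 / sqrt L * fst (pair_far L d 0) u, \<lambda>u. 1 / sqrt L * snd (pair_far L d 0) u)"
        using L by (simp add: pair_far_def rng_def ang_def remove_def wint_zero fun_eq_iff)
      from elim(2)[rule_format, OF this]
      have pn: "(pair_norm Q (\<gamma>(0 := d)) (pair_proj_perp Q (\<gamma>(0 := d))
         (space_B Q \<alpha> L (\<gamma>(0 := d))) (w_fun Q \<alpha> (\<gamma>(0 := d)), \<lambda>u. 0)))\<^sup>2 = (1 / sqrt L)\<^sup>2 / Bd d 0 0"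
        unfolding space_B_eq[OF elim(1)] w_fun_eq[OF elim(1)] .
      have "(1 / sqrt L)\<^sup>2 = 1 / L" using L by (simp add: power_divide)
      then show ?case
        unfolding pn unfolding star_norm_sq w_fun_eq[OF elim(1)] W_def[symmetric] point_range_bound_def
        using L elim(3) by (simp add: field_simps)
    qed
    show "((\<lambda>d. Cd d 0 0) \<longlongrightarrow> B 0 0) at_top" using Clim[of 0 0] by (simp add: C00)
    show "((\<lambda>d. Bd d 0 0) \<longlongrightarrow> B 0 0) at_top" using Blim[of 0 0] by simp
    show "B 0 0 \<noteq> 0" using Bpos[of 0] by simp
  qed
  have Zlim: "((\<lambda>d. 1 / (M * (cos (\<gamma> 1))\<^sup>2 * W d)) \<longlongrightarrow> 1 / Z) at_top"
    unfolding Z_def by (intro tendsto_intros Wlim) (use Z0 wint_w_pos in auto)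
  show ?direction
  proof (rule asymp_equiv_common_factor)
    have "1 < ?n" by auto
    from bound[OF this]
    show "\<forall>\<^sub>F d in at_top. cramer_rao Q \<alpha> L M N0 (E d) (\<gamma>(0 := d)) 1 = W d / (2 * E d / N0) * Cd d 1 1" .
    show "\<forall>\<^sub>F d in at_top. point_direction_bound M (\<gamma> 1) N0 (E d)
        = W d / (2 * E d / N0) * (1 / (M * (cos (\<gamma> 1))\<^sup>2 * W d))"
      using W0 by eventually_elim (simp add: point_direction_bound_def field_simps)
    show "((\<lambda>d. Cd d 1 1) \<longlongrightarrow> 1 / Z) at_top" using Clim[of 1 1] unfolding C11 by simp
    show "1 / Z \<noteq> 0" using Z by simp
  qed (rule Zlim)
  \<comment> \<open>To be read with \<open>t = 2 * E d / N0\<close> and \<open>b\<close> the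
    diagonal entry of the inverse Gram matrix; zero values of \<open>t\<close>, \<open>z\<close> and
    \<open>b\<close> are harmless because \<open>inverse 0 = 0\<close>.\<close>
  have sum_of_bounds: "inverse t * inverse z + inverse t * inverse (inverse w * (1\<^sup>2 / b))
      = w / t * (b + 1 / (z * w))" if "w \<noteq> 0" for t z w b :: real
    using that by (cases "t = 0"; cases "z = 0"; cases "b = 0") (auto simp: field_simps)
  show ?orientation
  proof (rule asymp_equiv_common_factor)
    have "2 < ?n" "1 < ?m" by auto
    from bound[OF this(1)]
    show "\<forall>\<^sub>F d in at_top. cramer_rao Q \<alpha> L M N0 (E d) (\<gamma>(0 := d)) 2 = W d / (2 * E d / N0) * Cd d 2 2" .
    show "\<forall>\<^sub>F d in at_top. point_direction_bound M (\<gamma> 1) N0 (E d) + inverse (2 * E d / N0) *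
            inverse (inverse ((star_norm Q (\<gamma>(0 := d)) (w_fun Q \<alpha> (\<gamma>(0 := d))))\<^sup>2) *
              (pair_norm Q (\<gamma>(0 := d)) (pair_proj_perp Q (\<gamma>(0 := d))
                (space_D Q \<alpha> L (\<gamma>(0 := d))) (pair_orient Q \<alpha> L (\<gamma>(0 := d)))))\<^sup>2)
        = W d / (2 * E d / N0) * (Bd d 1 1 + 1 / (M * (cos (\<gamma> 1))\<^sup>2 * W d))"
      using eventually_far residual[OF \<open>1 < ?m\<close>] Bd_ne[OF \<open>1 < ?m\<close>] W0
    proof eventually_elim
      case (elim d)
      have "pair_far L d 1 = (\<lambda>u. 1 * fst (pair_far L d 1) u, \<lambda>u. 1 * snd (pair_far L d 1) u)"
        by simp
      from elim(2)[rule_format, OF this]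
      have pn: "(pair_norm Q (\<gamma>(0 := d)) (pair_proj_perp Q (\<gamma>(0 := d))
         (space_D Q \<alpha> L (\<gamma>(0 := d))) (pair_orient Q \<alpha> L (\<gamma>(0 := d)))))\<^sup>2 = 1\<^sup>2 / Bd d 1 1"
        unfolding space_D_eq[OF elim(1)] pair_orient_eq[OF elim(1)] .
      show ?case
        unfolding pn unfolding star_norm_sq w_fun_eq[OF elim(1)] W_def[symmetric] point_direction_bound_def
        by (rule sum_of_bounds[OF elim(4)])
    qed
    show "((\<lambda>d. Cd d 2 2) \<longlongrightarrow> B 1 1 + 1 / Z) at_top" using Clim[of 2 2] unfolding C22 by simp
    show "((\<lambda>d. Bd d 1 1 + 1 / (M * (cos (\<gamma> 1))\<^sup>2 * W d)) \<longlongrightarrow> B 1 1 + 1 / Z) at_top"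
      using Blim[of 1 1] by (intro tendsto_add Zlim) simp
    have "1 < ?m" by simp
    from Bpos[OF this] Z show "B 1 1 + 1 / Z \<noteq> 0"
      using add_pos_pos[of "B 1 1" "1 / Z"] by simp
  qed
qed

end

text \<open>Approximation at long range is read as asymptotic equivalence as the range tends to
  infinity, all other parameters fixed. The energy hypothesis makes \<open>E\<close> eventually
  nonzero, without which the Fisher matrix would be zero; \<open>cos (\<gamma> 1) \<noteq> 0\<close>
  keeps the border entry of the direction positive.\<close>

theorem proposition4:
  fixes Q N :: nat and \<alpha> N0 B c G L M :: real
    and \<gamma> :: "nat \<Rightarrow> real" and E :: "real \<Rightarrow> real"
  assumes "Q \<ge> 1" and "N \<ge> 2"
    and "\<alpha> \<ge> 0" and "N0 > 0" and "B > 0" and "c > 0" and "G > 0"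
    and "L = (4 * pi * B / c)\<^sup>2" and "M = pi\<^sup>2 * ((real N)\<^sup>2 - 1) / 12"
    and "coeff_a \<gamma> 1 > 0" and "coeff_b Q \<gamma> 1 > 0"
    and regular: "\<And>u. 0 \<le> u \<Longrightarrow> u < 2 * pi \<Longrightarrow> rho_dot Q \<gamma> u \<noteq> 0"
    and direction: "cos (\<gamma> 1) \<noteq> 0"
    and energy: "E \<sim>[at_top] (\<lambda>d. (sqrt G / d\<^sup>2)\<^sup>2 * real N *
                   (star_norm Q (\<gamma>(0 := d)) (w_fun Q \<alpha> (\<gamma>(0 := d))))\<^sup>2)"
  shows "((\<lambda>d. cramer_rao Q \<alpha> L M N0 (E d) (\<gamma>(0 := d)) 0) \<sim>[at_top]
         (\<lambda>d. let \<gamma>d = \<gamma>(0 := d); w = w_fun Q \<alpha> \<gamma>d in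
            point_range_bound L N0 (E d) *
            inverse (inverse ((star_norm Q \<gamma>d w)\<^sup>2) *
              (pair_norm Q \<gamma>d (pair_proj_perp Q \<gamma>d (space_B Q \<alpha> L \<gamma>d) (w, \<lambda>u. 0)))\<^sup>2)))
       \<and> ((\<lambda>d. cramer_rao Q \<alpha> L M N0 (E d) (\<gamma>(0 := d)) 1) \<sim>[at_top]
         (\<lambda>d. point_direction_bound M (\<gamma> 1) N0 (E d)))
       \<and> ((\<lambda>d. cramer_rao Q \<alpha> L M N0 (E d) (\<gamma>(0 := d)) 2) \<sim>[at_top]
         (\<lambda>d. let \<gamma>d = \<gamma>(0 := d); w = w_fun Q \<alpha> \<gamma>d in
            point_direction_bound M (\<gamma> 1) N0 (E d) +
            inverse (2 * E d / N0) *
            inverse (inverse ((star_norm Q \<gamma>d w)\<^sup>2) *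
              (pair_norm Q \<gamma>d (pair_proj_perp Q \<gamma>d (space_D Q \<alpha> L \<gamma>d)
                 (pair_orient Q \<alpha> L \<gamma>d)))\<^sup>2)))"
proof -
  \<comment> \<open>Regularity is assumed on one period, while the locale asks for it on the whole
    line; parameters are reduced modulo \<open>2 * pi\<close>.\<close>
  have reg: "dcos_sum Q (coeff_a \<gamma>) u \<noteq> 0 \<or> dsin_sum Q (coeff_b Q \<gamma>) u \<noteq> 0" for u
  proof -
    define k where "k = \<lfloor>u / (2 * pi)\<rfloor>"
    define t where "t = u - 2 * pi * of_int k"
    have "of_int k \<le> u / (2 * pi)" "u / (2 * pi) < of_int k + 1"
      unfolding k_def by linarith+
    then have "0 \<le> t" "t < 2 * pi"
      by (simp_all add: t_def field_simps)
    from regular[OF this] have "dcos_sum Q (coeff_a \<gamma>) t \<noteq> 0 \<or> dsin_sum Q (coeff_b Q \<gamma>) t \<noteq> 0"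
      by (auto simp: rho_dot_eq zero_prod_def)
    moreover have "u = t + 2 * pi * of_int k" by (simp add: t_def)
    ultimately show ?thesis by (simp only: trig_sum_periodic)
  qed
  interpret far_target Q \<gamma> "cos (\<gamma> 1 - \<gamma> 2)" "sin (\<gamma> 1 - \<gamma> 2)" \<alpha>
    by unfold_locales (use assms reg in auto)
  have L: "L > 0" using assms by simp
  have "(real N)\<^sup>2 > 1" using \<open>N \<ge> 2\<close> by (intro one_less_power) auto
  then have M: "M > 0" unfolding \<open>M = _\<close> by simp
  have W: "\<forall>\<^sub>F d in at_top. wint (w_far d) (w_far d) \<noteq> 0"
    by (rule tendsto_imp_eventually_ne[OF wint_tendsto[OF bconv_w bconv_w]
          less_imp_neq[OF wint_w_pos, symmetric]])
  have "\<forall>\<^sub>F d in at_top. (sqrt G / d\<^sup>2)\<^sup>2 * real N * (star_norm Q (\<gamma>(0 := d)) (w_fun Q \<alpha> (\<gamma>(0 := d))))\<^sup>2 \<noteq> 0"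
    using eventually_far W
  proof eventually_elim
    case (elim d)
    then show ?case
      unfolding star_norm_sq w_fun_eq[OF elim(1)]
      using d_pos[OF elim(1)] \<open>G > 0\<close> \<open>N \<ge> 2\<close> by simp
  qed
  then have E: "\<forall>\<^sub>F d in at_top. E d \<noteq> 0"
    using asymp_equiv_eventually_zeros[OF energy] by eventually_elim blast
  show ?thesis
    unfolding Let_def using bounds_asymptotics[OF L M direction \<open>N0 > 0\<close> E] by blast
qed

end
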